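(* Let $\mathcal U$ be a subfield of $\mathbb R$. Suppose $A,B$ are positive matrices over $\mathcal U$ which are strong shift equivalent over $\mathbb R_+$. Then $A$ and $B$ are strong shift equivalent over $\mathcal U_+$, through positive matrices.
   Context: A matrix is positive if all its entries are positive. $\mathcal U_+=\mathcal U\cap[0,\infty)$. Square matrices $A,B$ are elementary strong shift equivalent (ESSE) over a semiring $\mathcal S$ if there are (possibly rectangular) matrices $R,S$ over $\mathcal S$ with $A=RS$ and $B=SR$. They are strong shift equivalent over $\mathcal S$ if they are connected by a finite chain of square matrices over $\mathcal S$ (possibly of different sizes) in which consecutive matrices are ESSE over $\mathcal S$; "through positive matrices" means that the matrices in the chain can all be taken positive. *)

theory Defs
  imports
    "Jordan_Normal_Form.Matrix"
    "HOL-Algebra.Subrings"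
    "HOL-Algebra.Algebraic_Closure_Type"
begin

abbreviation real_subfield :: "real set \<Rightarrow> bool" where
  "real_subfield U \<equiv> subfield U (ring_of_type_algebra :: real ring)"

lemma real_subfield_iff:
  "real_subfield U \<longleftrightarrow>
     0 \<in> U \<and> 1 \<in> U \<and> (\<forall>x\<in>U. \<forall>y\<in>U. x + y \<in> U \<and> x * y \<in> U)
       \<and> (\<forall>x\<in>U. - x \<in> U \<and> inverse x \<in> U)" (is "?L \<longleftrightarrow> ?R")
proof -
  let ?F = "ring_of_type_algebra :: real ring"
  interpret F: field ?F by (rule field_from_type_algebra)
  have ops: "carrier ?F = UNIV" "x \<otimes>\<^bsub>?F\<^esub> y = x * y" "x \<oplus>\<^bsub>?F\<^esub> y = x + y"
      "\<one>\<^bsub>?F\<^esub> = 1" "\<zero>\<^bsub>?F\<^esub> = 0" for x y :: real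
    by (simp_all add: ring_of_type_algebra_def)
  have neg: "\<ominus>\<^bsub>?F\<^esub> x = - x" for x :: real
    by (rule F.minus_equality) (simp_all add: ops)
  have inv: "m_inv ?F x = inverse x" if "x \<noteq> 0" for x :: real
    by (rule F.comm_inv_char) (use that in \<open>simp_all add: ops\<close>)
  show ?thesis
  proof
    assume L: ?L
    note sub = subringE[OF subfieldE(1)[OF L], unfolded ops neg]
    have "inverse x \<in> U" if "x \<in> U" for x
    proof (cases "x = 0")
      case False
      then show ?thesis
        using F.subfield_m_inv(1)[OF L, of x] that by (simp add: ops inv)
    qed (use sub in simp)
    then show ?R using sub by auto
  next
    assume R: ?R
    show ?L
    proof (rule F.subfieldI')
      show "subring U ?F"
        by (rule F.subringI) (use R in \<open>auto simp: ops neg\<close>)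
      show "m_inv ?F k \<in> U" if "k \<in> U - {\<zero>\<^bsub>?F\<^esub>}" for k
        using that R by (simp add: ops inv)
    qed
  qed
qed

definition mat_over :: "real set \<Rightarrow> real mat \<Rightarrow> bool" where
  "mat_over S M \<longleftrightarrow> elements_mat M \<subseteq> S"

definition positive_mat :: "real mat \<Rightarrow> bool" where
  "positive_mat M \<longleftrightarrow> (\<forall>x\<in>elements_mat M. 0 < x)"

text \<open>
  The type of matrices contains matrices without rows or columns.  They are excluded
  throughout: all dimensions of the matrices below are at least 1.
\<close>

definition ESSE :: "real set \<Rightarrow> real mat \<Rightarrow> real mat \<Rightarrow> bool" where
  "ESSE S A B \<longleftrightarrow>
     (\<exists>m n V W. 0 < m \<and> 0 < n \<and> V \<in> carrier_mat m n \<and> W \<in> carrier_mat n m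
        \<and> mat_over S V \<and> mat_over S W \<and> A = V * W \<and> B = W * V)"

text \<open>
  The list \<open>Ms\<close> is the chain joining \<open>A\<close> to \<open>B\<close>, both ends included, and \<open>P\<close> is an
  additional property required of each of its members.
\<close>

definition SSE_through :: "(real mat \<Rightarrow> bool) \<Rightarrow> real set \<Rightarrow> real mat \<Rightarrow> real mat \<Rightarrow> bool" where
  "SSE_through P S A B \<longleftrightarrow>
     (\<exists>Ms. Ms \<noteq> [] \<and> hd Ms = A \<and> last Ms = B
        \<and> (\<forall>M\<in>set Ms. square_mat M \<and> 0 < dim_row M \<and> mat_over S M \<and> P M)
        \<and> successively (ESSE S) Ms)"

abbreviation SSE :: "real set \<Rightarrow> real mat \<Rightarrow> real mat \<Rightarrow> bool" where
  "SSE \<equiv> SSE_through (\<lambda>_. True)"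

end

theory Submission
  imports Defs "Jordan_Normal_Form.Determinant" "HOL-Analysis.Product_Vector"
begin

text \<open>
  The proof has a real half and a descent half.

  Real half. After deleting the indices that no bi-infinite path visits, every elementary equivalence
  \<open>A = V W\<close>, \<open>B = W V\<close> of the given chain has a factor \<open>V\<close> without zero rows or columns. On the index set
  \<open>{(i,j). 0 < V\<^sub>i\<^sub>j}\<close> there is then a matrix that arises from \<open>A\<close> by splitting rows and from which \<open>B\<close>
  arises by merging columns. A merging followed by a splitting can be replaced by a splitting followed
  by a merging, so the whole chain can be given a single peak \<open>E\<close>: repeated row splittings lead from \<open>A\<close>
  to \<open>E\<close>, and from the transpose of \<open>B\<close> to the transpose of \<open>E\<close> (lemma \<open>common_peak\<close>). The peak is usually
  not positive, but
  \<open>(1 + t Y) E (1 + t Y)\<^sup>-\<^sup>1 = E + t (Y E - E Y) + O(t\<^sup>2)\<close>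
  is positive for all small \<open>t > 0\<close> once \<open>Y E - E Y\<close> is positive at the zeros of \<open>E\<close>. Such a \<open>Y\<close> is obtained
  by averaging over the fibres of the splittings, later splittings having much larger weights
  (lemma \<open>spreadable_up\<close>). All these positive conjugates of \<open>E\<close>, the ones coming from \<open>A\<close> and the ones
  coming from \<open>B\<close>, are joined by paths of positive conjugates.

  Descent half. A real matrix \<open>C\<close> is called reached from \<open>A\<close> if conjugations tending to the identity move
  it to matrices over the subfield \<open>U\<close> that are joined to \<open>A\<close> by chains of positive matrices over \<open>U\<close>.
  This notion is invariant along paths of positive conjugates (lemma \<open>Reach_path\<close>), because a
  conjugation near the identity is a product of two elementary equivalences with positive
  intermediate matrix. It also passes from \<open>D = S P\<close> to \<open>P S\<close> for a row splitting (lemma \<open>Reach_split\<close>).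
  This is the delicate point: the class of \<open>P S\<close> depends not only on that of \<open>D\<close> but also on the position
  of the kernel of \<open>P\<close> with respect to the images of the powers of \<open>D\<close>. The kernel is
  moved to a subspace spanned by vectors over \<open>U\<close> by a matrix close to the identity which commutes with
  \<open>D\<close> and thus preserves those images; what remains is a linear system over \<open>U\<close>, whose solutions over
  \<open>U\<close> are dense among the real ones (lemma \<open>split_over_subfield\<close>).

  Both \<open>A\<close> and \<open>B\<close> reach one positive conjugate of \<open>E\<close>. Close to it lie two matrices over \<open>U\<close>, one joined to
  \<open>A\<close> and one to \<open>B\<close>, which are conjugate by a real matrix near the identity, hence also by one over \<open>U\<close>,
  and so are joined to each other (lemma \<open>Reach_join\<close>).
\<close>

section \<open>Matrices by dimension\<close>

lemma mult_assoc_dim: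
  "dim_col A = dim_row B \<Longrightarrow> dim_col B = dim_row C \<Longrightarrow> A * B * C = A * (B * C)"
  for A B C :: "real mat"
  by (rule assoc_mult_mat[of _ "dim_row A" "dim_col A" _ "dim_col B" _ "dim_col C"]) auto

lemma mult_add_dim:
  "dim_col A = dim_row B \<Longrightarrow> dim_row B = dim_row C \<Longrightarrow> dim_col B = dim_col C
     \<Longrightarrow> A * (B + C) = A * B + A * C" for A B C :: "real mat"
  by (rule mult_add_distrib_mat[of _ "dim_row A" "dim_col A" _ "dim_col B"]) auto

lemma add_mult_dim:
  "dim_col A = dim_row C \<Longrightarrow> dim_row A = dim_row B \<Longrightarrow> dim_col A = dim_col B
     \<Longrightarrow> (A + B) * C = A * C + B * C" for A B C :: "real mat"
  by (rule add_mult_distrib_mat[of _ "dim_row A" "dim_col A" _ _ "dim_col C"]) auto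

lemma mult_minus_dim:
  "dim_col A = dim_row B \<Longrightarrow> dim_row B = dim_row C \<Longrightarrow> dim_col B = dim_col C
     \<Longrightarrow> A * (B - C) = A * B - A * C" for A B C :: "real mat"
  by (rule mult_minus_distrib_mat[of _ "dim_row A" "dim_col A" _ "dim_col B"]) auto

lemma minus_mult_dim:
  "dim_col A = dim_row C \<Longrightarrow> dim_row A = dim_row B \<Longrightarrow> dim_col A = dim_col B
     \<Longrightarrow> (A - B) * C = A * C - B * C" for A B C :: "real mat"
  by (rule minus_mult_distrib_mat[of _ "dim_row A" "dim_col A" _ _ "dim_col C"]) (auto intro: carrier_matI)

lemma one_mult_dim: "dim_row A = n \<Longrightarrow> 1\<^sub>m n * A = A" for A :: "real mat"
  by (rule left_mult_one_mat[of _ _ "dim_col A"]) auto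

lemma mult_one_dim: "dim_col A = n \<Longrightarrow> A * 1\<^sub>m n = A" for A :: "real mat"
  by (rule right_mult_one_mat[of _ "dim_row A"]) auto

lemma smult_mult_dim: "dim_col A = dim_row B \<Longrightarrow> (c \<cdot>\<^sub>m A) * B = c \<cdot>\<^sub>m (A * B)" for A B :: "real mat"
  by (rule mult_smult_assoc_mat[of _ "dim_row A" "dim_col A" _ "dim_col B"]) auto

lemma mult_smult_dim: "dim_col A = dim_row B \<Longrightarrow> A * (c \<cdot>\<^sub>m B) = c \<cdot>\<^sub>m (A * B)" for A B :: "real mat"
  by (rule mult_smult_distrib[of _ "dim_row A" "dim_col A" _ "dim_col B"]) auto

lemma transpose_mult_dim: "dim_col A = dim_row B \<Longrightarrow> (A * B)\<^sup>T = B\<^sup>T * A\<^sup>T" for A B :: "real mat"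
  by (rule transpose_mult[of _ "dim_row A" "dim_col A" _ "dim_col B"]) auto

lemma zero_mult_dim: "dim_row A = n \<Longrightarrow> 0\<^sub>m k n * A = 0\<^sub>m k (dim_col A)" for A :: "real mat"
  by (rule left_mult_zero_mat[of _ _ "dim_col A"]) auto

lemma mult_zero_dim: "dim_col A = n \<Longrightarrow> A * 0\<^sub>m n k = 0\<^sub>m (dim_row A) k" for A :: "real mat"
  by (rule right_mult_zero_mat[of _ "dim_row A"]) auto

lemmas mat_dim = mult_assoc_dim mult_add_dim add_mult_dim mult_minus_dim minus_mult_dim
  one_mult_dim mult_one_dim smult_mult_dim mult_smult_dim

text \<open>
  With the entries of a product left unevaluated, an identity between sums of products
  is checked entrywise by treating each product as an atom.
\<close>

declare index_mult_mat(1) [simp del]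

lemma mult_entry:
  "i < dim_row A \<Longrightarrow> j < dim_col B \<Longrightarrow> dim_col A = dim_row B
     \<Longrightarrow> (A * B) $$ (i,j) = (\<Sum>k<dim_row B. A $$ (i,k) * B $$ (k,j))" for A B :: "real mat"
  by (simp add: times_mat_def scalar_prod_def lessThan_atLeast0)

definition inverses :: "nat \<Rightarrow> real mat \<Rightarrow> real mat \<Rightarrow> bool" where
  "inverses n g h \<longleftrightarrow> g \<in> carrier_mat n n \<and> h \<in> carrier_mat n n \<and> g * h = 1\<^sub>m n \<and> h * g = 1\<^sub>m n"

lemma inversesD:
  assumes "inverses n g h"
  shows "dim_row g = n" "dim_col g = n" "dim_row h = n" "dim_col h = n"
    "g * h = 1\<^sub>m n" "h * g = 1\<^sub>m n"
  using assms by (auto simp: inverses_def)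

lemma inverses_cancel:
  assumes "inverses n g h" "dim_row Z = n"
  shows "g * (h * Z) = Z" "h * (g * Z) = Z"
  using inversesD[OF assms(1)] assms(2) by (simp_all add: one_mult_dim flip: mult_assoc_dim)

lemma inverses_sym: "inverses n g h \<Longrightarrow> inverses n h g"
  by (auto simp: inverses_def)

lemma inverses_one: "inverses n (1\<^sub>m n) (1\<^sub>m n)"
  by (auto simp: inverses_def)

lemma inverses_mult:
  assumes a: "inverses n g h" and b: "inverses n g' h'"
  shows "inverses n (g * g') (h' * h)"
proof -
  note d = inversesD(1-4)[OF a] inversesD(1-4)[OF b]
  have "g * g' * (h' * h) = g * (g' * (h' * h))" by (rule mult_assoc_dim) (simp_all add: d)
  then have 1: "g * g' * (h' * h) = 1\<^sub>m n"
    using inverses_cancel(1)[OF b, of h] inversesD(5)[OF a] by (simp add: d)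
  have "h' * h * (g * g') = h' * (h * (g * g'))" by (rule mult_assoc_dim) (simp_all add: d)
  then have "h' * h * (g * g') = 1\<^sub>m n"
    using inverses_cancel(2)[OF a, of g'] inversesD(6)[OF b] by (simp add: d)
  with 1 show ?thesis unfolding inverses_def by (intro conjI carrier_matI) (simp_all add: d)
qed

lemma inverses_transpose: "inverses n g h \<Longrightarrow> inverses n g\<^sup>T h\<^sup>T"
  by (auto simp: inverses_def simp flip: transpose_mult_dim)

lemma inverses_unique: "inverses n g h \<Longrightarrow> inverses n g k \<Longrightarrow> h = k"
  using inverses_cancel(2)[of n g h k] inversesD[of n g h] inversesD[of n g k]
  by (simp add: mult_one_dim)

definition nonneg_mat :: "real mat \<Rightarrow> bool" where
  "nonneg_mat M \<longleftrightarrow> (\<forall>i<dim_row M. \<forall>j<dim_col M. 0 \<le> M $$ (i,j))"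

lemma in_elements_mat_iff:
  "x \<in> elements_mat M \<longleftrightarrow> (\<exists>i<dim_row M. \<exists>j<dim_col M. x = M $$ (i,j))"
  by (blast intro: elements_matI[OF carrier_matI[OF refl refl]])

lemma positive_mat_iff:
  "positive_mat M \<longleftrightarrow> (\<forall>i<dim_row M. \<forall>j<dim_col M. 0 < M $$ (i,j))"
  by (auto simp: positive_mat_def in_elements_mat_iff)

lemma mat_over_iff:
  "mat_over U M \<longleftrightarrow> (\<forall>i<dim_row M. \<forall>j<dim_col M. M $$ (i,j) \<in> U)"
  by (auto simp: mat_over_def in_elements_mat_iff)

lemma positive_imp_nonneg: "positive_mat M \<Longrightarrow> nonneg_mat M"
  by (auto simp: positive_mat_iff nonneg_mat_def less_imp_le)

lemma mat_over_nonneg_iff: "mat_over (U \<inter> {0..}) M \<longleftrightarrow> mat_over U M \<and> nonneg_mat M"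
  by (auto simp: mat_over_iff nonneg_mat_def)

lemma nonneg_mult:
  "nonneg_mat A \<Longrightarrow> nonneg_mat B \<Longrightarrow> dim_col A = dim_row B \<Longrightarrow> nonneg_mat (A * B)"
  by (auto simp: nonneg_mat_def mult_entry intro!: sum_nonneg)

lemma positive_mult:
  assumes "positive_mat A" "positive_mat B" "dim_col A = dim_row B" "0 < dim_col A"
  shows "positive_mat (A * B)"
  using assms by (auto simp: positive_mat_iff mult_entry intro!: sum_pos)

lemma nonneg_transpose [simp]: "nonneg_mat M\<^sup>T \<longleftrightarrow> nonneg_mat M"
  by (auto simp: nonneg_mat_def)
lemma positive_transpose [simp]: "positive_mat M\<^sup>T \<longleftrightarrow> positive_mat M"
  by (auto simp: positive_mat_iff)
lemma mat_over_transpose [simp]: "mat_over U M\<^sup>T \<longleftrightarrow> mat_over U M"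
  by (auto simp: mat_over_iff)

section \<open>Entrywise limits and inverses\<close>

text \<open>
  Constant dimensions are part of the notion of limit, which makes the algebraic rules below hold
  without further conditions on the individual matrices.
\<close>

definition mlim :: "('x \<Rightarrow> real mat) \<Rightarrow> real mat \<Rightarrow> 'x filter \<Rightarrow> bool" where
  "mlim Z L F \<longleftrightarrow> (\<forall>x. dim_row (Z x) = dim_row L \<and> dim_col (Z x) = dim_col L) \<and>
     (\<forall>i<dim_row L. \<forall>j<dim_col L. ((\<lambda>x. Z x $$ (i,j)) \<longlongrightarrow> L $$ (i,j)) F)"

lemma mlimD:
  assumes "mlim Z L F"
  shows "dim_row (Z x) = dim_row L" "dim_col (Z x) = dim_col L"
    "i < dim_row L \<Longrightarrow> j < dim_col L \<Longrightarrow> ((\<lambda>x. Z x $$ (i,j)) \<longlongrightarrow> L $$ (i,j)) F"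
  using assms by (auto simp: mlim_def)

lemma mlim_const: "mlim (\<lambda>_. L) L F" by (auto simp: mlim_def)

lemma mlim_add:
  "mlim Z L F \<Longrightarrow> mlim Y K F \<Longrightarrow> dim_row L = dim_row K \<Longrightarrow> dim_col L = dim_col K
    \<Longrightarrow> mlim (\<lambda>x. Z x + Y x) (L + K) F"
  by (auto simp: mlim_def intro!: tendsto_add)

lemma mlim_minus:
  "mlim Z L F \<Longrightarrow> mlim Y K F \<Longrightarrow> dim_row L = dim_row K \<Longrightarrow> dim_col L = dim_col K
    \<Longrightarrow> mlim (\<lambda>x. Z x - Y x) (L - K) F"
  by (auto simp: mlim_def intro!: tendsto_diff)

lemma mlim_mult:
  "mlim Z L F \<Longrightarrow> mlim Y K F \<Longrightarrow> dim_col L = dim_row K \<Longrightarrow> mlim (\<lambda>x. Z x * Y x) (L * K) F"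
  by (auto simp: mlim_def mult_entry intro!: tendsto_sum tendsto_mult)

lemma mlim_smult:
  "(c \<longlongrightarrow> d) F \<Longrightarrow> mlim Z L F \<Longrightarrow> mlim (\<lambda>x. c x \<cdot>\<^sub>m Z x) (d \<cdot>\<^sub>m L) F"
  by (auto simp: mlim_def intro!: tendsto_mult)

lemma mlim_transpose: "mlim Z L F \<Longrightarrow> mlim (\<lambda>x. (Z x)\<^sup>T) L\<^sup>T F"
  by (auto simp: mlim_def)

lemma mlim_compose: "mlim Z L G \<Longrightarrow> filterlim f G F \<Longrightarrow> mlim (\<lambda>x. Z (f x)) L F"
  by (auto simp: mlim_def intro: filterlim_compose[of _ _ G])

lemma eventually_positive_entries:
  assumes "mlim Z L F" "positive_mat L"
  shows "eventually (\<lambda>x. positive_mat (Z x)) F"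
proof -
  have "\<forall>\<^sub>F x in F. \<forall>i\<in>{..<dim_row L}. \<forall>j\<in>{..<dim_col L}. 0 < Z x $$ (i,j)"
    by (intro eventually_ball_finite ballI finite_lessThan)
       (use assms in \<open>auto simp: positive_mat_iff intro: order_tendstoD(1)[OF mlimD(3)]\<close>)
  then show ?thesis
    by eventually_elim (use mlimD(1,2)[OF assms(1)] in \<open>auto simp: positive_mat_iff\<close>)
qed

lemma mlim_eventually_close:
  assumes Z: "mlim Z L F" and "0 < e"
  shows "\<forall>\<^sub>F x in F. \<forall>i<dim_row L. \<forall>j<dim_col L. \<bar>Z x $$ (i,j) - L $$ (i,j)\<bar> < e"
proof -
  have "\<forall>\<^sub>F x in F. \<forall>i\<in>{..<dim_row L}. \<forall>j\<in>{..<dim_col L}. dist (Z x $$ (i,j)) (L $$ (i,j)) < e"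
    by (intro eventually_ball_finite ballI finite_lessThan)
       (use assms(2) in \<open>auto intro!: tendstoD[OF mlimD(3)[OF Z]]\<close>)
  then show ?thesis by eventually_elim (auto simp: dist_real_def)
qed

lemma mlim_close:
  assumes L: "mlim L M sequentially" and d: "\<And>k. dim_row (Z k) = dim_row M" "\<And>k. dim_col (Z k) = dim_col M"
    and close: "\<And>k i j. i < dim_row M \<Longrightarrow> j < dim_col M \<Longrightarrow> \<bar>Z k $$ (i,j) - L k $$ (i,j)\<bar> < inverse (real (Suc k))"
  shows "mlim Z M sequentially"
  unfolding mlim_def
proof (intro conjI allI impI)
  fix i j assume ij: "i < dim_row M" "j < dim_col M"
  have "(\<lambda>k. Z k $$ (i,j) - L k $$ (i,j)) \<longlonglongrightarrow> 0"
    by (rule metric_tendsto_imp_tendsto[OF LIMSEQ_inverse_real_of_nat])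
       (use close[OF ij] in \<open>auto simp: dist_real_def intro!: always_eventually less_imp_le\<close>)
  from tendsto_add[OF this mlimD(3)[OF L ij]] show "(\<lambda>k. Z k $$ (i,j)) \<longlonglongrightarrow> M $$ (i,j)" by simp
qed (use d in auto)

text \<open>
  Cramer's rule makes it evident that inversion is continuous and does not leave a field
  containing the entries.
\<close>

definition minv :: "real mat \<Rightarrow> real mat" where
  "minv g = inverse (det g) \<cdot>\<^sub>m adj_mat g"

lemma minv_dim [simp]: "dim_row (minv g) = dim_row g" "dim_col (minv g) = dim_col g"
  by (auto simp: minv_def adj_mat_def)

lemma inverses_minv:
  assumes "g \<in> carrier_mat n n" "det g \<noteq> 0"
  shows "inverses n g (minv g)"
  using adj_mat[OF assms(1)] assms
  by (auto simp: inverses_def minv_def mat_dim intro!: eq_matI)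

lemma det_tendsto:
  assumes "mlim Z L F" "dim_row L = n" "dim_col L = n"
  shows "((\<lambda>x. det (Z x)) \<longlongrightarrow> det L) F"
proof -
  have "det (Z x) = (\<Sum>p | p permutes {0..<n}. signof p * (\<Prod>i = 0..<n. Z x $$ (i, p i)))" for x
    using mlimD(1,2)[OF assms(1), of x] assms(2,3) by (simp add: det_def)
  moreover have "det L = (\<Sum>p | p permutes {0..<n}. signof p * (\<Prod>i = 0..<n. L $$ (i, p i)))"
    using assms(2,3) by (simp add: det_def)
  moreover have "((\<lambda>x. Z x $$ (i, p i)) \<longlongrightarrow> L $$ (i, p i)) F"
    if "p permutes {0..<n}" "i \<in> {0..<n}" for p i
    using that permutes_in_image[OF that(1), of i] assms(2,3) by (intro mlimD(3)[OF assms(1)]) auto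
  ultimately show ?thesis
    by (simp only:) (intro tendsto_sum tendsto_mult tendsto_prod tendsto_const; simp)
qed

lemma cofactor_tendsto:
  assumes Z: "mlim Z L F" and L: "dim_row L = n" "dim_col L = n" and ij: "i < n" "j < n"
  shows "((\<lambda>x. cofactor (Z x) i j) \<longlongrightarrow> cofactor L i j) F"
proof -
  note D = mlimD(1,2)[OF Z, unfolded L]
  have "mlim (\<lambda>x. mat_delete (Z x) i j) (mat_delete L i j) F"
    unfolding mlim_def
    by (auto simp: mat_delete_def D L intro!: mlimD(3)[OF Z] less_diff_conv)
  then have "((\<lambda>x. det (mat_delete (Z x) i j)) \<longlongrightarrow> det (mat_delete L i j)) F"
    by (rule det_tendsto) (auto simp: L)
  then show ?thesis unfolding cofactor_def by (intro tendsto_mult tendsto_const)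
qed

lemma mlim_minv:
  assumes Z: "mlim Z L F" and L: "dim_row L = n" "dim_col L = n" and "det L \<noteq> 0"
  shows "mlim (\<lambda>x. minv (Z x)) (minv L) F"
proof -
  note D = mlimD(1,2)[OF Z, unfolded L]
  have "mlim (\<lambda>x. adj_mat (Z x)) (adj_mat L) F"
    unfolding mlim_def
    by (auto simp: adj_mat_def D L intro!: cofactor_tendsto[OF Z, where n=n])
  then show ?thesis
    unfolding minv_def using assms by (intro mlim_smult tendsto_inverse det_tendsto[OF Z])
qed

lemma minv_one: "minv (1\<^sub>m n) = 1\<^sub>m n"
  by (rule inverses_unique[OF inverses_minv inverses_one]) auto

lemma mlim_minv_one: "mlim Z (1\<^sub>m n) F \<Longrightarrow> mlim (\<lambda>x. minv (Z x)) (1\<^sub>m n) F"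
  using mlim_minv[of Z "1\<^sub>m n" F n] by (simp add: minv_one)

lemma eventually_inverses:
  assumes Z: "mlim Z L F" and L: "dim_row L = n" "dim_col L = n" and "det L \<noteq> 0"
  shows "eventually (\<lambda>x. inverses n (Z x) (minv (Z x))) F"
proof -
  have "eventually (\<lambda>x. det (Z x) \<noteq> 0) F"
    using tendsto_imp_eventually_ne[OF det_tendsto[OF Z L]] assms(4) by auto
  then show ?thesis
    by eventually_elim (use mlimD(1,2)[OF Z] L in \<open>auto intro!: inverses_minv\<close>)
qed

lemma det_nonzero_of_inverses:
  assumes "inverses n g h" shows "det g \<noteq> 0"
proof -
  have "det (g * h) = det g * det h" by (rule det_mult) (use assms in \<open>auto simp: inverses_def\<close>)
  then have "det g * det h = 1" unfolding inversesD(5)[OF assms] by simp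
  then show ?thesis by auto
qed

lemma minv_eqI:
  assumes "inverses n g h" shows "minv g = h"
  by (rule inverses_unique[OF inverses_minv assms])
     (use assms det_nonzero_of_inverses[OF assms] in \<open>auto simp: inverses_def\<close>)

section \<open>Matrices over a subfield of the reals\<close>

locale real_subfield_loc =
  fixes U :: "real set"
  assumes subfield: "real_subfield U"
begin

lemma zero_in: "0 \<in> U" and one_in: "1 \<in> U"
  and add_in: "x \<in> U \<Longrightarrow> y \<in> U \<Longrightarrow> x + y \<in> U"
  and mult_in: "x \<in> U \<Longrightarrow> y \<in> U \<Longrightarrow> x * y \<in> U"
  and uminus_in: "x \<in> U \<Longrightarrow> - x \<in> U"
  and inverse_in: "x \<in> U \<Longrightarrow> inverse x \<in> U"
  using subfield by (auto simp: real_subfield_iff)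

lemma diff_in: "x \<in> U \<Longrightarrow> y \<in> U \<Longrightarrow> x - y \<in> U"
  using add_in[of x "- y"] uminus_in[of y] by simp

lemma sum_in: "(\<And>i. i \<in> I \<Longrightarrow> f i \<in> U) \<Longrightarrow> sum f I \<in> U"
  by (induction I rule: infinite_finite_induct) (auto simp: zero_in add_in)

lemma prod_in: "(\<And>i. i \<in> I \<Longrightarrow> f i \<in> U) \<Longrightarrow> prod f I \<in> U"
  by (induction I rule: infinite_finite_induct) (auto simp: one_in mult_in)

lemma of_nat_in: "of_nat k \<in> U"
  by (induction k) (auto simp: zero_in one_in add_in)

lemma of_int_in: "of_int k \<in> U"
  by (cases k rule: int_cases2) (auto simp: of_nat_in uminus_in)

lemma power_in: "x \<in> U \<Longrightarrow> x ^ k \<in> U"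
  by (induction k) (auto simp: one_in mult_in)

lemma mat_over_mult:
  "mat_over U A \<Longrightarrow> mat_over U B \<Longrightarrow> dim_col A = dim_row B \<Longrightarrow> mat_over U (A * B)"
  by (auto simp: mat_over_iff mult_entry intro!: sum_in mult_in)

lemma mat_over_add:
  "mat_over U A \<Longrightarrow> mat_over U B \<Longrightarrow> dim_row A = dim_row B \<Longrightarrow> dim_col A = dim_col B
     \<Longrightarrow> mat_over U (A + B)"
  by (auto simp: mat_over_iff intro!: add_in)

lemma mat_over_minus:
  "mat_over U A \<Longrightarrow> mat_over U B \<Longrightarrow> dim_row A = dim_row B \<Longrightarrow> dim_col A = dim_col B
     \<Longrightarrow> mat_over U (A - B)"
  by (auto simp: mat_over_iff intro!: diff_in)

lemma mat_over_smult: "c \<in> U \<Longrightarrow> mat_over U A \<Longrightarrow> mat_over U (c \<cdot>\<^sub>m A)"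
  by (auto simp: mat_over_iff intro!: mult_in)

lemma mat_over_one: "mat_over U (1\<^sub>m n)"
  by (auto simp: mat_over_iff zero_in one_in)

lemma det_in:
  assumes "mat_over U A" shows "det A \<in> U"
proof (cases "dim_row A = dim_col A")
  case True
  have "A $$ (i, p i) \<in> U" if "p permutes {0..<dim_row A}" "i \<in> {0..<dim_row A}" for p i
    using assms that permutes_in_image[OF that(1), of i] True by (auto simp: mat_over_iff)
  moreover have "signof p \<in> U" for p :: "nat \<Rightarrow> nat"
    by (auto simp: sign_def one_in uminus_in)
  ultimately show ?thesis unfolding det_def using True
    by (auto intro!: sum_in mult_in prod_in)
qed (auto simp: det_def zero_in)

lemma mat_over_minv:
  assumes "mat_over U A" "dim_row A = dim_col A" shows "mat_over U (minv A)"
proof -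
  have "cofactor A j i \<in> U" if "i < dim_row A" "j < dim_row A" for i j
  proof -
    have "mat_over U (mat_delete A j i)"
      using assms that by (auto simp: mat_over_iff mat_delete_def)
    then show ?thesis
      unfolding cofactor_def by (intro mult_in power_in det_in) (auto simp: one_in uminus_in)
  qed
  then have "mat_over U (adj_mat A)" using assms(2) by (auto simp: mat_over_iff adj_mat_def)
  then show ?thesis unfolding minv_def by (intro mat_over_smult inverse_in det_in assms(1))
qed

lemma dense_sequence: "\<exists>q::nat \<Rightarrow> real. (\<forall>n. q n \<in> U) \<and> q \<longlonglongrightarrow> x"
proof -
  define q :: "nat \<Rightarrow> real" where "q n = of_int \<lfloor>x * of_nat (Suc n)\<rfloor> * inverse (of_nat (Suc n))" for n
  have bound: "\<bar>q n - x\<bar> \<le> inverse (real (Suc n))" for n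
  proof -
    have "q n - x = (of_int \<lfloor>x * of_nat (Suc n)\<rfloor> - x * of_nat (Suc n)) * inverse (of_nat (Suc n))"
      unfolding q_def by (simp add: left_diff_distrib del: of_nat_Suc)
    moreover have "\<bar>of_int \<lfloor>x * of_nat (Suc n)\<rfloor> - x * of_nat (Suc n)\<bar> \<le> 1"
      by (simp add: abs_le_iff) linarith
    ultimately show ?thesis
      by (simp add: abs_mult mult_left_le_one_le del: of_nat_Suc)
  qed
  have "q \<longlonglongrightarrow> x"
    by (rule metric_tendsto_imp_tendsto[OF LIMSEQ_inverse_real_of_nat])
       (use bound in \<open>auto simp: dist_real_def\<close>)
  moreover have "q n \<in> U" for n unfolding q_def by (intro mult_in inverse_in of_int_in of_nat_in)
  ultimately show ?thesis by blast
qed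

lemma dense_matrix: "\<exists>Q::nat \<Rightarrow> real mat. mlim Q M sequentially \<and> (\<forall>k. mat_over U (Q k))"
proof -
  obtain q where q: "\<And>x n. q x n \<in> U" "\<And>x. q x \<longlonglongrightarrow> x"
    using dense_sequence by metis
  have "mlim (\<lambda>k. map_mat (\<lambda>x. q x k) M) M sequentially"
    by (auto simp: mlim_def q)
  then show ?thesis using q(1) by (intro exI[of _ "\<lambda>k. map_mat (\<lambda>x. q x k) M"]) (auto simp: mat_over_iff)
qed

section \<open>Chains of positive matrices\<close>

definition vertex :: "real mat \<Rightarrow> bool" where
  "vertex C \<longleftrightarrow> square_mat C \<and> 0 < dim_row C \<and> mat_over U C \<and> positive_mat C"

definition sse_step :: "real mat \<Rightarrow> real mat \<Rightarrow> bool" where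
  "sse_step C D \<longleftrightarrow> vertex C \<and> vertex D \<and> ESSE (U \<inter> {0..}) C D"

abbreviation sse_pos :: "real mat \<Rightarrow> real mat \<Rightarrow> bool" where
  "sse_pos \<equiv> sse_step\<^sup>*\<^sup>*"

lemma sse_step_sym: "sse_step C D \<Longrightarrow> sse_step D C"
  unfolding sse_step_def ESSE_def by blast

lemma sse_pos_sym: "sse_pos C D \<Longrightarrow> sse_pos D C"
  by (induction rule: rtranclp_induct)
     (auto intro: converse_rtranclp_into_rtranclp sse_step_sym)

lemma vertex_transpose: "vertex C \<Longrightarrow> vertex C\<^sup>T"
  by (auto simp: vertex_def)

lemma sse_pos_transpose: "sse_pos C D \<Longrightarrow> sse_pos C\<^sup>T D\<^sup>T"
proof (induction rule: rtranclp_induct)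
  case (step D E)
  then obtain m n V W where VW: "0 < m" "0 < n" "V \<in> carrier_mat m n" "W \<in> carrier_mat n m"
    "mat_over (U \<inter> {0..}) V" "mat_over (U \<inter> {0..}) W" "D = V * W" "E = W * V"
    by (auto simp: sse_step_def ESSE_def)
  have "ESSE (U \<inter> {0..}) D\<^sup>T E\<^sup>T"
    unfolding ESSE_def using VW
    by (intro exI[of _ m] exI[of _ n] exI[of _ "W\<^sup>T"] exI[of _ "V\<^sup>T"])
       (auto simp: transpose_mult_dim)
  with step show ?case
    by (auto simp: sse_step_def intro: vertex_transpose rtranclp.rtrancl_into_rtrancl)
qed simp

lemma SSE_through_of_sse_pos:
  assumes "vertex C" "sse_pos C D"
  shows "SSE_through positive_mat (U \<inter> {0..}) C D"
  using assms(2)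
proof (induction rule: rtranclp_induct)
  case base
  show ?case unfolding SSE_through_def
    using assms(1) by (intro exI[of _ "[C]"]) (auto simp: vertex_def mat_over_nonneg_iff positive_imp_nonneg)
next
  case (step D E)
  then obtain Ms where Ms: "Ms \<noteq> []" "hd Ms = C" "last Ms = D"
    "\<forall>M\<in>set Ms. square_mat M \<and> 0 < dim_row M \<and> mat_over (U \<inter> {0..}) M \<and> positive_mat M"
    "successively (ESSE (U \<inter> {0..})) Ms"
    by (auto simp: SSE_through_def)
  show ?case unfolding SSE_through_def
    using Ms step(2)
    by (intro exI[of _ "Ms @ [E]"])
       (auto simp: sse_step_def vertex_def mat_over_nonneg_iff positive_imp_nonneg successively_append_iff)
qed

lemma sse_pos_factors:
  assumes "vertex C" "vertex D" "C = V * W" "D = W * V"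
    "dim_col V = dim_row W" "dim_col W = dim_row V"
    "mat_over U V" "mat_over U W" "nonneg_mat V" "nonneg_mat W"
  shows "sse_pos C D"
proof -
  have "ESSE (U \<inter> {0..}) C D"
    unfolding ESSE_def using assms
    by (intro exI[of _ "dim_row V"] exI[of _ "dim_col V"] exI[of _ V] exI[of _ W])
       (auto simp: vertex_def mat_over_nonneg_iff)
  then show ?thesis using assms by (auto simp: sse_step_def)
qed

text \<open>
  The two matrices are joined through \<open>g' C g\<close>: the pairs of factors are \<open>(g, g' C)\<close> and
  \<open>(q g, g' C q')\<close>. For a fixed positive \<open>g\<close> the conditions are satisfied by all \<open>q\<close> near the identity,
  whatever the signs of the entries of \<open>q - 1\<close>.
\<close>

lemma sse_pos_conjugate:
  assumes C: "vertex C" "C \<in> carrier_mat n n" and C1: "vertex (q * C * q')"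
    and q: "inverses n q q'" "mat_over U q" "mat_over U q'"
    and g: "inverses n g g'" "mat_over U g" "mat_over U g'"
    and pos: "positive_mat g" "positive_mat (g' * C)" "nonneg_mat (q * g)" "nonneg_mat (g' * C * q')"
  shows "sse_pos C (q * C * q')"
proof -
  note d = inversesD(1-4)[OF q(1)] inversesD(1-4)[OF g(1)] carrier_matD[OF C(2)]
  have n: "0 < n" using C d by (auto simp: vertex_def)
  have over: "mat_over U C" using C by (simp add: vertex_def)
  note ov = over q(2,3) g(2,3)
  have M: "vertex (g' * C * g)"
    unfolding vertex_def using n d ov pos by (auto intro!: mat_over_mult positive_mult)
  have "sse_pos C (g' * C * g)"
    by (rule sse_pos_factors[OF C(1) M, of g "g' * C"])
       (use d ov pos in \<open>auto intro!: mat_over_mult simp: inverses_cancel[OF g(1)] positive_imp_nonneg\<close>)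
  moreover have "sse_pos (q * C * q') (g' * C * g)"
  proof (rule sse_pos_factors[OF C1 M, of "q * g" "g' * C * q'"])
    show "q * C * q' = q * g * (g' * C * q')"
      by (simp add: d mult_assoc_dim inverses_cancel[OF g(1)])
    show "g' * C * g = g' * C * q' * (q * g)"
      by (simp add: d mult_assoc_dim inverses_cancel[OF q(1)])
  qed (use d ov pos in \<open>auto intro!: mat_over_mult\<close>)
  ultimately show ?thesis by (meson rtranclp_trans sse_pos_sym)
qed

text \<open>
  The matrix \<open>1 + \<epsilon> J\<close>, with all entries of \<open>J\<close> equal to one, is positive, and for small \<open>\<epsilon>\<close> its
  inverse is so close to the identity that it keeps \<open>C\<close> positive.
\<close>

lemma positive_conjugator:
  assumes C: "C \<in> carrier_mat n n" "positive_mat C"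
  shows "\<exists>g g'. inverses n g g' \<and> mat_over U g \<and> mat_over U g' \<and> positive_mat g \<and> positive_mat (g' * C)"
proof -
  define J where "J = mat n n (\<lambda>_. 1::real)"
  have J: "J \<in> carrier_mat n n" "mat_over U J" by (auto simp: J_def mat_over_iff one_in)
  define g where "g k = 1\<^sub>m n + inverse (of_nat (Suc k)) \<cdot>\<^sub>m J" for k
  have "mlim g (1\<^sub>m n + 0 \<cdot>\<^sub>m J) sequentially"
    unfolding g_def
    by (intro mlim_add mlim_const mlim_smult LIMSEQ_inverse_real_of_nat) (use J in auto)
  moreover have "1\<^sub>m n + 0 \<cdot>\<^sub>m J = 1\<^sub>m n" using J by auto
  ultimately have lim: "mlim g (1\<^sub>m n) sequentially" by simp
  have "mlim (\<lambda>k. minv (g k) * C) (1\<^sub>m n * C) sequentially"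
    by (intro mlim_mult mlim_minv_one lim mlim_const) (use C in auto)
  then have "eventually (\<lambda>k. positive_mat (minv (g k) * C)) sequentially"
    using C by (intro eventually_positive_entries) (auto simp: one_mult_dim)
  moreover have "eventually (\<lambda>k. inverses n (g k) (minv (g k))) sequentially"
    by (rule eventually_inverses[OF lim]) auto
  ultimately have "eventually (\<lambda>k. positive_mat (minv (g k) * C) \<and> inverses n (g k) (minv (g k))) sequentially"
    by eventually_elim simp
  then obtain k where k: "positive_mat (minv (g k) * C)" "inverses n (g k) (minv (g k))"
    by (auto simp: eventually_sequentially)
  moreover have "mat_over U (g k)"
    unfolding g_def using J
    by (intro mat_over_add mat_over_one mat_over_smult inverse_in of_nat_in) auto
  moreover have "mat_over U (minv (g k))"
    using inversesD[OF k(2)] by (intro mat_over_minv) (auto simp: \<open>mat_over U (g k)\<close>)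
  moreover have "positive_mat (g k)"
    using J by (auto simp: g_def positive_mat_iff J_def intro!: add_nonneg_pos)
  ultimately show ?thesis by blast
qed

section \<open>Real matrices reached from a matrix over the subfield\<close>

text \<open>
  The matrix \<open>C\<close> is real. Asking for approximation by conjugates, rather than by arbitrary matrices,
  keeps track of the nilpotent part of \<open>C\<close>, which decides whether two approximations of \<open>C\<close>
  obtained in different ways are conjugate.
\<close>

definition Reach :: "real mat \<Rightarrow> real mat \<Rightarrow> bool" where
  "Reach A C \<longleftrightarrow> (\<exists>n h h'. C \<in> carrier_mat n n \<and> mlim h (1\<^sub>m n) sequentially \<and> mlim h' (1\<^sub>m n) sequentially
     \<and> (\<forall>k::nat. inverses n (h k) (h' k) \<and> vertex (h k * C * h' k) \<and> sse_pos A (h k * C * h' k)))"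

lemma ReachI:
  assumes "C \<in> carrier_mat n n" "mlim h (1\<^sub>m n) sequentially" "mlim h' (1\<^sub>m n) sequentially"
    and ev: "eventually (\<lambda>k::nat. inverses n (h k) (h' k) \<and> vertex (h k * C * h' k)
      \<and> sse_pos A (h k * C * h' k)) sequentially"
  shows "Reach A C"
proof -
  obtain N where N: "\<And>k. k \<ge> N \<Longrightarrow> inverses n (h k) (h' k) \<and> vertex (h k * C * h' k)
      \<and> sse_pos A (h k * C * h' k)"
    using ev by (auto simp: eventually_sequentially)
  have "filterlim (\<lambda>k. k + N) sequentially sequentially"
    by (simp add: filterlim_add_const_nat_at_top)
  then have "mlim (\<lambda>k. h (k + N)) (1\<^sub>m n) sequentially" "mlim (\<lambda>k. h' (k + N)) (1\<^sub>m n) sequentially"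
    using assms(2,3) by (auto intro: mlim_compose)
  then show ?thesis unfolding Reach_def using N assms(1)
    by (intro exI[of _ n] exI[of _ "\<lambda>k. h (k + N)"] exI[of _ "\<lambda>k. h' (k + N)"]) auto
qed

lemma Reach_carrierE:
  assumes "Reach A C" "C \<in> carrier_mat n n"
  obtains h h' where "mlim h (1\<^sub>m n) sequentially" "mlim h' (1\<^sub>m n) sequentially"
    "\<And>k::nat. inverses n (h k) (h' k)" "\<And>k. vertex (h k * C * h' k)" "\<And>k. sse_pos A (h k * C * h' k)"
proof -
  obtain m h h' where "C \<in> carrier_mat m m" "mlim h (1\<^sub>m m) sequentially" "mlim h' (1\<^sub>m m) sequentially"
    "\<And>k::nat. inverses m (h k) (h' k)" "\<And>k. vertex (h k * C * h' k)" "\<And>k. sse_pos A (h k * C * h' k)"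
    using assms(1) unfolding Reach_def by blast
  moreover from this assms(2) have "m = n" by auto
  ultimately show thesis using that by blast
qed

lemma Reach_refl: "vertex A \<Longrightarrow> Reach A A"
  by (rule ReachI[of _ "dim_row A" "\<lambda>_. 1\<^sub>m (dim_row A)" "\<lambda>_. 1\<^sub>m (dim_row A)"])
     (auto simp: mlim_const inverses_one mat_dim vertex_def)

lemma mlim_conjugate:
  assumes "mlim h (1\<^sub>m n) F" "mlim h' (1\<^sub>m n) F" "C \<in> carrier_mat n n"
  shows "mlim (\<lambda>k. h k * C * h' k) C F"
proof -
  have "mlim (\<lambda>k. h k * C * h' k) (1\<^sub>m n * C * 1\<^sub>m n) F"
    by (intro mlim_mult assms mlim_const) (use assms in auto)
  then show ?thesis using assms by (simp add: mat_dim)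
qed

lemma Reach_transpose:
  assumes "Reach A C" shows "Reach A\<^sup>T C\<^sup>T"
proof -
  obtain n where C: "C \<in> carrier_mat n n" using assms by (auto simp: Reach_def)
  from Reach_carrierE[OF assms C] obtain h h' where h: "mlim h (1\<^sub>m n) sequentially" "mlim h' (1\<^sub>m n) sequentially"
    "\<And>k::nat. inverses n (h k) (h' k)" "\<And>k. vertex (h k * C * h' k)" "\<And>k. sse_pos A (h k * C * h' k)"
    by blast
  have eq: "(h k * C * h' k)\<^sup>T = (h' k)\<^sup>T * C\<^sup>T * (h k)\<^sup>T" for k
    using inversesD[OF h(3), of k] C by (simp add: transpose_mult_dim mult_assoc_dim)
  show ?thesis
  proof (rule ReachI[of _ n "\<lambda>k. (h' k)\<^sup>T" "\<lambda>k. (h k)\<^sup>T"])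
    show "mlim (\<lambda>k. (h' k)\<^sup>T) (1\<^sub>m n) sequentially" "mlim (\<lambda>k. (h k)\<^sup>T) (1\<^sub>m n) sequentially"
      using mlim_transpose[OF h(2)] mlim_transpose[OF h(1)] by simp_all
    show "\<forall>\<^sub>F k in sequentially. inverses n (h' k)\<^sup>T (h k)\<^sup>T \<and> vertex ((h' k)\<^sup>T * C\<^sup>T * (h k)\<^sup>T)
      \<and> sse_pos A\<^sup>T ((h' k)\<^sup>T * C\<^sup>T * (h k)\<^sup>T)"
      using h(3)[THEN inverses_sym, THEN inverses_transpose] h(4)[THEN vertex_transpose]
        h(5)[THEN sse_pos_transpose]
      unfolding eq by (intro always_eventually) blast
  qed (use C in auto)
qed

text \<open>
  The real conjugator \<open>q\<close> is replaced by matrices over \<open>U\<close> tending to it. All the positivity conditions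
  of \<open>sse_pos_conjugate\<close> are open, so they are inherited by the approximations.
\<close>

lemma Reach_conjugate:
  assumes R: "Reach A C" and C: "C \<in> carrier_mat n n"
    and q: "inverses n q q'"
    and g: "inverses n g g'" "mat_over U g" "mat_over U g'"
    and pos: "positive_mat g" "positive_mat (g' * C)" "positive_mat (q * g)" "positive_mat (g' * C * q')"
      "positive_mat (q * C * q')"
  shows "Reach A (q * C * q')"
proof -
  from Reach_carrierE[OF R C] obtain h h' where h: "mlim h (1\<^sub>m n) sequentially" "mlim h' (1\<^sub>m n) sequentially"
    "\<And>k::nat. inverses n (h k) (h' k)" "\<And>k. vertex (h k * C * h' k)" "\<And>k. sse_pos A (h k * C * h' k)"
    by blast
  obtain Q :: "nat \<Rightarrow> real mat" where Q: "mlim Q q sequentially" "\<And>k. mat_over U (Q k)"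
    using dense_matrix by blast
  note d = inversesD(1-4)[OF q] inversesD(1-4)[OF g(1)] carrier_matD[OF C] inversesD(1-4)[OF h(3)]
  have n: "0 < n" using h(4)[of 0] d by (auto simp: vertex_def)
  have detq: "det q \<noteq> 0" by (rule det_nonzero_of_inverses[OF q])
  have invQ: "\<forall>\<^sub>F k in sequentially. inverses n (Q k) (minv (Q k))"
    by (rule eventually_inverses[OF Q(1)]) (use detq d in auto)
  have Q': "mlim (\<lambda>k. minv (Q k)) q' sequentially"
    using mlim_minv[OF Q(1), of n] detq minv_eqI[OF q] d by simp
  have dQ: "dim_row (Q k) = n" "dim_col (Q k) = n" for k using mlimD(1,2)[OF Q(1)] d by auto
  have Q'over: "mat_over U (minv (Q k))" for k by (rule mat_over_minv) (use Q dQ in auto)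
  define C' where "C' k = h k * C * h' k" for k
  have C'lim: "mlim C' C sequentially" unfolding C'_def by (rule mlim_conjugate[OF h(1,2) C])
  have dC: "dim_row (C' k) = n" "dim_col (C' k) = n" for k by (auto simp: C'_def d)
  have D: "mlim (\<lambda>k. Q k * C' k * minv (Q k)) (q * C * q') sequentially"
    by (intro mlim_mult Q(1) C'lim Q') (auto simp: d)
  have "\<forall>\<^sub>F k in sequentially. positive_mat (Q k * C' k * minv (Q k))"
    by (rule eventually_positive_entries[OF D pos(5)])
  moreover have "\<forall>\<^sub>F k in sequentially. positive_mat (g' * C' k)"
    by (rule eventually_positive_entries[OF _ pos(2)], intro mlim_mult mlim_const C'lim) (auto simp: d)
  moreover have "\<forall>\<^sub>F k in sequentially. positive_mat (Q k * g)"
    by (rule eventually_positive_entries[OF _ pos(3)], intro mlim_mult mlim_const Q) (auto simp: d)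
  moreover have "\<forall>\<^sub>F k in sequentially. positive_mat (g' * C' k * minv (Q k))"
    by (rule eventually_positive_entries[OF _ pos(4)], intro mlim_mult mlim_const Q' C'lim) (auto simp: d)
  ultimately have ev: "\<forall>\<^sub>F k in sequentially. inverses n (Q k) (minv (Q k)) \<and>
      vertex (Q k * C' k * minv (Q k)) \<and> sse_pos A (Q k * C' k * minv (Q k))"
    using invQ
  proof eventually_elim
    case (elim k)
    have v: "vertex (C' k)" using h(4) by (simp add: C'_def)
    have over: "mat_over U (C' k)" using v by (simp add: vertex_def)
    have v': "vertex (Q k * C' k * minv (Q k))"
      unfolding vertex_def using elim n over Q(2) Q'over
      by (auto simp: dQ dC intro!: mat_over_mult)
    have "sse_pos (C' k) (Q k * C' k * minv (Q k))"
      by (rule sse_pos_conjugate[OF v _ v' _ _ _ g]) (use elim Q(2) Q'over pos(1) in \<open>auto simp: dC positive_imp_nonneg\<close>)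
    with v' elim h(5)[of k] show ?case unfolding C'_def by (auto intro: rtranclp_trans)
  qed
  define l where "l k = Q k * h k * q'" for k
  define l' where "l' k = q * h' k * minv (Q k)" for k
  have dq: "q * C * q' \<in> carrier_mat n n" by (auto simp: d)
  have "mlim l (q * 1\<^sub>m n * q') sequentially" "mlim l' (q * 1\<^sub>m n * q') sequentially"
    unfolding l_def l'_def by (intro mlim_mult Q(1) h Q' mlim_const; simp add: d)+
  then have lim: "mlim l (1\<^sub>m n) sequentially" "mlim l' (1\<^sub>m n) sequentially"
    by (simp_all add: mat_dim d inversesD[OF q])
  have conj: "l k * (q * C * q') * l' k = Q k * C' k * minv (Q k)" for k
    by (simp add: l_def l'_def C'_def d dQ mult_assoc_dim inverses_cancel[OF q])
  show ?thesis
  proof (rule ReachI[OF dq lim], unfold conj, use ev in eventually_elim)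
    case (elim k)
    have "inverses n (l k) (l' k)"
    proof -
      have "inverses n (Q k * h k * q') (q * (h' k * minv (Q k)))"
        using elim by (intro inverses_mult h(3) inverses_sym[OF q]) auto
      then show ?thesis by (simp add: l_def l'_def mult_assoc_dim d dQ)
    qed
    with elim show ?case by auto
  qed
qed

text \<open>
  Two points of the path that are close to each other differ by a conjugation near the identity.
  Hence being reached is a locally constant property on the unit interval.
\<close>

lemma Reach_path:
  fixes g g' :: "real \<Rightarrow> real mat"
  assumes C: "C \<in> carrier_mat n n"
    and inv: "\<And>s. s \<in> {0..1} \<Longrightarrow> inverses n (g s) (g' s)"
    and pos: "\<And>s. s \<in> {0..1} \<Longrightarrow> positive_mat (g s * C * g' s)"
    and lim: "\<And>s. s \<in> {0..1} \<Longrightarrow> mlim g (g s) (at s within {0..1})"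
      "\<And>s. s \<in> {0..1} \<Longrightarrow> mlim g' (g' s) (at s within {0..1})"
    and R: "Reach A (g 0 * C * g' 0)"
  shows "Reach A (g 1 * C * g' 1)"
proof -
  define c where "c s = g s * C * g' s" for s
  have local: "\<forall>\<^sub>F x in at s within {0..1}. Reach A (c s) = Reach A (c x)"
    if s: "s \<in> {0..1}" for s
  proof -
    let ?F = "at s within {0..1::real}"
    note ds = inversesD(1-4)[OF inv[OF s]] carrier_matD[OF C]
    have dg: "dim_row (g x) = n" "dim_col (g x) = n" "dim_row (g' x) = n" "dim_col (g' x) = n" for x
      using mlimD(1,2)[OF lim(1)[OF s], of x] mlimD(1,2)[OF lim(2)[OF s], of x] ds by auto
    have cs: "c s \<in> carrier_mat n n" "positive_mat (c s)" using pos[OF s] by (auto simp: c_def ds)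
    from positive_conjugator[OF this] obtain \<gamma> \<gamma>' where \<gamma>: "inverses n \<gamma> \<gamma>'" "mat_over U \<gamma>" "mat_over U \<gamma>'"
      "positive_mat \<gamma>" "positive_mat (\<gamma>' * c s)" by blast
    note d\<gamma> = inversesD(1-4)[OF \<gamma>(1)]
    \<comment> \<open>The conjugator from the matrix at \<open>x\<close> to the matrix at \<open>s\<close>, close to the identity for \<open>x\<close> near \<open>s\<close>.\<close>
    define r where "r x = g s * g' x" for x
    define r' where "r' x = g x * g' s" for x
    have "mlim r (g s * g' s) ?F" "mlim r' (g s * g' s) ?F"
      unfolding r_def r'_def by (intro mlim_mult mlim_const lim s; simp add: ds)+
    then have rlim: "mlim r (1\<^sub>m n) ?F" "mlim r' (1\<^sub>m n) ?F"
      using inversesD[OF inv[OF s]] by simp_all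
    have clim: "mlim c (c s) ?F"
      unfolding c_def by (intro mlim_mult mlim_const lim s) (auto simp: ds)
    note dc = mlimD(1,2)[OF clim] 
    note 1 = mult_one_dim[of \<gamma>] one_mult_dim[of \<gamma> n] mult_one_dim[of "\<gamma>' * c s" n]
    have "\<forall>\<^sub>F x in ?F. positive_mat (\<gamma>' * c x)"
      by (rule eventually_positive_entries[OF _ \<gamma>(5)], intro mlim_mult mlim_const clim)
         (use cs in \<open>auto simp: d\<gamma>\<close>)
    moreover have "\<forall>\<^sub>F x in ?F. positive_mat (r x * \<gamma>)"
      by (rule eventually_positive_entries[OF mlim_mult[OF rlim(1) mlim_const]])
         (use \<gamma>(4) 1(2) d\<gamma> in auto)
    moreover have "\<forall>\<^sub>F x in ?F. positive_mat (r' x * \<gamma>)"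
      by (rule eventually_positive_entries[OF mlim_mult[OF rlim(2) mlim_const]])
         (use \<gamma>(4) 1(2) d\<gamma> in auto)
    moreover have "\<forall>\<^sub>F x in ?F. positive_mat (\<gamma>' * c x * r' x)"
      by (rule eventually_positive_entries[OF mlim_mult[OF mlim_mult[OF mlim_const clim] rlim(2)]])
         (use \<gamma>(5) 1(3) d\<gamma> cs(1) in auto)
    moreover have "\<forall>\<^sub>F x in ?F. positive_mat (\<gamma>' * c s * r x)"
      by (rule eventually_positive_entries[OF mlim_mult[OF mlim_const rlim(1)]])
         (use \<gamma>(5) 1(3) d\<gamma> cs(1) in auto)
    moreover have "\<forall>\<^sub>F x in ?F. x \<in> {0..1}" by (auto simp: eventually_at_filter)
    ultimately have ev: "\<forall>\<^sub>F x in ?F. Reach A (c x) \<longleftrightarrow> Reach A (c s)"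
    proof eventually_elim
      case (elim x)
      note x = inv[OF elim(6)] pos[OF elim(6)]
      have cx: "c x \<in> carrier_mat n n" by (auto simp: c_def dg ds)
      have rr: "inverses n (r x) (r' x)" unfolding r_def r'_def
        by (rule inverses_mult[OF inv[OF s] inverses_sym[OF x(1)]])
      have e1: "r x * c x * r' x = c s" unfolding r_def r'_def c_def
        by (simp add: dg ds mult_assoc_dim inverses_cancel[OF x(1)])
      have e2: "r' x * c s * r x = c x" unfolding r_def r'_def c_def
        by (simp add: dg ds mult_assoc_dim inverses_cancel[OF inv[OF s]])
      show ?case
      proof
        assume "Reach A (c x)"
        from Reach_conjugate[OF this cx rr \<gamma>(1-4)] elim cs(2) show "Reach A (c s)" by (simp add: e1)
      next
        assume "Reach A (c s)"
        from Reach_conjugate[OF this cs(1) inverses_sym[OF rr] \<gamma>(1-4)] elim \<gamma>(5) x(2)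
        show "Reach A (c x)" by (simp add: e2 c_def[of x])
      qed
    qed
    then show ?thesis by eventually_elim simp
  qed
  have "Reach A (c 0) = Reach A (c 1)"
    by (rule connected_local_const[of "{0..1::real}"]) (use local in auto)
  with R have "Reach A (c 1)" by (simp add: c_def)
  then show ?thesis by (simp add: c_def)
qed

end

section \<open>Linear algebra\<close>

text \<open>
  The Fredholm alternative. If the last vector is independent of the others, a functional that
  kills the others and is one at it serves to correct the functional supplied by the induction hypothesis.
\<close>

lemma separating_functional:
  fixes f :: "nat \<Rightarrow> nat \<Rightarrow> real" and v :: "nat \<Rightarrow> real"
  assumes "\<nexists>x. \<forall>a<N. v a = (\<Sum>i<k. x i * f i a)"
  shows "\<exists>\<psi>. (\<forall>i<k. (\<Sum>a<N. \<psi> a * f i a) = 0) \<and> (\<Sum>a<N. \<psi> a * v a) = 1"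
  using assms
proof (induction k arbitrary: v)
  case 0
  then obtain a where a: "a < N" "v a \<noteq> 0" by auto
  have "(\<Sum>b<N. (if b = a then 1 / v a else 0) * v b) = (\<Sum>b<N. if b = a then 1 else 0)"
    using a by (intro sum.cong) auto
  then show ?case using a by (intro exI[of _ "\<lambda>b. if b = a then 1 / v a else 0"]) simp
next
  case (Suc k)
  show ?case
  proof (cases "\<exists>x. \<forall>a<N. f k a = (\<Sum>i<k. x i * f i a)")
    case True
    then obtain x where x: "\<And>a. a < N \<Longrightarrow> f k a = (\<Sum>i<k. x i * f i a)" by blast
    have "\<nexists>z. \<forall>a<N. v a = (\<Sum>i<k. z i * f i a)"
    proof
      assume "\<exists>z. \<forall>a<N. v a = (\<Sum>i<k. z i * f i a)"
      then obtain z where "\<forall>a<N. v a = (\<Sum>i<k. z i * f i a)" ..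
      then have "\<forall>a<N. v a = (\<Sum>i<Suc k. (z(k := 0)) i * f i a)" by simp
      with Suc.prems show False by blast
    qed
    from Suc.IH[OF this] obtain \<psi> where \<psi>: "\<forall>i<k. (\<Sum>a<N. \<psi> a * f i a) = 0" "(\<Sum>a<N. \<psi> a * v a) = 1"
      by blast
    have "(\<Sum>a<N. \<psi> a * f k a) = (\<Sum>a<N. \<Sum>i<k. x i * (\<psi> a * f i a))"
      by (intro sum.cong refl) (auto simp: x sum_distrib_left algebra_simps)
    also have "\<dots> = (\<Sum>i<k. x i * (\<Sum>a<N. \<psi> a * f i a))"
      by (subst sum.swap) (simp add: sum_distrib_left)
    also have "\<dots> = 0" using \<psi>(1) by simp
    finally show ?thesis using \<psi> by (intro exI[of _ \<psi>]) (auto simp: less_Suc_eq)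
  next
    case False
    from Suc.IH[OF False] obtain \<phi> where \<phi>: "\<forall>i<k. (\<Sum>a<N. \<phi> a * f i a) = 0" "(\<Sum>a<N. \<phi> a * f k a) = 1"
      by blast
    define c where "c = (\<Sum>a<N. \<phi> a * v a)"
    have "\<nexists>z. \<forall>a<N. v a - c * f k a = (\<Sum>i<k. z i * f i a)"
    proof
      assume "\<exists>z. \<forall>a<N. v a - c * f k a = (\<Sum>i<k. z i * f i a)"
      then obtain z where "\<forall>a<N. v a - c * f k a = (\<Sum>i<k. z i * f i a)" ..
      then have "\<forall>a<N. v a = (\<Sum>i<Suc k. (z(k := c)) i * f i a)"
        by (auto simp: algebra_simps)
      with Suc.prems show False by blast
    qed
    from Suc.IH[OF this] obtain \<psi> where \<psi>: "\<forall>i<k. (\<Sum>a<N. \<psi> a * f i a) = 0"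
      "(\<Sum>a<N. \<psi> a * (v a - c * f k a)) = 1" by blast
    define d where "d = (\<Sum>a<N. \<psi> a * f k a)"
    have expand: "(\<Sum>a<N. (\<psi> a - d * \<phi> a) * w a) = (\<Sum>a<N. \<psi> a * w a) - d * (\<Sum>a<N. \<phi> a * w a)" for w
      by (simp add: left_diff_distrib sum_subtractf sum_distrib_left mult.assoc)
    have "(\<Sum>a<N. \<psi> a * v a) - c * d = 1"
      using \<psi>(2) by (simp add: d_def right_diff_distrib sum_subtractf sum_distrib_left algebra_simps)
    then have "(\<Sum>a<N. (\<psi> a - d * \<phi> a) * v a) = 1"
      unfolding expand c_def by (simp add: mult.commute[of d])
    moreover have "(\<Sum>a<N. (\<psi> a - d * \<phi> a) * f i a) = 0" if "i < Suc k" for i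
      using that \<psi>(1) \<phi> by (cases "i = k") (simp_all add: expand d_def[symmetric])
    ultimately show ?thesis by (intro exI[of _ "\<lambda>a. \<psi> a - d * \<phi> a"] conjI allI impI)
  qed
qed

lemma functional_vanishing_on_image:
  fixes M v :: "real mat"
  assumes M: "M \<in> carrier_mat N k" and v: "v \<in> carrier_mat N 1"
    and no: "\<And>x. x \<in> carrier_mat k 1 \<Longrightarrow> M * x \<noteq> v"
  obtains \<psi> where "\<psi> \<in> carrier_mat 1 N" "\<psi> * M = 0\<^sub>m 1 k" "\<psi> * v = 1\<^sub>m 1"
proof -
  have "\<nexists>x. \<forall>a<N. v $$ (a,0) = (\<Sum>i<k. x i * M $$ (a,i))"
  proof
    assume "\<exists>x. \<forall>a<N. v $$ (a,0) = (\<Sum>i<k. x i * M $$ (a,i))"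
    then obtain x where x: "\<And>a. a < N \<Longrightarrow> v $$ (a,0) = (\<Sum>i<k. x i * M $$ (a,i))" by blast
    have "M * mat k 1 (\<lambda>(i,_). x i) = v"
      using M v by (intro eq_matI) (auto simp: mult_entry x mult.commute intro!: sum.cong)
    then show False using no by auto
  qed
  from separating_functional[OF this] obtain \<psi> where
    \<psi>: "\<forall>i<k. (\<Sum>a<N. \<psi> a * M $$ (a,i)) = 0" "(\<Sum>a<N. \<psi> a * v $$ (a,0)) = 1" by blast
  show thesis
    by (rule that[of "mat 1 N (\<lambda>(_,a). \<psi> a)"])
       (use M v \<psi> in \<open>auto simp: mult_entry intro!: eq_matI\<close>)
qed

lemma left_factor_of_kernel_subset:
  fixes P Q :: "real mat"
  assumes P: "P \<in> carrier_mat a N" and Q: "Q \<in> carrier_mat b N"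
    and ker: "\<And>v. v \<in> carrier_mat N 1 \<Longrightarrow> P * v = 0\<^sub>m a 1 \<Longrightarrow> Q * v = 0\<^sub>m b 1"
  obtains L where "L \<in> carrier_mat b a" "L * P = Q"
proof -
  have "\<exists>x. \<forall>c<N. Q $$ (i,c) = (\<Sum>k<a. x k * P $$ (k,c))" if i: "i < b" for i
  proof (rule ccontr)
    assume "\<nexists>x. \<forall>c<N. Q $$ (i,c) = (\<Sum>k<a. x k * P $$ (k,c))"
    from separating_functional[OF this] obtain \<psi> where
      \<psi>: "\<forall>k<a. (\<Sum>c<N. \<psi> c * P $$ (k,c)) = 0" "(\<Sum>c<N. \<psi> c * Q $$ (i,c)) = 1" by blast
    define v where "v = mat N 1 (\<lambda>(c,_). \<psi> c)"
    have "P * v = 0\<^sub>m a 1"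
      using P \<psi>(1) by (auto simp: v_def mult_entry mult.commute intro!: eq_matI)
    then have "Q * v = 0\<^sub>m b 1" by (intro ker) (auto simp: v_def)
    moreover have "(Q * v) $$ (i,0) = 1"
      using Q i \<psi>(2) by (auto simp: v_def mult_entry mult.commute)
    ultimately show False using i by simp
  qed
  then obtain x where x: "\<And>i c. i < b \<Longrightarrow> c < N \<Longrightarrow> Q $$ (i,c) = (\<Sum>k<a. x i k * P $$ (k,c))"
    by metis
  show thesis
    by (rule that[of "mat b a (\<lambda>(i,k). x i k)"])
       (use P Q x in \<open>auto simp: mult_entry intro!: eq_matI\<close>)
qed

lemma wide_matrix_kernel:
  fixes K :: "real mat"
  assumes K: "K \<in> carrier_mat N r" and "N < r"
  obtains x where "x \<in> carrier_mat r 1" "x \<noteq> 0\<^sub>m r 1" "K * x = 0\<^sub>m N 1"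
proof -
  \<comment> \<open>Padding with zero rows gives a square matrix with a zero row.\<close>
  define K' where "K' = mat r r (\<lambda>(i,j). if i < N then K $$ (i,j) else 0)"
  have K': "K' \<in> carrier_mat r r" by (simp add: K'_def)
  have "det K' = 0"
  proof (rule ccontr)
    assume "det K' \<noteq> 0"
    from inversesD(5)[OF inverses_minv[OF K' this]] have "(K' * minv K') $$ (N,N) = 1"
      using assms(2) by simp
    then show False using assms(2) by (subst (asm) mult_entry) (auto simp: K'_def)
  qed
  then obtain w where w: "w \<in> carrier_vec r" "w \<noteq> 0\<^sub>v r" "K' *\<^sub>v w = 0\<^sub>v r"
    using det_0_iff_vec_prod_zero[OF K'] by blast
  have sum: "(\<Sum>j<r. K $$ (i,j) * w $ j) = 0" if "i < N" for i
  proof -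
    have "(K' *\<^sub>v w) $ i = 0" using w that assms(2) by simp
    then show ?thesis using w that assms(2)
      by (simp add: K'_def scalar_prod_def lessThan_atLeast0)
  qed
  show thesis
  proof (rule that[of "mat r 1 (\<lambda>(i,_). w $ i)"])
    show "mat r 1 (\<lambda>(i,_). w $ i) \<noteq> 0\<^sub>m r 1"
    proof
      assume eq: "mat r 1 (\<lambda>(i,_). w $ i) = 0\<^sub>m r 1"
      have "w $ i = 0" if "i < r" for i
        using arg_cong[OF eq, of "\<lambda>M. M $$ (i,0)"] that by simp
      then have "w = 0\<^sub>v r" using w(1) by (intro eq_vecI) auto
      with w(2) show False by simp
    qed
    show "K * mat r 1 (\<lambda>(i,_). w $ i) = 0\<^sub>m N 1"
      using K sum by (auto simp: mult_entry intro!: eq_matI)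
  qed auto
qed

lemma pow_mat_dims [simp]:
  assumes "D \<in> carrier_mat N N"
  shows "dim_row (D ^\<^sub>m k) = N" "dim_col (D ^\<^sub>m k) = N"
  using pow_carrier_mat[OF assms, of k] by auto

lemma pow_mat_add_mult:
  fixes D :: "real mat"
  assumes D: "D \<in> carrier_mat N N"
  shows "D ^\<^sub>m (a + b) = D ^\<^sub>m a * D ^\<^sub>m b"
  by (induction b) (use D in \<open>auto simp: mult_one_dim mult_assoc_dim pow_mat_dims[OF D]\<close>)

lemma pow_mat_Suc_left:
  fixes D :: "real mat"
  assumes D: "D \<in> carrier_mat N N"
  shows "D ^\<^sub>m (Suc b) = D * D ^\<^sub>m b"
  using pow_mat_add_mult[OF D, of 1 b] D by (simp add: one_mult_dim)

text \<open>
  If \<open>v = D\<^sup>N y\<close> were a nonzero kernel vector, then the \<open>N + 1\<close> vectors \<open>y, D y, \<dots>, D\<^sup>N y\<close> would be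
  independent, as one sees by applying powers of \<open>D\<close> to a relation between them. So a nonzero kernel
  vector has a well-defined depth \<open>j\<close> in the decreasing chain of images.
\<close>

lemma kernel_vector_depth:
  fixes D v :: "real mat"
  assumes D: "D \<in> carrier_mat N N" and v: "v \<in> carrier_mat N 1" "v \<noteq> 0\<^sub>m N 1" "D * v = 0\<^sub>m N 1"
  obtains j y where "y \<in> carrier_mat N 1" "v = D ^\<^sub>m j * y"
    "\<And>z. z \<in> carrier_mat N 1 \<Longrightarrow> D ^\<^sub>m (Suc j) * z \<noteq> v"
proof -
  note dp = pow_mat_dims[OF D] carrier_matD[OF D]
  have "\<exists>j. (\<exists>y\<in>carrier_mat N 1. v = D ^\<^sub>m j * y) \<and> (\<forall>z\<in>carrier_mat N 1. D ^\<^sub>m (Suc j) * z \<noteq> v)"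
  proof (rule ccontr)
    assume *: "\<not> ?thesis"
    have "\<exists>y\<in>carrier_mat N 1. v = D ^\<^sub>m j * y" for j
    proof (induction j)
      case 0
      show ?case using v D by (intro bexI[of _ v]) (auto simp: one_mult_dim)
    qed (use * in \<open>metis\<close>)
    then obtain y where y: "y \<in> carrier_mat N 1" "v = D ^\<^sub>m N * y" by blast
    define u where "u s = D ^\<^sub>m s * y" for s
    have du: "dim_row (u s) = N" "dim_col (u s) = 1" for s using y by (auto simp: u_def dp)
    have shift: "D ^\<^sub>m e * u s = u (e + s)" for e s
      using y by (simp add: u_def pow_mat_add_mult[OF D] mult_assoc_dim dp)
    have u0: "u s = 0\<^sub>m N 1" if "s > N" for s
    proof -
      have "u (Suc N) = D * v"
        unfolding u_def y(2) pow_mat_Suc_left[OF D] by (rule mult_assoc_dim) (use y in \<open>auto simp: dp\<close>)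
      then have "u (Suc N) = 0\<^sub>m N 1" using v by simp
      moreover have "u s = D ^\<^sub>m (s - Suc N) * u (Suc N)" using that by (simp add: shift)
      ultimately show ?thesis using pow_carrier_mat[OF D] by (simp add: right_mult_zero_mat[of _ N N])
    qed
    define K where "K = mat N (Suc N) (\<lambda>(a,s). u s $$ (a,0))"
    have "K \<in> carrier_mat N (Suc N)" by (simp add: K_def)
    from wide_matrix_kernel[OF this] obtain x where
      x: "x \<in> carrier_mat (Suc N) 1" "x \<noteq> 0\<^sub>m (Suc N) 1" "K * x = 0\<^sub>m N 1" by auto
    have "\<exists>s. s < Suc N \<and> x $$ (s,0) \<noteq> 0"
    proof (rule ccontr)
      assume "\<not> ?thesis"
      then have "x = 0\<^sub>m (Suc N) 1" using x(1) by (intro eq_matI) auto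
      with x(2) show False by simp
    qed
    then obtain s where s: "s < Suc N" "x $$ (s,0) \<noteq> 0" "\<And>t. t < s \<Longrightarrow> x $$ (t,0) = 0"
      using exists_least_iff[of "\<lambda>s. s < Suc N \<and> x $$ (s,0) \<noteq> 0"] by (metis less_trans)
    have "v $$ (a,0) = 0" if a: "a < N" for a
    proof -
      have "(D ^\<^sub>m (N - s) * K) $$ (a,t) = u (N - s + t) $$ (a,0)" if "t < Suc N" for t
      proof -
        have "(D ^\<^sub>m (N - s) * K) $$ (a,t) = (D ^\<^sub>m (N - s) * u t) $$ (a,0)"
          using a that by (subst (1 2) mult_entry) (auto simp: dp du K_def)
        then show ?thesis by (simp add: shift)
      qed
      moreover have "D ^\<^sub>m (N - s) * K * x = 0\<^sub>m N 1"
        using x pow_carrier_mat[OF D] by (subst mult_assoc_dim) (auto simp: dp K_def right_mult_zero_mat[of _ N N])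
      then have "(D ^\<^sub>m (N - s) * K * x) $$ (a,0) = 0" using a by simp
      ultimately have "0 = (\<Sum>t<Suc N. u (N - s + t) $$ (a,0) * x $$ (t,0))"
        using a x(1) by (subst (asm) mult_entry) (auto simp: dp K_def)
      also have "\<dots> = (\<Sum>t<Suc N. if t = s then u N $$ (a,0) * x $$ (s,0) else 0)"
      proof (intro sum.cong refl)
        fix t assume "t \<in> {..<Suc N}"
        consider "t < s" | "t = s" | "t > s" by linarith
        then show "u (N - s + t) $$ (a,0) * x $$ (t,0) = (if t = s then u N $$ (a,0) * x $$ (s,0) else 0)"
          by cases (use s a u0[of "N - s + t"] in auto)
      qed
      also have "\<dots> = v $$ (a,0) * x $$ (s,0)" using s(1) y by (simp add: u_def)
      finally show ?thesis using s(2) by simp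
    qed
    then have "v = 0\<^sub>m N 1" using v(1) by (intro eq_matI) auto
    with v(2) show False by simp
  qed
  then show thesis using that by blast
qed

definition biorthogonal :: "nat \<Rightarrow> nat \<Rightarrow> (nat \<Rightarrow> real mat) \<Rightarrow> (nat \<Rightarrow> real mat) \<Rightarrow> bool" where
  "biorthogonal N r k \<psi> \<longleftrightarrow> (\<forall>i<r. k i \<in> carrier_mat N 1 \<and> \<psi> i \<in> carrier_mat 1 N) \<and>
     (\<forall>i<r. \<forall>l<r. \<psi> i * k l = (if i = l then 1\<^sub>m 1 else 0\<^sub>m 1 1))"

lemma biorthogonal_bound:
  assumes "biorthogonal N r k \<psi>" shows "r \<le> N"
proof (rule ccontr)
  assume "\<not> r \<le> N"
  then have "N < r" by simp
  have d: "dim_row (k i) = N" "dim_col (k i) = 1" "dim_row (\<psi> i) = 1" "dim_col (\<psi> i) = N" if "i < r" for i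
    using assms that by (auto simp: biorthogonal_def)
  define K where "K = mat N r (\<lambda>(a,i). k i $$ (a,0))"
  have K: "K \<in> carrier_mat N r" by (simp add: K_def)
  from wide_matrix_kernel[OF K \<open>N < r\<close>] obtain x where
    x: "x \<in> carrier_mat r 1" "x \<noteq> 0\<^sub>m r 1" "K * x = 0\<^sub>m N 1" by auto
  have "x $$ (i,0) = 0" if i: "i < r" for i
  proof -
    have "\<psi> i * K * x = 0\<^sub>m 1 1"
      using x d[OF i] by (subst mult_assoc_dim) (auto simp: K_def right_mult_zero_mat[of _ 1 N])
    then have "0 = (\<psi> i * K * x) $$ (0,0)" by simp
    also have "\<dots> = (\<Sum>l<r. (\<psi> i * K) $$ (0,l) * x $$ (l,0))"
      using d[OF i] x K by (subst mult_entry) auto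
    also have "\<dots> = (\<Sum>l<r. if l = i then x $$ (i,0) else 0)"
    proof (intro sum.cong refl)
      fix l assume "l \<in> {..<r}"
      then have l: "l < r" by simp
      have "(\<psi> i * K) $$ (0,l) = (\<psi> i * k l) $$ (0,0)"
        using l d[OF i] d[OF l] by (subst (1 2) mult_entry) (auto simp: K_def)
      then show "(\<psi> i * K) $$ (0,l) * x $$ (l,0) = (if l = i then x $$ (i,0) else 0)"
        using assms i l by (auto simp: biorthogonal_def)
    qed
    also have "\<dots> = x $$ (i,0)" using i by simp
    finally show ?thesis by simp
  qed
  then have "x = 0\<^sub>m r 1" using x(1) by (intro eq_matI) auto
  with x(2) show False by simp
qed

text \<open>
  Vectors \<open>k i\<close> of the kernel of \<open>P\<close> with dual functionals \<open>\<psi> i\<close>, graded by depth: \<open>k i\<close> lies in the image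
  of \<open>D\<^sup>j\<close> and \<open>\<psi> i\<close> kills the image of \<open>D\<^sup>j\<^sup>+\<^sup>1\<close>, where \<open>j = j i\<close>. These two conditions are what is needed
  to displace \<open>k i\<close>, and no other member, by an operator that commutes with \<open>D\<close>.
\<close>

definition graded_system ::
  "real mat \<Rightarrow> real mat \<Rightarrow> nat \<Rightarrow> nat \<Rightarrow> (nat \<Rightarrow> real mat) \<Rightarrow> (nat \<Rightarrow> real mat) \<Rightarrow> (nat \<Rightarrow> nat) \<Rightarrow> (nat \<Rightarrow> real mat) \<Rightarrow> bool" where
  "graded_system D P N r k \<psi> j y \<longleftrightarrow> biorthogonal N r k \<psi> \<and>
     (\<forall>i<r. P * k i = 0\<^sub>m (dim_row P) 1 \<and> y i \<in> carrier_mat N 1 \<and> k i = D ^\<^sub>m j i * y i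
        \<and> \<psi> i * D ^\<^sub>m Suc (j i) = 0\<^sub>m 1 N)"

text \<open>
  Let \<open>v\<close> have depth \<open>e\<close>. A functional that is one at \<open>v\<close> and kills the image of \<open>D\<^sup>e\<^sup>+\<^sup>1\<close> is made to vanish at
  the old vectors by subtracting multiples of the old functionals. This does not spoil the grading:
  the functional already vanishes at old vectors of depth greater than \<open>e\<close>, and the functionals of
  the other old vectors kill the image of \<open>D\<^sup>e\<^sup>+\<^sup>1\<close> themselves.
\<close>

lemma graded_system_extend:
  assumes sys: "graded_system D P N r k \<psi> j y"
    and D: "D \<in> carrier_mat N N" and P: "dim_col P = N"
    and v: "v \<in> carrier_mat N 1" "v \<noteq> 0\<^sub>m N 1" "P * v = 0\<^sub>m (dim_row P) 1" "D * v = 0\<^sub>m N 1"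
      "\<And>i. i < r \<Longrightarrow> \<psi> i * v = 0\<^sub>m 1 1"
  shows "\<exists>k \<psi> j y. graded_system D P N (Suc r) k \<psi> j y"
proof -
  note dp = pow_mat_dims[OF D] carrier_matD[OF D]
  from kernel_vector_depth[OF D v(1,2,4)] obtain e z where e: "z \<in> carrier_mat N 1" "v = D ^\<^sub>m e * z"
    "\<And>z. z \<in> carrier_mat N 1 \<Longrightarrow> D ^\<^sub>m (Suc e) * z \<noteq> v" by blast
  from functional_vanishing_on_image[OF pow_carrier_mat[OF D] v(1) e(3)]
  obtain \<phi> where \<phi>: "\<phi> \<in> carrier_mat 1 N" "\<phi> * D ^\<^sub>m (Suc e) = 0\<^sub>m 1 N" "\<phi> * v = 1\<^sub>m 1" by blast
  have bi: "k i \<in> carrier_mat N 1" "\<psi> i \<in> carrier_mat 1 N" "y i \<in> carrier_mat N 1"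
    "P * k i = 0\<^sub>m (dim_row P) 1" "k i = D ^\<^sub>m j i * y i" "\<psi> i * D ^\<^sub>m Suc (j i) = 0\<^sub>m 1 N" if "i < r" for i
    using sys that by (auto simp: graded_system_def biorthogonal_def)
  have or: "\<psi> i * k l = (if i = l then 1\<^sub>m 1 else 0\<^sub>m 1 1)" if "i < r" "l < r" for i l
    using sys that by (auto simp: graded_system_def biorthogonal_def)
  note dk = carrier_matD[OF bi(1)] and d\<psi> = carrier_matD[OF bi(2)]
  define c where "c l = (\<phi> * k l) $$ (0,0)" for l
  define \<chi> where "\<chi> = mat 1 N (\<lambda>(_,a). \<phi> $$ (0,a) - (\<Sum>l<r. c l * \<psi> l $$ (0,a)))"
  have \<chi>: "(\<chi> * M) $$ (0,b) = (\<phi> * M) $$ (0,b) - (\<Sum>l<r. c l * (\<psi> l * M) $$ (0,b))"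
    if M: "dim_row M = N" "b < dim_col M" for M b
  proof -
    have "(\<chi> * M) $$ (0,b) = (\<Sum>a<N. (\<phi> $$ (0,a) - (\<Sum>l<r. c l * \<psi> l $$ (0,a))) * M $$ (a,b))"
      using M by (subst mult_entry) (auto simp: \<chi>_def)
    also have "\<dots> = (\<Sum>a<N. \<phi> $$ (0,a) * M $$ (a,b)) - (\<Sum>a<N. \<Sum>l<r. c l * (\<psi> l $$ (0,a) * M $$ (a,b)))"
      by (simp add: left_diff_distrib sum_subtractf sum_distrib_right mult.assoc)
    also have "(\<Sum>a<N. \<Sum>l<r. c l * (\<psi> l $$ (0,a) * M $$ (a,b))) = (\<Sum>l<r. c l * (\<psi> l * M) $$ (0,b))"
      by (subst sum.swap, intro sum.cong refl, subst mult_entry)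
         (use M in \<open>auto simp: sum_distrib_left d\<psi>\<close>)
    also have "(\<Sum>a<N. \<phi> $$ (0,a) * M $$ (a,b)) = (\<phi> * M) $$ (0,b)"
      using M \<phi> by (subst mult_entry) auto
    finally show ?thesis .
  qed
  have c\<psi>: "c l * (\<psi> l * D ^\<^sub>m Suc e) $$ (0,b) = 0" if l: "l < r" and b: "b < N" for l b
  proof (cases "j l \<le> e")
    case True
    have "\<psi> l * D ^\<^sub>m (Suc (j l) + (e - j l)) = \<psi> l * D ^\<^sub>m Suc (j l) * D ^\<^sub>m (e - j l)"
      using bi(2)[OF l] by (subst pow_mat_add_mult[OF D]) (simp add: mult_assoc_dim dp)
    also have "\<dots> = 0\<^sub>m 1 N"
      unfolding bi(6)[OF l] using pow_carrier_mat[OF D] by (rule left_mult_zero_mat)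
    finally show ?thesis using True b by simp
  next
    case False
    then have "j l = Suc e + (j l - Suc e)" by simp
    then have "k l = D ^\<^sub>m (Suc e) * (D ^\<^sub>m (j l - Suc e) * y l)"
      using bi(3,5)[OF l] pow_mat_add_mult[OF D, of "Suc e" "j l - Suc e"]
      by (simp add: mult_assoc_dim dp del: pow_mat.simps)
    then have "\<phi> * k l = \<phi> * D ^\<^sub>m (Suc e) * (D ^\<^sub>m (j l - Suc e) * y l)"
      using \<phi>(1) bi(3)[OF l] by (simp add: mult_assoc_dim dp del: pow_mat.simps)
    also have "\<dots> = 0\<^sub>m 1 1"
      unfolding \<phi>(2) using bi(3)[OF l] pow_carrier_mat[OF D] by (intro left_mult_zero_mat mult_carrier_mat)
    finally show ?thesis by (simp add: c_def)
  qed
  have one: "M = N'" if "M \<in> carrier_mat 1 1" "N' \<in> carrier_mat 1 1" "M $$ (0,0) = N' $$ (0,0)" for M N' :: "real mat"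
    using that by (intro eq_matI) auto
  have \<chi>v: "\<chi> * v = 1\<^sub>m 1"
  proof (rule one)
    show "(\<chi> * v) $$ (0,0) = 1\<^sub>m 1 $$ (0,0)"
      using v \<phi>(3) by (subst \<chi>) auto
  qed (use v in \<open>auto simp: \<chi>_def\<close>)
  have \<chi>k: "\<chi> * k i = 0\<^sub>m 1 1" if i: "i < r" for i
  proof (rule one)
    have "(\<Sum>l<r. c l * (\<psi> l * k i) $$ (0,0)) = (\<Sum>l<r. if l = i then c i else 0)"
      by (intro sum.cong refl) (use i in \<open>auto simp: or\<close>)
    then have "(\<chi> * k i) $$ (0,0) = c i - c i"
      using bi(1)[OF i] i by (subst \<chi>) (auto simp: c_def)
    then show "(\<chi> * k i) $$ (0,0) = 0\<^sub>m 1 1 $$ (0,0)" by simp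
  qed (use bi(1)[OF i] in \<open>auto simp: \<chi>_def\<close>)
  have \<chi>D: "\<chi> * D ^\<^sub>m Suc e = 0\<^sub>m 1 N"
  proof (rule eq_matI)
    fix i b assume ib: "i < dim_row (0\<^sub>m 1 N :: real mat)" "b < dim_col (0\<^sub>m 1 N :: real mat)"
    then have "(\<chi> * D ^\<^sub>m Suc e) $$ (0,b) = 0"
      by (subst \<chi>) (simp_all add: dp c\<psi> \<phi>(2) D del: pow_mat.simps)
    with ib show "(\<chi> * D ^\<^sub>m Suc e) $$ (i,b) = 0\<^sub>m 1 N $$ (i,b)" by simp
  qed (auto simp: \<chi>_def dp D simp del: pow_mat.simps)
  have "graded_system D P N (Suc r) (k(r := v)) (\<psi>(r := \<chi>)) (j(r := e)) (y(r := z))"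
    unfolding graded_system_def biorthogonal_def
    using bi or v \<chi>v \<chi>k \<chi>D e(1,2) by (auto simp: less_Suc_eq \<chi>_def simp del: pow_mat.simps)
  then show ?thesis by blast
qed

text \<open>
  A system of maximal length spans the kernel, since otherwise it could be extended.
\<close>

lemma adapted_kernel_basis:
  assumes D: "D \<in> carrier_mat N N" and P: "P \<in> carrier_mat a N"
    and ker: "\<And>v. v \<in> carrier_mat N 1 \<Longrightarrow> P * v = 0\<^sub>m a 1 \<Longrightarrow> D * v = 0\<^sub>m N 1"
  obtains r k \<psi> j y where "graded_system D P N r k \<psi> j y"
    "\<And>v. v \<in> carrier_mat N 1 \<Longrightarrow> P * v = 0\<^sub>m a 1 \<Longrightarrow> (\<And>i. i < r \<Longrightarrow> \<psi> i * v = 0\<^sub>m 1 1) \<Longrightarrow> v = 0\<^sub>m N 1"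
proof -
  define Q where "Q r \<longleftrightarrow> (\<exists>k \<psi> j y. graded_system D P N r k \<psi> j y)" for r
  have Q0: "Q 0" by (auto simp: Q_def graded_system_def biorthogonal_def)
  have bound: "r \<le> N" if "Q r" for r
    using that biorthogonal_bound by (auto simp: Q_def graded_system_def)
  define r where "r = (GREATEST r. Q r)"
  have "Q r" unfolding r_def by (rule GreatestI_nat[of Q, OF Q0]) (use bound in blast)
  then obtain k \<psi> j y where sys: "graded_system D P N r k \<psi> j y" by (auto simp: Q_def)
  have "\<not> Q (Suc r)" using Greatest_le_nat[of Q "Suc r" N] bound by (auto simp: r_def)
  then have "v = 0\<^sub>m N 1"
    if "v \<in> carrier_mat N 1" "P * v = 0\<^sub>m a 1" "\<And>i. i < r \<Longrightarrow> \<psi> i * v = 0\<^sub>m 1 1" for v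
    using graded_system_extend[OF sys D _ that(1)] that ker[of v] P unfolding Q_def by auto
  with sys show thesis using that by blast
qed

text \<open>
  The operator is \<open>T = \<Sum>\<^sub>s\<^sub>\<le>\<^sub>j D\<^sup>j\<^sup>-\<^sup>s w \<psi> D\<^sup>s\<close>. Its commutator with \<open>D\<close> telescopes to
  \<open>D\<^sup>j\<^sup>+\<^sup>1 w \<psi> - w \<psi> D\<^sup>j\<^sup>+\<^sup>1 = 0\<close>, and on the kernel of \<open>D\<close> only the summand with \<open>s = 0\<close> survives.
\<close>

lemma commuting_rank_one_extension:
  fixes D \<psi> :: "real mat" and w :: "nat \<Rightarrow> real mat"
  assumes D: "D \<in> carrier_mat N N" and \<psi>: "\<psi> \<in> carrier_mat 1 N" "\<psi> * D ^\<^sub>m Suc j = 0\<^sub>m 1 N"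
    and w: "mlim w (0\<^sub>m N 1) sequentially" "\<And>n. D ^\<^sub>m Suc j * w n = 0\<^sub>m N 1"
  obtains T where "mlim T (0\<^sub>m N N) sequentially" "\<And>n. T n * D = D * T n"
    "\<And>n v. v \<in> carrier_mat N 1 \<Longrightarrow> D * v = 0\<^sub>m N 1 \<Longrightarrow> T n * v = D ^\<^sub>m j * w n * (\<psi> * v)"
proof -
  note dp = pow_mat_dims[OF D] carrier_matD[OF D] carrier_matD[OF \<psi>(1)]
  have dw: "dim_row (w n) = N" "dim_col (w n) = 1" for n using mlimD(1,2)[OF w(1)] by auto
  define t where "t s n = rec_nat (w n * \<psi>) (\<lambda>s T. D * T + w n * (\<psi> * D ^\<^sub>m Suc s)) s" for s n
  have t: "t 0 n = w n * \<psi>" "t (Suc s) n = D * t s n + w n * (\<psi> * D ^\<^sub>m Suc s)" for s n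
    by (simp_all add: t_def)
  have dt: "dim_row (t s n) = N \<and> dim_col (t s n) = N" for s n
    by (induction s) (simp_all add: t dp dw del: pow_mat.simps)
  have comm: "D * t s n + w n * (\<psi> * D ^\<^sub>m Suc s) = t s n * D + D ^\<^sub>m Suc s * w n * \<psi>" for s n
  proof (induction s)
    case 0
    show ?case
      by (rule eq_matI) (simp_all add: t dp dw mult_assoc_dim one_mult_dim)
  next
    case (Suc s)
    have "D * (D * t s n + w n * (\<psi> * D ^\<^sub>m Suc s)) = D * (t s n * D) + D ^\<^sub>m Suc (Suc s) * w n * \<psi>"
      unfolding Suc.IH by (simp add: pow_mat_Suc_left[OF D] mult_add_dim mult_assoc_dim dp dw dt del: pow_mat.simps)
    moreover have "t (Suc s) n * D = D * (t s n * D) + w n * (\<psi> * D ^\<^sub>m Suc (Suc s))"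
      unfolding t by (subst pow_mat.simps(2)[of D "Suc s"]) (simp add: add_mult_dim mult_assoc_dim dp dw dt del: pow_mat.simps)
    moreover have "t (Suc s) n = D * t s n + w n * (\<psi> * D ^\<^sub>m Suc s)" by (rule t)
    ultimately show ?case
      by (intro eq_matI) (simp_all add: dp dw dt del: pow_mat.simps)
  qed
  have lim: "mlim (t s) (0\<^sub>m N N) sequentially" for s
  proof (induction s)
    case 0
    have "mlim (\<lambda>n. w n * \<psi>) (0\<^sub>m N 1 * \<psi>) sequentially"
      by (intro mlim_mult w mlim_const) (auto simp: dp)
    then show ?case using \<psi> by (simp add: t[abs_def])
  next
    case (Suc s)
    have "mlim (\<lambda>n. D * t s n + w n * (\<psi> * D ^\<^sub>m Suc s)) (D * 0\<^sub>m N N + 0\<^sub>m N 1 * (\<psi> * D ^\<^sub>m Suc s)) sequentially"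
      by (intro mlim_add mlim_mult w mlim_const Suc) (auto simp: dp simp del: pow_mat.simps)
    moreover have "D * 0\<^sub>m N N = 0\<^sub>m N N" "0\<^sub>m N 1 * (\<psi> * D ^\<^sub>m Suc s) = 0\<^sub>m N N"
      using D \<psi>(1) pow_carrier_mat[OF D, of "Suc s"] by (auto simp del: pow_mat.simps intro: left_mult_zero_mat)
    ultimately show ?case by (simp add: t(2)[abs_def] del: pow_mat.simps)
  qed
  have val: "t s n * v = D ^\<^sub>m s * w n * (\<psi> * v)" if v: "v \<in> carrier_mat N 1" "D * v = 0\<^sub>m N 1" for s n v
  proof (induction s)
    case (Suc s)
    have "\<psi> * D ^\<^sub>m Suc s * v = \<psi> * D ^\<^sub>m s * (D * v)"
      using v by (simp add: mult_assoc_dim dp)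
    also have "\<dots> = 0\<^sub>m 1 1"
      unfolding v(2) using \<psi>(1) pow_carrier_mat[OF D] by (intro right_mult_zero_mat mult_carrier_mat)
    finally have 0: "\<psi> * D ^\<^sub>m Suc s * v = 0\<^sub>m 1 1" .
    have "t (Suc s) n * v = D * (t s n * v) + w n * (\<psi> * D ^\<^sub>m Suc s * v)"
      unfolding t using v by (simp add: add_mult_dim mult_assoc_dim dp dw dt del: pow_mat.simps)
    also have "w n * (\<psi> * D ^\<^sub>m Suc s * v) = 0\<^sub>m N 1"
      unfolding 0 using dw by (intro right_mult_zero_mat) auto
    also have "D * (t s n * v) + 0\<^sub>m N 1 = D * (t s n * v)"
      using v by (intro right_add_zero_mat) (auto simp: dp dt)
    also have "\<dots> = D ^\<^sub>m Suc s * w n * (\<psi> * v)"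
      unfolding Suc.IH using v by (simp add: pow_mat_Suc_left[OF D] mult_assoc_dim dp dw del: pow_mat.simps)
    finally show ?case .
  qed (use v in \<open>simp add: t dp dw mult_assoc_dim one_mult_dim\<close>)
  show thesis
  proof (rule that[of "t j"])
    fix n
    have "w n * (\<psi> * D ^\<^sub>m Suc j) = 0\<^sub>m N N" unfolding \<psi>(2) using dw by (intro right_mult_zero_mat) auto
    moreover have "D ^\<^sub>m Suc j * w n * \<psi> = 0\<^sub>m N N" unfolding w(2) using \<psi>(1) by (intro left_mult_zero_mat)
    ultimately have "D * t j n + 0\<^sub>m N N = t j n * D + 0\<^sub>m N N" using comm[of j n] by simp
    then show "t j n * D = D * t j n"
      by (metis carrier_matI dp(3,4) dt index_mult_mat(2,3) right_add_zero_mat)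
  qed (use lim val in auto)
qed

lemma commuting_perturbation:
  fixes w :: "nat \<Rightarrow> nat \<Rightarrow> real mat"
  assumes D: "D \<in> carrier_mat N N" and sys: "graded_system D P N r k \<psi> j y"
    and w: "\<And>i. i < r \<Longrightarrow> mlim (w i) (0\<^sub>m N 1) sequentially"
      "\<And>i n. i < r \<Longrightarrow> D ^\<^sub>m Suc (j i) * w i n = 0\<^sub>m N 1"
    and ker: "\<And>i. i < r \<Longrightarrow> D * k i = 0\<^sub>m N 1"
  obtains T where "mlim T (0\<^sub>m N N) sequentially" "\<And>n. T n * D = D * T n"
    "\<And>n i. i < r \<Longrightarrow> T n * k i = D ^\<^sub>m j i * w i n"
proof -
  note dp = pow_mat_dims[OF D] carrier_matD[OF D]
  have bi: "k i \<in> carrier_mat N 1" "\<psi> i \<in> carrier_mat 1 N" "\<psi> i * D ^\<^sub>m Suc (j i) = 0\<^sub>m 1 N" if "i < r" for i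
    using sys that by (auto simp: graded_system_def biorthogonal_def)
  have or: "\<psi> i * k l = (if i = l then 1\<^sub>m 1 else 0\<^sub>m 1 1)" if "i < r" "l < r" for i l
    using sys that by (auto simp: graded_system_def biorthogonal_def)
  have dw: "dim_row (w i n) = N" "dim_col (w i n) = 1" if "i < r" for i n
    using mlimD(1,2)[OF w(1)[OF that]] by auto
  have "\<exists>T. mlim T (0\<^sub>m N N) sequentially \<and> (\<forall>n. T n * D = D * T n) \<and>
      (\<forall>n. \<forall>i<r. T n * k i = (if i < m then D ^\<^sub>m j i * w i n else 0\<^sub>m N 1))" if "m \<le> r" for m
    using that
  proof (induction m)
    case 0
    show ?case using D
      by (intro exI[of _ "\<lambda>_. 0\<^sub>m N N"]) (simp add: mlim_const left_mult_zero_mat[OF bi(1)])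
  next
    case (Suc m)
    then obtain T where T: "mlim T (0\<^sub>m N N) sequentially" "\<And>n. T n * D = D * T n"
      "\<And>n i. i < r \<Longrightarrow> T n * k i = (if i < m then D ^\<^sub>m j i * w i n else 0\<^sub>m N 1)" by auto
    from Suc.prems have m: "m < r" by simp
    from commuting_rank_one_extension[OF D bi(2,3)[OF m] w(1)[OF m] w(2)[OF m]] obtain R where
      R: "mlim R (0\<^sub>m N N) sequentially" "\<And>n. R n * D = D * R n"
      "\<And>n v. v \<in> carrier_mat N 1 \<Longrightarrow> D * v = 0\<^sub>m N 1 \<Longrightarrow> R n * v = D ^\<^sub>m j m * w m n * (\<psi> m * v)"
      by blast
    have dT: "dim_row (T n) = N" "dim_col (T n) = N" "dim_row (R n) = N" "dim_col (R n) = N" for n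
      using mlimD(1,2)[OF T(1)] mlimD(1,2)[OF R(1)] by auto
    have "mlim (\<lambda>n. T n + R n) (0\<^sub>m N N + 0\<^sub>m N N) sequentially"
      by (intro mlim_add T R) auto
    moreover have "(T n + R n) * D = D * (T n + R n)" for n
      by (simp add: add_mult_dim mult_add_dim dT dp T(2) R(2))
    moreover have "(T n + R n) * k i = (if i < Suc m then D ^\<^sub>m j i * w i n else 0\<^sub>m N 1)" if i: "i < r" for n i
    proof -
      have "R n * k i = (if i = m then D ^\<^sub>m j m * w m n else 0\<^sub>m N 1)"
        unfolding R(3)[OF bi(1)[OF i] ker[OF i]] or[OF m i]
        using m by (auto simp: mult_one_dim dw dp intro!: right_mult_zero_mat[of _ N 1] mult_carrier_mat[of _ N N])
      moreover have "(T n + R n) * k i = T n * k i + R n * k i"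
        using bi(1)[OF i] by (simp add: add_mult_dim dT)
      ultimately show ?thesis using dw[OF i] m
        by (auto simp: T(3)[OF i] less_Suc_eq dp dw[OF m] intro!: right_add_zero_mat[of _ N 1] left_add_zero_mat[of _ N 1] mult_carrier_mat[of _ N N])
    qed
    ultimately show ?case by (intro exI[of _ "\<lambda>n. T n + R n"]) auto
  qed
  from this[of r] show thesis using that by auto
qed

context real_subfield_loc
begin

section \<open>Rounding real numbers into the subfield\<close>

text \<open>
  Finitely many reals span a finite-dimensional vector space \<open>V\<close> over \<open>U\<close>. Moving the members of a basis
  into \<open>U\<close> by small amounts gives \<open>U\<close>-linear maps \<open>V \<rightarrow> U\<close> that converge to the identity. Applied to the
  entries of a real solution of a linear system with coefficients in \<open>U\<close>, they yield solutions over \<open>U\<close>.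
\<close>

definition rounding :: "real set \<Rightarrow> (nat \<Rightarrow> real \<Rightarrow> real) \<Rightarrow> bool" where
  "rounding V \<rho> \<longleftrightarrow> U \<subseteq> V \<and> (\<forall>x\<in>V. \<forall>y\<in>V. x + y \<in> V) \<and> (\<forall>u\<in>U. \<forall>x\<in>V. u * x \<in> V) \<and>
     (\<forall>n. \<forall>x\<in>V. \<rho> n x \<in> U) \<and> (\<forall>n. \<forall>x\<in>V. \<forall>y\<in>V. \<rho> n (x + y) = \<rho> n x + \<rho> n y) \<and>
     (\<forall>n. \<forall>u\<in>U. \<forall>x\<in>V. \<rho> n (u * x) = u * \<rho> n x) \<and> (\<forall>n. \<forall>u\<in>U. \<rho> n u = u) \<and>
     (\<forall>x\<in>V. (\<lambda>n. \<rho> n x) \<longlonglongrightarrow> x)"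

text \<open>
  Reals are adjoined one at a time. If \<open>x\<close> is not in \<open>V\<close>, then the sum \<open>V + U x\<close> is direct, because \<open>U\<close> is a
  field, and the image of \<open>x\<close> may be any sequence in \<open>U\<close> converging to \<open>x\<close>.
\<close>

lemma rounding_exists:
  assumes "finite F"
  shows "\<exists>V \<rho>. rounding V \<rho> \<and> F \<subseteq> V"
  using assms
proof (induction F)
  case empty
  show ?case
    by (intro exI[of _ U] exI[of _ "\<lambda>_ x. x"]) (auto simp: rounding_def add_in mult_in)
next
  case (insert x F)
  then obtain V \<rho> where r: "rounding V \<rho>" "F \<subseteq> V" by blast
  show ?case
  proof (cases "x \<in> V")
    case True
    with r show ?thesis by blast
  next
    case False
    obtain q where q: "\<And>n. q n \<in> U" "q \<longlonglongrightarrow> x" using dense_sequence by blast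
    note R = r(1)[unfolded rounding_def]
    define V' where "V' = {v + u * x |v u. v \<in> V \<and> u \<in> U}"
    define \<rho>' where "\<rho>' n z = (let p = SOME p. fst p \<in> V \<and> snd p \<in> U \<and> z = fst p + snd p * x
      in \<rho> n (fst p) + snd p * q n)" for n z
    have uniq: "v = v' \<and> u = u'" if "v \<in> V" "v' \<in> V" "u \<in> U" "u' \<in> U" "v + u * x = v' + u' * x" for v v' u u'
    proof (rule ccontr)
      assume "\<not> (v = v' \<and> u = u')"
      then have "u - u' \<noteq> 0" using that(5) by auto
      moreover have "(u - u') * x = v' + (-1) * v" using that(5) by (simp add: algebra_simps)
      ultimately have "x = inverse (u - u') * (v' + (-1) * v)" by (simp add: field_simps)
      moreover have "(-1) * v \<in> V" using R that uminus_in[OF one_in] by blast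
      moreover have "inverse (u - u') \<in> U" using that by (intro inverse_in diff_in)
      ultimately have "x \<in> V" using R that by metis
      with False show False ..
    qed
    have \<rho>': "\<rho>' n (v + u * x) = \<rho> n v + u * q n" if "v \<in> V" "u \<in> U" for n v u
    proof -
      have "(SOME p. fst p \<in> V \<and> snd p \<in> U \<and> v + u * x = fst p + snd p * x) = (v, u)"
        by (rule some_equality) (use that uniq in \<open>auto intro!: prod_eqI\<close>)
      then show ?thesis by (simp add: \<rho>'_def)
    qed
    have 0: "0 \<in> V" using R zero_in by blast
    have \<rho>0: "\<rho> n 0 = 0" for n using R zero_in by blast
    have VV': "V \<subseteq> V'" unfolding V'_def using zero_in by force
    have old: "\<rho>' n v = \<rho> n v" if "v \<in> V" for n v using \<rho>'[OF that zero_in, of n] by simp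
    have "rounding V' \<rho>'"
      unfolding rounding_def
    proof (intro conjI ballI allI)
      show "U \<subseteq> V'" using R VV' by blast
      show "\<rho>' n u = u" if "u \<in> U" for n u using R that old[of u n] by auto
    next
      fix a b assume "a \<in> V'" "b \<in> V'"
      then obtain v u v' u' where ab: "a = v + u * x" "b = v' + u' * x" "v \<in> V" "u \<in> U" "v' \<in> V" "u' \<in> U"
        unfolding V'_def by blast
      have eq: "a + b = (v + v') + (u + u') * x" using ab by (simp add: algebra_simps)
      have mem: "v + v' \<in> V" "u + u' \<in> U" using ab R add_in by auto
      show "a + b \<in> V'" unfolding V'_def using eq mem by blast
      show "\<rho>' n (a + b) = \<rho>' n a + \<rho>' n b" for n
        unfolding eq \<rho>'[OF mem] unfolding ab(1,2) \<rho>'[OF ab(3,4)] \<rho>'[OF ab(5,6)]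
        using R ab by (simp add: algebra_simps)
    next
      fix w a assume w: "w \<in> U" and "a \<in> V'"
      then obtain v u where a: "a = v + u * x" "v \<in> V" "u \<in> U" unfolding V'_def by blast
      have eq: "w * a = w * v + (w * u) * x" using a by (simp add: algebra_simps)
      have mem: "w * v \<in> V" "w * u \<in> U" using a w R mult_in by auto
      show "w * a \<in> V'" unfolding V'_def using eq mem by blast
      show "\<rho>' n (w * a) = w * \<rho>' n a" for n
        unfolding eq \<rho>'[OF mem] unfolding a(1) \<rho>'[OF a(2,3)]
        using R a w by (simp add: distrib_left mult.assoc)
    next
      fix a assume "a \<in> V'"
      then obtain v u where a: "a = v + u * x" "v \<in> V" "u \<in> U" unfolding V'_def by blast
      show "\<rho>' n a \<in> U" for n unfolding a(1) \<rho>'[OF a(2,3)] using R a q by (auto intro!: add_in mult_in)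
      show "(\<lambda>n. \<rho>' n a) \<longlonglongrightarrow> a" unfolding a(1) \<rho>'[OF a(2,3)]
        using R a q by (auto intro!: tendsto_add tendsto_mult)
    qed
    moreover have "x \<in> V'"
      unfolding V'_def using 0 one_in by (intro CollectI exI[of _ 0] exI[of _ 1]) auto
    ultimately show ?thesis using r(2) VV' by (intro exI[of _ V'] exI[of _ \<rho>']) auto
  qed
qed

lemma rounding_sum:
  assumes "rounding V \<rho>" "finite I" "\<And>i. i \<in> I \<Longrightarrow> f i \<in> V"
  shows "sum f I \<in> V \<and> \<rho> n (sum f I) = (\<Sum>i\<in>I. \<rho> n (f i))"
  using assms(2,3)
proof (induction I)
  case empty
  show ?case using assms(1) zero_in by (auto simp: rounding_def)
next
  case (insert i I)
  then show ?case using assms(1) by (auto simp: rounding_def)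
qed

lemma rounding_mult:
  assumes r: "rounding V \<rho>" and "mat_over U D" "mat_over V M"
  shows "dim_col D = dim_row M \<Longrightarrow> map_mat (\<rho> n) (D * M) = D * map_mat (\<rho> n) M"
    "dim_col M = dim_row D \<Longrightarrow> map_mat (\<rho> n) (M * D) = map_mat (\<rho> n) M * D"
proof -
  assume d: "dim_col D = dim_row M"
  show "map_mat (\<rho> n) (D * M) = D * map_mat (\<rho> n) M"
  proof (rule eq_matI)
    fix i j assume ij: "i < dim_row (D * map_mat (\<rho> n) M)" "j < dim_col (D * map_mat (\<rho> n) M)"
    have mem: "D $$ (i,k) \<in> U" "M $$ (k,j) \<in> V" if "k < dim_row M" for k
      using assms(2,3) ij d that by (auto simp: mat_over_iff)
    have "\<rho> n ((D * M) $$ (i,j)) = (\<Sum>k<dim_row M. \<rho> n (D $$ (i,k) * M $$ (k,j)))"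
      using ij d mem r by (simp add: mult_entry) (intro rounding_sum[OF r, THEN conjunct2], auto simp: rounding_def)
    also have "\<dots> = (\<Sum>k<dim_row M. D $$ (i,k) * \<rho> n (M $$ (k,j)))"
      using mem r by (intro sum.cong refl) (auto simp: rounding_def)
    finally show "map_mat (\<rho> n) (D * M) $$ (i,j) = (D * map_mat (\<rho> n) M) $$ (i,j)"
      using ij d by (simp add: mult_entry)
  qed auto
next
  assume d: "dim_col M = dim_row D"
  show "map_mat (\<rho> n) (M * D) = map_mat (\<rho> n) M * D"
  proof (rule eq_matI)
    fix i j assume ij: "i < dim_row (map_mat (\<rho> n) M * D)" "j < dim_col (map_mat (\<rho> n) M * D)"
    have mem: "D $$ (k,j) \<in> U" "M $$ (i,k) \<in> V" if "k < dim_row D" for k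
      using assms(2,3) ij d that by (auto simp: mat_over_iff)
    have com: "M $$ (i,k) * D $$ (k,j) = D $$ (k,j) * M $$ (i,k)" for k by simp
    have "\<rho> n ((M * D) $$ (i,j)) = (\<Sum>k<dim_row D. \<rho> n (M $$ (i,k) * D $$ (k,j)))"
      using ij d mem r by (simp add: mult_entry com) (intro rounding_sum[OF r, THEN conjunct2], auto simp: rounding_def)
    also have "\<dots> = (\<Sum>k<dim_row D. \<rho> n (M $$ (i,k)) * D $$ (k,j))"
      using mem r by (intro sum.cong refl) (auto simp: rounding_def com)
    finally show "map_mat (\<rho> n) (M * D) $$ (i,j) = (map_mat (\<rho> n) M * D) $$ (i,j)"
      using ij d by (simp add: mult_entry)
  qed auto
qed

lemma rounding_fixes: "rounding V \<rho> \<Longrightarrow> mat_over U M \<Longrightarrow> map_mat (\<rho> n) M = M"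
  by (intro eq_matI) (auto simp: rounding_def mat_over_iff)

lemma rounding_mlim: "rounding V \<rho> \<Longrightarrow> mat_over V M \<Longrightarrow> mlim (\<lambda>n. map_mat (\<rho> n) M) M sequentially"
  by (auto simp: rounding_def mat_over_iff mlim_def)

lemma rounding_over: "rounding V \<rho> \<Longrightarrow> mat_over V M \<Longrightarrow> mat_over U (map_mat (\<rho> n) M)"
  by (auto simp: rounding_def mat_over_iff)

lemma finite_elements_mat: "finite (elements_mat M)" by (simp add: elements_mat_def)

lemma mat_over_pow:
  assumes "mat_over U D" "D \<in> carrier_mat N N" shows "mat_over U (D ^\<^sub>m k)"
proof (induction k)
  case 0
  show ?case by (simp add: mat_over_one)
next
  case (Suc k)
  then show ?case using assms by (auto intro!: mat_over_mult simp: pow_mat_dims[OF assms(2)])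
qed

lemma intertwiner_approximation:
  assumes C: "mat_over U C" "C \<in> carrier_mat n n" "mat_over U C'" "C' \<in> carrier_mat n n"
    and q: "q \<in> carrier_mat n n" "q * C = C' * q"
  obtains Q where "mlim Q q sequentially" "\<And>k. mat_over U (Q k)" "\<And>k. Q k * C = C' * Q k"
proof -
  obtain V \<rho> where r: "rounding V \<rho>" "elements_mat q \<subseteq> V"
    using rounding_exists[OF finite_elements_mat[of q]] by blast
  then have ov: "mat_over V q" by (simp add: mat_over_def)
  show thesis
  proof (rule that[of "\<lambda>n. map_mat (\<rho> n) q"])
    show "map_mat (\<rho> k) q * C = C' * map_mat (\<rho> k) q" for k
      using rounding_mult(2)[OF r(1) C(1) ov, of k] rounding_mult(1)[OF r(1) C(3) ov, of k] q C by simp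
  qed (use r ov rounding_mlim rounding_over in auto)
qed

section \<open>Splitting over the subfield\<close>

text \<open>
  Let \<open>K\<close> have as columns a graded basis of the kernel of \<open>P\<close>, and let \<open>\<Psi>\<close> have the dual functionals as
  rows. Rounding \<open>K\<close> gives \<open>K' n = \<kappa> n * K\<close> with \<open>\<kappa> n\<close> commuting with \<open>D\<close> and close to the identity. The
  rounding of \<open>P\<close> satisfies \<open>S p = D\<close> but its rank may be too large; composing it with a projection
  along \<open>K' n\<close> repairs this and gives \<open>p n\<close>. Finally \<open>P\<close> and \<open>p n\<close> are intertwined, \<open>G n * P = p n * \<kappa> n\<close> and
  \<open>S * G n = \<kappa> n * S\<close>, where \<open>G n\<close> is a lift of \<open>\<kappa> n\<close> along \<open>S\<close>, corrected with the help of a matrix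
  \<open>L\<close> that inverts \<open>P\<close> from the left modulo its kernel.
\<close>

lemma split_over_subfield:
  assumes S: "S \<in> carrier_mat m N" "mat_over U S" and \<Sigma>: "\<Sigma> \<in> carrier_mat N m" "S * \<Sigma> = 1\<^sub>m m"
    and P: "P \<in> carrier_mat N m" and D: "D = S * P" "mat_over U D"
  obtains p G where "mlim p P sequentially" "mlim G (1\<^sub>m N) sequentially"
    "\<forall>\<^sub>F n in sequentially. mat_over U (p n) \<and> S * p n = D \<and> G n * (P * S) = (p n * S) * G n"
proof -
  have Dc: "D \<in> carrier_mat m m" using S P D by auto
  note d = carrier_matD[OF S(1)] carrier_matD[OF \<Sigma>(1)] carrier_matD[OF P] carrier_matD[OF Dc]
  note dp = pow_mat_dims[OF Dc]
  have kerD: "D * v = 0\<^sub>m m 1" if "v \<in> carrier_mat m 1" "P * v = 0\<^sub>m N 1" for v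
  proof -
    have "D * v = S * (P * v)" unfolding D by (rule mult_assoc_dim) (use that in \<open>auto simp: d\<close>)
    then show ?thesis unfolding that(2) by (simp add: right_mult_zero_mat[OF S(1)])
  qed
  from adapted_kernel_basis[OF Dc P kerD] obtain r k \<psi> j y where
    sys: "graded_system D P m r k \<psi> j y" and
    complete: "\<And>v. v \<in> carrier_mat m 1 \<Longrightarrow> P * v = 0\<^sub>m N 1 \<Longrightarrow> (\<And>i. i < r \<Longrightarrow> \<psi> i * v = 0\<^sub>m 1 1) \<Longrightarrow> v = 0\<^sub>m m 1"
    by blast
  have bi: "k i \<in> carrier_mat m 1" "\<psi> i \<in> carrier_mat 1 m" "y i \<in> carrier_mat m 1"
    "P * k i = 0\<^sub>m N 1" "k i = D ^\<^sub>m j i * y i" if "i < r" for i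
    using sys that by (auto simp: graded_system_def biorthogonal_def d)
  have or: "\<psi> i * k l = (if i = l then 1\<^sub>m 1 else 0\<^sub>m 1 1)" if "i < r" "l < r" for i l
    using sys that by (auto simp: graded_system_def biorthogonal_def)
  note dk = carrier_matD[OF bi(1)] carrier_matD[OF bi(2)] carrier_matD[OF bi(3)]
  define F where "F = elements_mat P \<union> (\<Union>i<r. elements_mat (k i) \<union> elements_mat (\<psi> i) \<union> elements_mat (y i))"
  have "finite F" unfolding F_def by (intro finite_UnI finite_UN_I finite_elements_mat) auto
  then obtain V \<rho> where r: "rounding V \<rho>" "F \<subseteq> V" using rounding_exists by blast
  have ov: "mat_over V P" "\<And>i. i < r \<Longrightarrow> mat_over V (k i)" "\<And>i. i < r \<Longrightarrow> mat_over V (\<psi> i)"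
    "\<And>i. i < r \<Longrightarrow> mat_over V (y i)"
    using r(2) by (auto simp: F_def mat_over_def)
  \<comment> \<open>The displacement of \<open>y i\<close> by rounding. It is killed by \<open>D ^\<^sub>m Suc (j i)\<close>, because
    rounding respects the equation \<open>D ^\<^sub>m Suc (j i) * y i = 0\<close> over \<open>U\<close>.\<close>
  define w where "w i n = map_mat (\<rho> n) (y i) - y i" for i n
  have wlim: "mlim (w i) (0\<^sub>m m 1) sequentially" if i: "i < r" for i
  proof -
    have "mlim (w i) (y i - y i) sequentially"
      unfolding w_def by (intro mlim_minus rounding_mlim[OF r(1)] ov i mlim_const) auto
    moreover have "y i - y i = 0\<^sub>m m 1" using bi(3)[OF i] by auto
    ultimately show ?thesis by simp
  qed
  have Dk: "D * k i = 0\<^sub>m m 1" if "i < r" for i by (rule kerD) (use bi that in auto)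
  have round_zero: "map_mat (\<rho> n) (0\<^sub>m a b) = 0\<^sub>m a b" for a b n
    by (rule rounding_fixes[OF r(1)]) (auto simp: mat_over_iff zero_in)
  have Dy: "D ^\<^sub>m Suc (j i) * y i = 0\<^sub>m m 1" if i: "i < r" for i
  proof -
    have "D ^\<^sub>m Suc (j i) * y i = D * k i"
      unfolding bi(5)[OF i] pow_mat_Suc_left[OF Dc] by (rule mult_assoc_dim) (use dk i in \<open>auto simp: dp d\<close>)
    then show ?thesis by (simp add: Dk i)
  qed
  have wD: "D ^\<^sub>m Suc (j i) * w i n = 0\<^sub>m m 1" if i: "i < r" for i n
  proof -
    have "D ^\<^sub>m Suc (j i) * map_mat (\<rho> n) (y i) = map_mat (\<rho> n) (D ^\<^sub>m Suc (j i) * y i)"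
      using rounding_mult(1)[OF r(1) mat_over_pow[OF D(2) Dc] ov(4)[OF i], of "Suc (j i)" n] dk[OF i]
      by (simp add: dp d del: pow_mat.simps)
    then have "D ^\<^sub>m Suc (j i) * map_mat (\<rho> n) (y i) = 0\<^sub>m m 1" unfolding Dy[OF i] round_zero .
    then show ?thesis unfolding w_def
      by (subst mult_minus_dim) (use dk[OF i] Dy[OF i] in \<open>auto simp: dp d simp del: pow_mat.simps\<close>)
  qed
  from commuting_perturbation[OF Dc sys wlim wD Dk] obtain T where
    T: "mlim T (0\<^sub>m m m) sequentially" "\<And>n. T n * D = D * T n"
    "\<And>n i. i < r \<Longrightarrow> T n * k i = D ^\<^sub>m j i * w i n" by blast
  have dT: "dim_row (T n) = m" "dim_col (T n) = m" for n using mlimD(1,2)[OF T(1)] by auto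
  define \<kappa> where "\<kappa> n = 1\<^sub>m m + T n" for n
  have d\<kappa>: "dim_row (\<kappa> n) = m" "dim_col (\<kappa> n) = m" for n by (simp_all add: \<kappa>_def dT)
  have \<kappa>k: "\<kappa> n * k i = map_mat (\<rho> n) (k i)" if i: "i < r" for n i
  proof -
    have "\<kappa> n * k i = k i + D ^\<^sub>m j i * w i n"
      unfolding \<kappa>_def using dk[OF i] by (simp add: add_mult_dim dT T(3)[OF i] one_mult_dim)
    also have "D ^\<^sub>m j i * w i n = D ^\<^sub>m j i * map_mat (\<rho> n) (y i) - k i"
      unfolding w_def by (subst mult_minus_dim) (use dk[OF i] bi(5)[OF i] in \<open>auto simp: dp d\<close>)
    also have "D ^\<^sub>m j i * map_mat (\<rho> n) (y i) = map_mat (\<rho> n) (k i)"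
      using rounding_mult(1)[OF r(1) mat_over_pow[OF D(2) Dc] ov(4)[OF i], of "j i" n] dk[OF i] bi(5)[OF i]
      by (simp add: dp d)
    finally have *: "\<kappa> n * k i = k i + (map_mat (\<rho> n) (k i) - k i)" .
    show ?thesis unfolding * using dk[OF i] by (intro eq_matI) auto
  qed
  define K where "K = mat m r (\<lambda>(a,i). k i $$ (a,0))"
  define \<Psi> where "\<Psi> = mat r m (\<lambda>(i,a). \<psi> i $$ (0,a))"
  have dK: "dim_row K = m" "dim_col K = r" "dim_row \<Psi> = r" "dim_col \<Psi> = m" by (simp_all add: K_def \<Psi>_def)
  have ovK: "mat_over V K" "mat_over V \<Psi>"
    using ov(2,3) by (auto simp: mat_over_iff K_def \<Psi>_def dk)
  have MK: "(M * K) $$ (a,i) = (M * k i) $$ (a,0)" if "i < r" "dim_col M = m" "a < dim_row M" for M a i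
    using that by (subst (1 2) mult_entry) (auto simp: K_def dk)
  have \<Psi>M: "(\<Psi> * M) $$ (i,b) = (\<psi> i * M) $$ (0,b)" if "i < r" "dim_row M = m" "b < dim_col M" for M b i
    using that by (subst (1 2) mult_entry) (auto simp: \<Psi>_def dk)
  have \<Psi>K: "\<Psi> * K = 1\<^sub>m r"
    by (rule eq_matI) (auto simp: \<Psi>M dK MK dk or)
  have PK: "P * K = 0\<^sub>m N r"
    by (rule eq_matI) (auto simp: MK d dK bi(4))
  define K' where "K' n = map_mat (\<rho> n) K" for n
  have dK': "dim_row (K' n) = m" "dim_col (K' n) = r" for n by (simp_all add: K'_def dK)
  have \<kappa>K: "\<kappa> n * K = K' n" for n
  proof (rule eq_matI)
    fix a i assume "a < dim_row (K' n)" "i < dim_col (K' n)"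
    then have ai: "a < m" "i < r" by (simp_all add: dK')
    then show "(\<kappa> n * K) $$ (a,i) = K' n $$ (a,i)"
      by (subst MK) (auto simp: d\<kappa> \<kappa>k K'_def K_def dk)
  qed (auto simp: d\<kappa> dK dK')
  have DK: "D * K = 0\<^sub>m m r" by (rule eq_matI) (auto simp: MK d dK Dk)
  have DK': "D * K' n = 0\<^sub>m m r" for n
    using rounding_mult(1)[OF r(1) D(2) ovK(1), of n] by (simp add: d dK DK round_zero K'_def)
  \<comment> \<open>The rounded functionals are no longer dual to the rounded basis; multiplication with the
    inverse of \<open>R n\<close> makes them so.\<close>
  define R where "R n = map_mat (\<rho> n) \<Psi> * K' n" for n
  define \<Psi>' where "\<Psi>' n = minv (R n) * map_mat (\<rho> n) \<Psi>" for n
  have dR: "dim_row (R n) = r" "dim_col (R n) = r" for n by (simp_all add: R_def dK dK')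
  have d\<Psi>': "dim_row (\<Psi>' n) = r" "dim_col (\<Psi>' n) = m" for n by (simp_all add: \<Psi>'_def dK dR)
  have K'lim: "mlim K' K sequentially" unfolding K'_def by (rule rounding_mlim[OF r(1) ovK(1)])
  have \<rho>\<Psi>lim: "mlim (\<lambda>n. map_mat (\<rho> n) \<Psi>) \<Psi> sequentially" by (rule rounding_mlim[OF r(1) ovK(2)])
  have Rlim: "mlim R (1\<^sub>m r) sequentially"
    unfolding R_def \<Psi>K[symmetric] by (intro mlim_mult K'lim \<rho>\<Psi>lim) (simp add: dK)
  have invR: "\<forall>\<^sub>F n in sequentially. inverses r (R n) (minv (R n))"
    by (rule eventually_inverses[OF Rlim]) auto
  have "mlim \<Psi>' (1\<^sub>m r * \<Psi>) sequentially"
    unfolding \<Psi>'_def by (intro mlim_mult mlim_minv_one Rlim \<rho>\<Psi>lim) (simp add: dK)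
  then have \<Psi>'lim: "mlim \<Psi>' \<Psi> sequentially" by (simp add: one_mult_dim dK)
  have over': "mat_over U (K' n)" "mat_over U (\<Psi>' n)" for n
  proof -
    show "mat_over U (K' n)" unfolding K'_def by (rule rounding_over[OF r(1) ovK(1)])
    then show "mat_over U (\<Psi>' n)" unfolding \<Psi>'_def R_def
      by (intro mat_over_mult mat_over_minv rounding_over[OF r(1) ovK(2)]) (auto simp: dK dK')
  qed
  \<comment> \<open>The projection makes \<open>K' n\<close> part of the kernel and does not affect the product with \<open>S\<close>,
    since \<open>D\<close> kills \<open>K' n\<close>.\<close>
  define p where "p n = map_mat (\<rho> n) P * (1\<^sub>m m - K' n * \<Psi>' n)" for n
  have dpn: "dim_row (p n) = N" "dim_col (p n) = m" for n by (simp_all add: p_def d d\<Psi>')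
  have plim0: "mlim p (P * (1\<^sub>m m - K * \<Psi>)) sequentially"
    unfolding p_def
    by (intro mlim_mult mlim_minus mlim_const K'lim \<Psi>'lim rounding_mlim[OF r(1) ov(1)]) (auto simp: d dK)
  have "P * (1\<^sub>m m - K * \<Psi>) = P * 1\<^sub>m m - P * K * \<Psi>"
    by (simp add: mult_minus_dim mult_assoc_dim d dK)
  also have "\<dots> = P" unfolding PK using d dK
    by (intro eq_matI) (auto simp: mult_one_dim zero_mult_dim mult_zero_dim)
  finally have plim: "mlim p P sequentially" using plim0 by simp
  have pover: "mat_over U (p n)" for n
    unfolding p_def by (intro mat_over_mult mat_over_minus mat_over_one over' rounding_over[OF r(1) ov(1)])
       (auto simp: d dK' d\<Psi>')
  have Sp: "S * p n = D" for n
  proof -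
    have "S * p n = S * map_mat (\<rho> n) P * (1\<^sub>m m - K' n * \<Psi>' n)"
      unfolding p_def by (rule mult_assoc_dim[symmetric]) (auto simp: d dK' d\<Psi>')
    also have "S * map_mat (\<rho> n) P = D"
      using rounding_mult(1)[OF r(1) S(2) ov(1), of n] rounding_fixes[OF r(1) D(2), of n] by (simp add: d D)
    also have "D * (1\<^sub>m m - K' n * \<Psi>' n) = D * 1\<^sub>m m - D * K' n * \<Psi>' n"
      by (simp add: mult_minus_dim mult_assoc_dim d dK' d\<Psi>')
    also have "\<dots> = D" unfolding DK' using d d\<Psi>'
      by (intro eq_matI) (auto simp: mult_one_dim zero_mult_dim mult_zero_dim)
    finally show ?thesis .
  qed
  have pK: "\<forall>\<^sub>F n in sequentially. p n * K' n = 0\<^sub>m N r"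
    using invR
  proof eventually_elim
    case (elim n)
    have "\<Psi>' n * K' n = 1\<^sub>m r"
      using inversesD(6)[OF elim] by (simp add: \<Psi>'_def mult_assoc_dim dR dK dK' flip: R_def)
    then have "(1\<^sub>m m - K' n * \<Psi>' n) * K' n = K' n - K' n"
      by (simp add: minus_mult_dim mult_assoc_dim dK' d\<Psi>' one_mult_dim mult_one_dim)
    also have "\<dots> = 0\<^sub>m m r" using dK' by (intro eq_matI) auto
    finally have "(1\<^sub>m m - K' n * \<Psi>' n) * K' n = 0\<^sub>m m r" .
    then show ?case unfolding p_def using P
      by (subst mult_assoc_dim) (auto simp: d dK' d\<Psi>' zero_mult_dim mult_zero_dim)
  qed
  obtain L where L: "L \<in> carrier_mat m N" "L * P = 1\<^sub>m m - K * \<Psi>"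
  proof (rule left_factor_of_kernel_subset[OF P, of "1\<^sub>m m - K * \<Psi>" m])
    fix v assume v: "v \<in> carrier_mat m 1" "P * v = 0\<^sub>m N 1"
    have e: "(1\<^sub>m m - K * \<Psi>) * v = v - K * (\<Psi> * v)"
      using v(1) by (simp add: minus_mult_dim mult_assoc_dim one_mult_dim dK)
    show "(1\<^sub>m m - K * \<Psi>) * v = 0\<^sub>m m 1"
      unfolding e
    proof (rule complete)
      show "v - K * (\<Psi> * v) \<in> carrier_mat m 1" using v(1) by (auto simp: dK intro!: carrier_matI)
      have "P * (v - K * (\<Psi> * v)) = P * v - P * K * (\<Psi> * v)"
        using v(1) by (simp add: mult_minus_dim mult_assoc_dim d dK)
      also have "\<dots> = 0\<^sub>m N 1" unfolding PK v(2) using v(1)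
        by (intro eq_matI) (auto simp: zero_mult_dim mult_zero_dim dK)
      finally show "P * (v - K * (\<Psi> * v)) = 0\<^sub>m N 1" .
      have "\<Psi> * (v - K * (\<Psi> * v)) = \<Psi> * v - \<Psi> * K * (\<Psi> * v)"
        using v(1) by (simp add: mult_minus_dim mult_assoc_dim d dK)
      also have "\<dots> = 0\<^sub>m r 1" unfolding \<Psi>K using v(1)
        by (intro eq_matI) (auto simp: one_mult_dim dK)
      finally have 0: "\<Psi> * (v - K * (\<Psi> * v)) = 0\<^sub>m r 1" .
      show "\<psi> i * (v - K * (\<Psi> * v)) = 0\<^sub>m 1 1" if i: "i < r" for i
      proof (rule eq_matI)
        fix a b assume "a < dim_row (0\<^sub>m 1 1 :: real mat)" "b < dim_col (0\<^sub>m 1 1 :: real mat)"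
        then show "(\<psi> i * (v - K * (\<Psi> * v))) $$ (a,b) = 0\<^sub>m 1 1 $$ (a,b)"
          using \<Psi>M[OF i, of "v - K * (\<Psi> * v)" 0] i v(1) by (auto simp: 0 dK)
      qed (use dk[OF i] v(1) in \<open>auto simp: dK\<close>)
    qed
  qed (auto simp: dK intro!: carrier_matI)
  note dL = carrier_matD[OF L(1)]
  define \<kappa>' where "\<kappa>' n = 1\<^sub>m N + \<Sigma> * T n * S" for n
  have d\<kappa>': "dim_row (\<kappa>' n) = N" "dim_col (\<kappa>' n) = N" for n by (simp_all add: \<kappa>'_def d)
  have S\<kappa>': "S * \<kappa>' n = \<kappa> n * S" for n
  proof -
    have "S * (\<Sigma> * T n * S) = S * \<Sigma> * T n * S" by (simp add: mult_assoc_dim d dT)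
    then show ?thesis unfolding \<Sigma>(2) \<kappa>'_def \<kappa>_def
      by (simp add: mult_add_dim add_mult_dim one_mult_dim mult_one_dim d dT)
  qed
  define X' where "X' n = p n * \<kappa> n - \<kappa>' n * P" for n
  have dX': "dim_row (X' n) = N" "dim_col (X' n) = m" for n by (simp_all add: X'_def d dpn d\<kappa>' d\<kappa>)
  \<comment> \<open>The columns of \<open>X' n * K\<close> vanish, so \<open>X' n * (L * P) = X' n\<close>; and \<open>S * X' n = 0\<close>, so the
    correction is not seen by \<open>S\<close>.\<close>
  define G where "G n = \<kappa>' n + X' n * L" for n
  have dG: "dim_row (G n) = N" "dim_col (G n) = N" for n by (simp_all add: G_def d\<kappa>' dX' dL)
  have \<kappa>lim: "mlim \<kappa> (1\<^sub>m m) sequentially"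
  proof -
    have "mlim \<kappa> (1\<^sub>m m + 0\<^sub>m m m) sequentially" unfolding \<kappa>_def by (intro mlim_add mlim_const T) auto
    then show ?thesis by simp
  qed
  have \<kappa>'lim: "mlim \<kappa>' (1\<^sub>m N) sequentially"
  proof -
    have "mlim \<kappa>' (1\<^sub>m N + \<Sigma> * 0\<^sub>m m m * S) sequentially"
      unfolding \<kappa>'_def by (intro mlim_add mlim_mult mlim_const T) (auto simp: d)
    moreover have "1\<^sub>m N + \<Sigma> * 0\<^sub>m m m * S = 1\<^sub>m N"
      using \<Sigma>(1) S(1) by (simp add: right_mult_zero_mat[OF \<Sigma>(1)] left_mult_zero_mat[OF S(1)])
    ultimately show ?thesis by simp
  qed
  have Glim: "mlim G (1\<^sub>m N) sequentially"
  proof -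
    have "mlim G (1\<^sub>m N + (P * 1\<^sub>m m - 1\<^sub>m N * P) * L) sequentially"
      unfolding G_def X'_def by (intro mlim_add mlim_mult mlim_minus mlim_const plim \<kappa>lim \<kappa>'lim) (auto simp: d dL)
    moreover have "P * 1\<^sub>m m - 1\<^sub>m N * P = 0\<^sub>m N m"
      by (intro eq_matI) (auto simp: d one_mult_dim mult_one_dim)
    ultimately show ?thesis by (simp add: left_mult_zero_mat[OF L(1)])
  qed
  have SX': "S * X' n = 0\<^sub>m m m" for n
  proof -
    have "S * X' n = D * \<kappa> n - \<kappa> n * D"
    proof -
      have "S * (p n * \<kappa> n) = D * \<kappa> n"
        using mult_assoc_dim[of S "p n" "\<kappa> n"] Sp by (simp add: d dpn d\<kappa>)
      moreover have "S * (\<kappa>' n * P) = \<kappa> n * D"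
        using mult_assoc_dim[of S "\<kappa>' n" P] mult_assoc_dim[of "\<kappa> n" S P] S\<kappa>'[of n]
        by (simp add: d d\<kappa> d\<kappa>' D(1)[symmetric])
      ultimately show ?thesis unfolding X'_def by (subst mult_minus_dim) (auto simp: d dpn d\<kappa> d\<kappa>')
    qed
    also have "D * \<kappa> n = \<kappa> n * D"
      unfolding \<kappa>_def by (simp add: mult_add_dim add_mult_dim one_mult_dim mult_one_dim d dT T(2))
    finally show ?thesis by (auto simp: d\<kappa> d)
  qed
  have SG: "S * G n = \<kappa> n * S" for n
  proof -
    have "S * (X' n * L) = S * X' n * L" by (simp add: mult_assoc_dim d dX' dL)
    also have "\<dots> = 0\<^sub>m m N" unfolding SX' by (rule left_mult_zero_mat[OF L(1)])
    finally show ?thesis unfolding G_def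
      by (subst mult_add_dim) (auto simp: d d\<kappa>' d\<kappa> dX' dL S\<kappa>')
  qed
  have "\<forall>\<^sub>F n in sequentially. mat_over U (p n) \<and> S * p n = D \<and> G n * (P * S) = (p n * S) * G n"
    using pK
  proof eventually_elim
    case (elim n)
    have "X' n * K = p n * (\<kappa> n * K) - \<kappa>' n * (P * K)"
      unfolding X'_def by (simp add: minus_mult_dim mult_assoc_dim d dpn d\<kappa> d\<kappa>' dK)
    also have "\<dots> = 0\<^sub>m N r"
      unfolding \<kappa>K elim PK by (intro eq_matI) (auto simp: mult_zero_dim d\<kappa>')
    finally have XK: "X' n * K = 0\<^sub>m N r" .
    have "X' n * (L * P) = X' n - X' n * K * \<Psi>"
      unfolding L(2) by (simp add: mult_minus_dim mult_assoc_dim mult_one_dim dX' dK)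
    also have "\<dots> = X' n" unfolding XK using dX' dK
      by (intro eq_matI) (auto simp: zero_mult_dim mult_zero_dim)
    finally have "G n * P = \<kappa>' n * P + X' n"
      unfolding G_def by (simp add: add_mult_dim mult_assoc_dim d\<kappa>' dX' dL d)
    then have GP: "G n * P = p n * \<kappa> n"
      unfolding X'_def by (intro eq_matI) (auto simp: d dpn d\<kappa> d\<kappa>')
    have "G n * (P * S) = G n * P * S" by (simp add: mult_assoc_dim dG d)
    also have "\<dots> = p n * (\<kappa> n * S)" unfolding GP by (simp add: mult_assoc_dim dpn d\<kappa> d)
    also have "\<dots> = p n * S * G n" unfolding SG[symmetric] by (simp add: mult_assoc_dim dpn dG d)
    finally show ?case using pover Sp by auto
  qed
  with plim Glim show thesis using that by blast
qed

end

section \<open>Lifting along a row splitting\<close>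

text \<open>
  For a right inverse \<open>\<Sigma>\<close> of \<open>S\<close> this is a multiplicative way of lifting operators on the range of \<open>S\<close> to its
  domain.
\<close>

definition lift_along :: "real mat \<Rightarrow> real mat \<Rightarrow> real mat \<Rightarrow> real mat" where
  "lift_along \<Sigma> S h = 1\<^sub>m (dim_col S) + \<Sigma> * (h - 1\<^sub>m (dim_row S)) * S"

lemma lift_along_dim [simp]:
  "S \<in> carrier_mat m N \<Longrightarrow> \<Sigma> \<in> carrier_mat N m \<Longrightarrow> dim_row (lift_along \<Sigma> S h) = N"
  "S \<in> carrier_mat m N \<Longrightarrow> \<Sigma> \<in> carrier_mat N m \<Longrightarrow> dim_col (lift_along \<Sigma> S h) = N"
  by (auto simp: lift_along_def)

lemma lift_along_intertwines:
  assumes S: "S \<in> carrier_mat m N" and \<Sigma>: "\<Sigma> \<in> carrier_mat N m" "S * \<Sigma> = 1\<^sub>m m" and h: "h \<in> carrier_mat m m"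
  shows "S * lift_along \<Sigma> S h = h * S"
proof -
  note d = carrier_matD[OF S] carrier_matD[OF \<Sigma>(1)] carrier_matD[OF h]
  have "S * (\<Sigma> * (h - 1\<^sub>m m) * S) = S * \<Sigma> * (h - 1\<^sub>m m) * S"
    by (simp add: mult_assoc_dim d)
  then have "S * lift_along \<Sigma> S h = S + (h * S - S)"
    unfolding \<Sigma>(2) lift_along_def by (simp add: mat_dim d)
  then show ?thesis by (auto simp: d)
qed

lemma lift_along_mult:
  assumes S: "S \<in> carrier_mat m N" and \<Sigma>: "\<Sigma> \<in> carrier_mat N m" "S * \<Sigma> = 1\<^sub>m m"
    and h: "h \<in> carrier_mat m m" "h' \<in> carrier_mat m m"
  shows "lift_along \<Sigma> S h * lift_along \<Sigma> S h' = lift_along \<Sigma> S (h * h')"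
proof -
  note d = carrier_matD[OF S] carrier_matD[OF \<Sigma>(1)] carrier_matD[OF h(1)] carrier_matD[OF h(2)]
  have "lift_along \<Sigma> S h * lift_along \<Sigma> S h'
      = lift_along \<Sigma> S h' + \<Sigma> * (h - 1\<^sub>m m) * (S * lift_along \<Sigma> S h')"
    using lift_along_dim[OF S \<Sigma>(1), of h']
    by (subst lift_along_def[of \<Sigma> S h]) (simp add: add_mult_dim mult_assoc_dim one_mult_dim d)
  also have "\<dots> = lift_along \<Sigma> S h' + \<Sigma> * (h - 1\<^sub>m m) * (h' * S)"
    by (simp add: lift_along_intertwines[OF S \<Sigma> h(2)])
  also have "\<dots> = lift_along \<Sigma> S (h * h')"
    by (rule eq_matI) (simp_all add: lift_along_def d mat_dim)
  finally show ?thesis .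
qed

lemma lift_along_inverses:
  assumes S: "S \<in> carrier_mat m N" and \<Sigma>: "\<Sigma> \<in> carrier_mat N m" "S * \<Sigma> = 1\<^sub>m m" and h: "inverses m h h'"
  shows "inverses N (lift_along \<Sigma> S h) (lift_along \<Sigma> S h')"
proof -
  have c: "h \<in> carrier_mat m m" "h' \<in> carrier_mat m m" using h by (auto simp: inverses_def)
  have 0: "1\<^sub>m m - 1\<^sub>m m = (0\<^sub>m m m :: real mat)" by (intro eq_matI) auto
  have "lift_along \<Sigma> S (1\<^sub>m m) = 1\<^sub>m N"
    unfolding lift_along_def carrier_matD[OF S] 0
    by (simp add: right_mult_zero_mat[OF \<Sigma>(1)] left_mult_zero_mat[OF S])
  then show ?thesis
    unfolding inverses_def using lift_along_mult[OF S \<Sigma> c] lift_along_mult[OF S \<Sigma> c(2,1)] inversesD[OF h] S \<Sigma>(1)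
    by (auto intro!: carrier_matI)
qed

lemma lift_along_mlim:
  assumes S: "S \<in> carrier_mat m N" and \<Sigma>: "\<Sigma> \<in> carrier_mat N m" and h: "mlim h (1\<^sub>m m) F"
  shows "mlim (\<lambda>x. lift_along \<Sigma> S (h x)) (1\<^sub>m N) F"
proof -
  have "mlim (\<lambda>x. lift_along \<Sigma> S (h x)) (1\<^sub>m N + \<Sigma> * (1\<^sub>m m - 1\<^sub>m m) * S) F"
    unfolding lift_along_def
    using S \<Sigma> by (auto intro!: mlim_add mlim_mult mlim_minus mlim_const h)
  moreover have 0: "1\<^sub>m m - 1\<^sub>m m = (0\<^sub>m m m :: real mat)" by (intro eq_matI) auto
  have "1\<^sub>m N + \<Sigma> * (1\<^sub>m m - 1\<^sub>m m) * S = 1\<^sub>m N"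
    unfolding 0 by (simp add: right_mult_zero_mat[OF \<Sigma>] left_mult_zero_mat[OF S])
  ultimately show ?thesis by simp
qed

definition diagonal :: "nat \<Rightarrow> (nat \<Rightarrow> real) \<Rightarrow> real mat" where
  "diagonal n f = mat n n (\<lambda>(i,j). if i = j then f i else 0)"

lemma diagonal_dim [simp]: "dim_row (diagonal n f) = n" "dim_col (diagonal n f) = n"
  by (simp_all add: diagonal_def)

lemma diagonal_mult:
  assumes "i < n" "dim_row M = n" "j < dim_col M"
  shows "(diagonal n f * M) $$ (i,j) = f i * M $$ (i,j)"
proof -
  have "(diagonal n f * M) $$ (i,j) = (\<Sum>k<n. diagonal n f $$ (i,k) * M $$ (k,j))"
    using assms by (simp add: mult_entry)
  also have "\<dots> = (\<Sum>k<n. if k = i then f i * M $$ (i,j) else 0)"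
    by (intro sum.cong refl) (use assms in \<open>auto simp: diagonal_def\<close>)
  finally show ?thesis using assms by simp
qed

lemma mult_diagonal:
  assumes "j < n" "dim_col M = n" "i < dim_row M"
  shows "(M * diagonal n f) $$ (i,j) = M $$ (i,j) * f j"
proof -
  have "(M * diagonal n f) $$ (i,j) = (\<Sum>k<n. M $$ (i,k) * diagonal n f $$ (k,j))"
    using assms by (simp add: mult_entry)
  also have "\<dots> = (\<Sum>k<n. if k = j then M $$ (i,j) * f j else 0)"
    by (intro sum.cong refl) (use assms in \<open>auto simp: diagonal_def\<close>)
  finally show ?thesis using assms by simp
qed

lemma diagonal_inverses:
  assumes "\<And>i. i < n \<Longrightarrow> f i * g i = 1"
  shows "inverses n (diagonal n f) (diagonal n g)"
  unfolding inverses_def using assms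
  by (auto intro!: eq_matI carrier_matI simp: diagonal_mult mult.commute) (auto simp: diagonal_def mult.commute)

text \<open>
  Left factors of this shape describe row splittings: in \<open>D = S P\<close> the row \<open>i\<close> of \<open>D\<close> is the weighted sum of the
  rows of \<open>P\<close> in the fibre of \<open>\<pi>\<close> over \<open>i\<close>, and \<open>P S\<close> repeats the columns of \<open>P\<close> accordingly.
\<close>

definition subdivision :: "nat \<Rightarrow> nat \<Rightarrow> (nat \<Rightarrow> nat) \<Rightarrow> (nat \<Rightarrow> real) \<Rightarrow> real mat" where
  "subdivision m N \<pi> s = mat m N (\<lambda>(i,x). if \<pi> x = i then s x else 0)"

definition subdiv_data :: "nat \<Rightarrow> nat \<Rightarrow> (nat \<Rightarrow> nat) \<Rightarrow> (nat \<Rightarrow> real) \<Rightarrow> bool" where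
  "subdiv_data m N \<pi> s \<longleftrightarrow> 0 < m \<and> \<pi> ` {..<N} = {..<m} \<and> (\<forall>x<N. 0 < s x)"

lemma subdivision_dim [simp]: "dim_row (subdivision m N \<pi> s) = m" "dim_col (subdivision m N \<pi> s) = N"
  by (simp_all add: subdivision_def)

lemma subdivision_carrier: "subdivision m N \<pi> s \<in> carrier_mat m N" by (simp add: subdivision_def)

lemma subdiv_dataD:
  assumes "subdiv_data m N \<pi> s"
  shows "0 < m" "0 < N" "x < N \<Longrightarrow> \<pi> x < m" "x < N \<Longrightarrow> 0 < s x" "i < m \<Longrightarrow> \<exists>x<N. \<pi> x = i"
proof -
  show "0 < m" "x < N \<Longrightarrow> \<pi> x < m" "x < N \<Longrightarrow> 0 < s x" using assms by (auto simp: subdiv_data_def)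
  show ex: "\<exists>x<N. \<pi> x = i" if "i < m" for i
  proof -
    have "i \<in> \<pi> ` {..<N}" using assms that by (auto simp: subdiv_data_def)
    then show ?thesis by auto
  qed
  show "0 < N" using ex[of 0] \<open>0 < m\<close> by auto
qed

lemma mult_subdivision:
  assumes "subdiv_data m N \<pi> s" "dim_col M = m" "a < dim_row M" "x < N"
  shows "(M * subdivision m N \<pi> s) $$ (a,x) = M $$ (a, \<pi> x) * s x"
proof -
  have "(M * subdivision m N \<pi> s) $$ (a,x) = (\<Sum>k<m. M $$ (a,k) * subdivision m N \<pi> s $$ (k,x))"
    using assms by (simp add: mult_entry)
  also have "\<dots> = (\<Sum>k<m. if k = \<pi> x then M $$ (a, \<pi> x) * s x else 0)"
    by (intro sum.cong refl) (use assms in \<open>auto simp: subdivision_def\<close>)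
  finally show ?thesis using subdiv_dataD(3)[OF assms(1,4)] by simp
qed

lemma subdivision_mult:
  assumes "dim_row M = N" "b < dim_col M" "i < m"
  shows "(subdivision m N \<pi> s * M) $$ (i,b) = (\<Sum>x | x < N \<and> \<pi> x = i. s x * M $$ (x,b))"
proof -
  have "(subdivision m N \<pi> s * M) $$ (i,b) = (\<Sum>x<N. if \<pi> x = i then s x * M $$ (x,b) else 0)"
    using assms by (auto simp: mult_entry subdivision_def intro!: sum.cong)
  also have "\<dots> = (\<Sum>x\<in>{..<N} \<inter> {x. \<pi> x = i}. s x * M $$ (x,b))"
    by (subst sum.inter_restrict) auto
  also have "{..<N} \<inter> {x. \<pi> x = i} = {x. x < N \<and> \<pi> x = i}" by auto
  finally show ?thesis .
qed

definition fibre_sum :: "nat \<Rightarrow> (nat \<Rightarrow> nat) \<Rightarrow> (nat \<Rightarrow> real) \<Rightarrow> nat \<Rightarrow> real" where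
  "fibre_sum N \<pi> s i = (\<Sum>x | x < N \<and> \<pi> x = i. s x)"

text \<open>
  The right inverse of the subdivision that is constant on each fibre.
\<close>

definition spread :: "nat \<Rightarrow> nat \<Rightarrow> (nat \<Rightarrow> nat) \<Rightarrow> (nat \<Rightarrow> real) \<Rightarrow> real mat" where
  "spread m N \<pi> s = mat N m (\<lambda>(x,i). if \<pi> x = i then inverse (fibre_sum N \<pi> s i) else 0)"

lemma spread_dim [simp]: "dim_row (spread m N \<pi> s) = N" "dim_col (spread m N \<pi> s) = m"
  by (simp_all add: spread_def)

lemma fibre_sum_pos:
  assumes "subdiv_data m N \<pi> s" "i < m" shows "0 < fibre_sum N \<pi> s i"
  unfolding fibre_sum_def using subdiv_dataD[OF assms(1)] subdiv_dataD(5)[OF assms(1,2)]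
  by (intro sum_pos) auto

lemma subdivision_spread:
  assumes "subdiv_data m N \<pi> s" shows "subdivision m N \<pi> s * spread m N \<pi> s = 1\<^sub>m m"
proof (rule eq_matI)
  fix i j assume "i < dim_row (1\<^sub>m m :: real mat)" "j < dim_col (1\<^sub>m m :: real mat)"
  then have ij: "i < m" "j < m" by auto
  have "(subdivision m N \<pi> s * spread m N \<pi> s) $$ (i,j)
      = (\<Sum>x | x < N \<and> \<pi> x = i. s x * (if i = j then inverse (fibre_sum N \<pi> s i) else 0))"
    using ij by (subst subdivision_mult) (auto simp: spread_def intro!: sum.cong)
  also have "\<dots> = fibre_sum N \<pi> s i * (if i = j then inverse (fibre_sum N \<pi> s i) else 0)"
    by (simp add: fibre_sum_def sum_distrib_right)
  finally show "(subdivision m N \<pi> s * spread m N \<pi> s) $$ (i,j) = 1\<^sub>m m $$ (i,j)"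
    using fibre_sum_pos[OF assms, of i] ij by (cases "i = j") auto
qed auto

lemma spread_mult:
  assumes "subdiv_data m N \<pi> s" "dim_row M = m" "b < dim_col M" "x < N"
  shows "(spread m N \<pi> s * M) $$ (x,b) = inverse (fibre_sum N \<pi> s (\<pi> x)) * M $$ (\<pi> x, b)"
proof -
  have "(spread m N \<pi> s * M) $$ (x,b) = (\<Sum>k<m. spread m N \<pi> s $$ (x,k) * M $$ (k,b))"
    using assms by (simp add: mult_entry)
  also have "\<dots> = (\<Sum>k<m. if k = \<pi> x then inverse (fibre_sum N \<pi> s (\<pi> x)) * M $$ (\<pi> x, b) else 0)"
    by (intro sum.cong refl) (use assms in \<open>auto simp: spread_def\<close>)
  finally show ?thesis using subdiv_dataD(3)[OF assms(1,4)] by simp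
qed

section \<open>Splittings of reached matrices\<close>

context real_subfield_loc
begin

text \<open>
  The approximations \<open>h k * D * h' k\<close> of \<open>D\<close> are lifted along \<open>S\<close> to real splittings, and each of these is
  replaced by a nearby splitting over \<open>U\<close>. The error bounds \<open>1/(k+1)\<close> make both the new right factors and
  the new conjugators converge.
\<close>

lemma Reach_split:
  assumes R: "Reach A D" and S: "S \<in> carrier_mat m N" "mat_over U S" "nonneg_mat S"
    and \<Sigma>: "\<Sigma> \<in> carrier_mat N m" "S * \<Sigma> = 1\<^sub>m m"
    and P: "P \<in> carrier_mat N m" "positive_mat P" "positive_mat (P * S)" and D: "D = S * P" and N: "0 < N"
  shows "Reach A (P * S)"
proof -
  have Dc: "D \<in> carrier_mat m m" using S P D by auto
  note d = carrier_matD[OF S(1)] carrier_matD[OF \<Sigma>(1)] carrier_matD[OF P(1)] carrier_matD[OF Dc]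
  from Reach_carrierE[OF R Dc] obtain h h' where h: "mlim h (1\<^sub>m m) sequentially" "mlim h' (1\<^sub>m m) sequentially"
    "\<And>k::nat. inverses m (h k) (h' k)" "\<And>k. vertex (h k * D * h' k)" "\<And>k. sse_pos A (h k * D * h' k)"
    by blast
  note dh = inversesD(1-4)[OF h(3)]
  have hc: "h k \<in> carrier_mat m m" "h' k \<in> carrier_mat m m" for k using dh by auto
  let ?l = "\<lambda>k. lift_along \<Sigma> S (h k)" and ?l' = "\<lambda>k. lift_along \<Sigma> S (h' k)"
  have dl: "dim_row (?l k) = N" "dim_col (?l k) = N" "dim_row (?l' k) = N" "dim_col (?l' k) = N" for k
    using lift_along_dim[OF S(1) \<Sigma>(1)] by auto
  note Sl = lift_along_intertwines[OF S(1) \<Sigma> hc(1)] lift_along_intertwines[OF S(1) \<Sigma> hc(2)]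
  have linv: "inverses N (?l k) (?l' k)" for k by (rule lift_along_inverses[OF S(1) \<Sigma> h(3)])
  define Q where "Q k = ?l k * P * h' k" for k
  have Qc: "Q k \<in> carrier_mat N m" for k using dl dh d by (auto simp: Q_def intro!: carrier_matI)
  have SQ: "h k * D * h' k = S * Q k" for k
  proof -
    have "S * Q k = S * ?l k * P * h' k" by (simp add: Q_def mult_assoc_dim d dl dh)
    then show ?thesis unfolding Sl D by (simp add: mult_assoc_dim d dh)
  qed
  have QS: "Q k * S = ?l k * (P * S) * ?l' k" for k
    by (simp add: Q_def mult_assoc_dim d dl dh Sl)
  have Qlim: "mlim Q P sequentially"
  proof -
    have "mlim Q (1\<^sub>m N * P * 1\<^sub>m m) sequentially"
      unfolding Q_def by (intro mlim_mult mlim_const h lift_along_mlim[OF S(1) \<Sigma>(1)]) (auto simp: d)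
    then show ?thesis by (simp add: mat_dim d)
  qed
  have "\<exists>p G. p \<in> carrier_mat N m \<and> inverses N G (minv G) \<and> mat_over U p \<and> S * p = h k * D * h' k
      \<and> G * (Q k * S) = (p * S) * G
      \<and> (\<forall>i<N. \<forall>j<m. \<bar>p $$ (i,j) - Q k $$ (i,j)\<bar> < inverse (real (Suc k)))
      \<and> (\<forall>i<N. \<forall>j<N. \<bar>G $$ (i,j) - 1\<^sub>m N $$ (i,j)\<bar> < inverse (real (Suc k)))" for k
  proof -
    have ov: "mat_over U (h k * D * h' k)" using h(4) by (simp add: vertex_def)
    from split_over_subfield[OF S(1,2) \<Sigma> Qc SQ ov] obtain p G where
      pG: "mlim p (Q k) sequentially" "mlim G (1\<^sub>m N) sequentially"
      "\<forall>\<^sub>F n in sequentially. mat_over U (p n) \<and> S * p n = h k * D * h' k \<and> G n * (Q k * S) = (p n * S) * G n"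
      by blast
    have pc: "p n \<in> carrier_mat N m" for n using mlimD(1,2)[OF pG(1), of n] Qc[of k] by auto
    have Gi: "\<forall>\<^sub>F n in sequentially. inverses N (G n) (minv (G n))"
      by (rule eventually_inverses[OF pG(2)]) auto
    have e: "0 < inverse (real (Suc k))" by simp
    have "\<forall>\<^sub>F n in sequentially. inverses N (G n) (minv (G n)) \<and> mat_over U (p n) \<and> S * p n = h k * D * h' k
      \<and> G n * (Q k * S) = (p n * S) * G n
      \<and> (\<forall>i<N. \<forall>j<m. \<bar>p n $$ (i,j) - Q k $$ (i,j)\<bar> < inverse (real (Suc k)))
      \<and> (\<forall>i<N. \<forall>j<N. \<bar>G n $$ (i,j) - 1\<^sub>m N $$ (i,j)\<bar> < inverse (real (Suc k)))"
      using Gi pG(3) mlim_eventually_close[OF pG(1) e] mlim_eventually_close[OF pG(2) e]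
      by eventually_elim (use Qc[of k] in simp)
    from eventually_happens'[OF sequentially_bot this] obtain n where "inverses N (G n) (minv (G n)) \<and> mat_over U (p n) \<and> S * p n = h k * D * h' k
      \<and> G n * (Q k * S) = (p n * S) * G n
      \<and> (\<forall>i<N. \<forall>j<m. \<bar>p n $$ (i,j) - Q k $$ (i,j)\<bar> < inverse (real (Suc k)))
      \<and> (\<forall>i<N. \<forall>j<N. \<bar>G n $$ (i,j) - 1\<^sub>m N $$ (i,j)\<bar> < inverse (real (Suc k)))"
      ..
    with pc[of n] show ?thesis by (intro exI[of _ "p n"] exI[of _ "G n"] conjI) simp_all
  qed
  then obtain p G where
    p: "\<And>k. p k \<in> carrier_mat N m" "\<And>k. mat_over U (p k)" "\<And>k. S * p k = h k * D * h' k"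
      "\<And>k i j. i < N \<Longrightarrow> j < m \<Longrightarrow> \<bar>p k $$ (i,j) - Q k $$ (i,j)\<bar> < inverse (real (Suc k))" and
    G: "\<And>k. inverses N (G k) (minv (G k))" "\<And>k. G k * (Q k * S) = (p k * S) * G k"
      "\<And>k i j. i < N \<Longrightarrow> j < N \<Longrightarrow> \<bar>G k $$ (i,j) - 1\<^sub>m N $$ (i,j)\<bar> < inverse (real (Suc k))"
    by metis
  note dp = carrier_matD[OF p(1)]
  note dG = inversesD(1-4)[OF G(1)]
  have plim: "mlim p P sequentially"
    by (rule mlim_close[OF Qlim]) (use p d in auto)
  have Glim: "mlim G (1\<^sub>m N) sequentially"
    by (rule mlim_close[OF mlim_const]) (use G(3) dG in auto)
  have conj: "G k * ?l k * (P * S) * (?l' k * minv (G k)) = p k * S" for k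
  proof -
    have "G k * ?l k * (P * S) * (?l' k * minv (G k)) = G k * (?l k * (P * S) * ?l' k) * minv (G k)"
      by (simp add: mult_assoc_dim d dl dG del: minv_dim)
    also have "\<dots> = p k * S * (G k * minv (G k))"
      unfolding QS[symmetric] G(2) by (rule mult_assoc_dim) (auto simp: d dp dG simp del: minv_dim)
    finally show ?thesis by (simp add: inversesD(5)[OF G(1)] mult_one_dim d)
  qed
  have pS: "mlim (\<lambda>k. p k * S) (P * S) sequentially"
    by (intro mlim_mult plim mlim_const) (simp add: d)
  have "mlim (\<lambda>k. G k * ?l k) (1\<^sub>m N * 1\<^sub>m N) sequentially"
    by (intro mlim_mult Glim lift_along_mlim[OF S(1) \<Sigma>(1)] h) auto
  moreover have "mlim (\<lambda>k. ?l' k * minv (G k)) (1\<^sub>m N * 1\<^sub>m N) sequentially"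
    by (intro mlim_mult mlim_minv_one Glim lift_along_mlim[OF S(1) \<Sigma>(1)] h) auto
  ultimately have lims: "mlim (\<lambda>k. G k * ?l k) (1\<^sub>m N) sequentially" "mlim (\<lambda>k. ?l' k * minv (G k)) (1\<^sub>m N) sequentially"
    by (simp_all add: one_mult_dim)
  show ?thesis
  proof (rule ReachI[OF _ lims], unfold conj)
    show "P * S \<in> carrier_mat N N" using S P by auto
    have "\<forall>\<^sub>F k in sequentially. positive_mat (p k * S)" by (rule eventually_positive_entries[OF pS P(3)])
    moreover have "\<forall>\<^sub>F k in sequentially. positive_mat (p k)" by (rule eventually_positive_entries[OF plim P(2)])
    ultimately show "\<forall>\<^sub>F k in sequentially. inverses N (G k * ?l k) (?l' k * minv (G k))
      \<and> vertex (p k * S) \<and> sse_pos A (p k * S)"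
    proof eventually_elim
      case (elim k)
      have v: "vertex (p k * S)"
        unfolding vertex_def using elim(1) N mat_over_mult[OF p(2) S(2), of k] by (simp add: d dp)
      have "sse_pos (h k * D * h' k) (p k * S)"
        by (rule sse_pos_factors[OF h(4)[of k] v, of S "p k"])
           (use S(2,3) p(2)[of k] in \<open>simp_all add: p(3) d dp positive_imp_nonneg[OF elim(2)]\<close>)
      with h(5)[of k] v show ?case using inverses_mult[OF G(1) linv] by (auto intro: rtranclp_trans)
    qed
  qed
qed

text \<open>
  The weights may be real. They are moved from \<open>S\<close> to \<open>P\<close>, which changes \<open>P S\<close> by a conjugation with a
  positive diagonal matrix; the segment joining that matrix to the identity consists of
  positive diagonal matrices, so the conjugation runs through positive matrices.
\<close>

lemma Reach_weighted_split:
  assumes R: "Reach A D" and S: "subdiv_data m N \<pi> s"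
    and P: "P \<in> carrier_mat N m" "positive_mat P" and D: "D = subdivision m N \<pi> s * P"
  shows "Reach A (P * subdivision m N \<pi> s)"
proof -
  note SD = subdiv_dataD[OF S]
  have S1: "subdiv_data m N \<pi> (\<lambda>_. 1)" using S by (simp add: subdiv_data_def)
  define E where "E = subdivision m N \<pi> (\<lambda>_. 1)"
  define Q where "Q = diagonal N s * P"
  have Q: "Q \<in> carrier_mat N m" using P by (auto simp: Q_def)
  have Qe: "Q $$ (x,i) = s x * P $$ (x,i)" if "x < N" "i < m" for x i
    unfolding Q_def using that P by (intro diagonal_mult) auto
  have Qpos: "positive_mat Q" using P SD Q by (auto simp: positive_mat_iff Qe)
  have QE: "(Q * E) $$ (x,y) = s x * P $$ (x, \<pi> y)" if "x < N" "y < N" for x y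
    unfolding E_def using that Q SD(3) by (subst mult_subdivision[OF S1]) (auto simp: Qe)
  have dE: "dim_row E = m" "dim_col E = N" by (simp_all add: E_def)
  have QEpos: "positive_mat (Q * E)"
    using Q P SD by (auto simp: positive_mat_iff QE dE)
  have "D = E * Q"
    unfolding D E_def using P(1) Q
    by (intro eq_matI) (auto simp: subdivision_mult Qe intro!: sum.cong)
  have "Reach A (Q * E)"
    by (rule Reach_split[OF R _ _ _ _ subdivision_spread[OF S1, folded E_def] Q Qpos QEpos \<open>D = E * Q\<close> SD(2)])
       (auto simp: E_def subdivision_carrier mat_over_iff nonneg_mat_def subdivision_def zero_in one_in intro!: carrier_matI)
  define f where "f u x = 1 - u + u * inverse (s x)" for u x
  have fpos: "0 < f u x" if "u \<in> {0..1}" "x < N" for u x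
  proof (cases "u = 1")
    case False
    then show ?thesis unfolding f_def using that SD(4)[of x] by (intro add_pos_nonneg) auto
  qed (use that SD(4)[of x] in \<open>auto simp: f_def\<close>)
  define g where "g u = diagonal N (f u)" for u
  define g' where "g' u = diagonal N (\<lambda>x. inverse (f u x))" for u
  have QEc: "Q * E \<in> carrier_mat N N" using Q by (auto simp: E_def)
  have ent: "(g u * (Q * E) * g' u) $$ (x,y) = f u x * (s x * P $$ (x, \<pi> y)) * inverse (f u y)"
    if "x < N" "y < N" for u x y
    unfolding g_def g'_def using that Q
    by (subst mult_diagonal) (auto simp: E_def diagonal_mult QE[unfolded E_def])
  have lim: "mlim g (g u) (at u within {0..1})" "mlim g' (g' u) (at u within {0..1})" if "u \<in> {0..1}" for u
  proof -
    have "((\<lambda>u. f u x) \<longlongrightarrow> f u x) (at u within {0..1})" for x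
      unfolding f_def by (intro tendsto_add tendsto_diff tendsto_mult tendsto_const tendsto_ident_at)
    moreover have "f u x \<noteq> 0" if "x < N" for x
      using fpos[OF \<open>u \<in> {0..1}\<close> that] by linarith
    ultimately show "mlim g (g u) (at u within {0..1})" "mlim g' (g' u) (at u within {0..1})"
      by (auto simp: mlim_def g_def g'_def diagonal_def intro!: tendsto_inverse)
  qed
  have "Reach A (g 1 * (Q * E) * g' 1)"
  proof (rule Reach_path[OF QEc _ _ lim])
    show "inverses N (g u) (g' u)" if "u \<in> {0..1}" for u
      unfolding g_def g'_def using fpos[OF that] by (intro diagonal_inverses) (simp add: less_imp_neq[symmetric])
    show "positive_mat (g u * (Q * E) * g' u)" if "u \<in> {0..1}" for u
    proof -
      have "dim_row (g u * (Q * E) * g' u) = N" "dim_col (g u * (Q * E) * g' u) = N"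
        by (simp_all add: g_def g'_def)
      then show ?thesis unfolding positive_mat_iff using P(2) carrier_matD[OF P(1)] SD fpos[OF that]
        by (auto simp: ent positive_mat_iff)
    qed
    have "g 0 * (Q * E) * g' 0 = Q * E"
    proof (rule eq_matI)
      fix x y assume "x < dim_row (Q * E)" "y < dim_col (Q * E)"
      then have "x < N" "y < N" using QEc by auto
      then show "(g 0 * (Q * E) * g' 0) $$ (x,y) = (Q * E) $$ (x,y)" by (simp add: ent QE f_def)
    qed (use QEc in \<open>auto simp: g_def g'_def\<close>)
    with \<open>Reach A (Q * E)\<close> show "Reach A (g 0 * (Q * E) * g' 0)" by simp
  qed
  moreover have "g 1 * (Q * E) * g' 1 = P * subdivision m N \<pi> s"
  proof (rule eq_matI)
    fix x y assume "x < dim_row (P * subdivision m N \<pi> s)" "y < dim_col (P * subdivision m N \<pi> s)"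
    then have xy: "x < N" "y < N" using P by auto
    then show "(g 1 * (Q * E) * g' 1) $$ (x,y) = (P * subdivision m N \<pi> s) $$ (x,y)"
      using SD(4)[OF xy(1), THEN less_imp_neq, THEN not_sym] P by (simp add: ent mult_subdivision[OF S] f_def)
  qed (use P in \<open>auto simp: g_def g'_def\<close>)
  ultimately show ?thesis by simp
qed

text \<open>
  The approximations of \<open>C\<close> coming from \<open>A\<close> and from \<open>B\<close> are conjugate by real matrices tending to the
  identity. The intertwining relation is linear with coefficients in \<open>U\<close>, so the conjugators can be
  rounded, and the two approximations are eventually joined.
\<close>

lemma Reach_join:
  assumes C: "C \<in> carrier_mat n n" "positive_mat C" and R: "Reach A C" "Reach B C"
  shows "sse_pos A B"
proof -
  from Reach_carrierE[OF R(1) C(1)] obtain h h' where h: "mlim h (1\<^sub>m n) sequentially" "mlim h' (1\<^sub>m n) sequentially"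
    "\<And>k::nat. inverses n (h k) (h' k)" "\<And>k. vertex (h k * C * h' k)" "\<And>k. sse_pos A (h k * C * h' k)"
    by blast
  from Reach_carrierE[OF R(2) C(1)] obtain l l' where l: "mlim l (1\<^sub>m n) sequentially" "mlim l' (1\<^sub>m n) sequentially"
    "\<And>k::nat. inverses n (l k) (l' k)" "\<And>k. vertex (l k * C * l' k)" "\<And>k. sse_pos B (l k * C * l' k)"
    by blast
  note d = carrier_matD[OF C(1)] inversesD(1-4)[OF h(3)] inversesD(1-4)[OF l(3)]
  from positive_conjugator[OF C] obtain \<gamma> \<gamma>' where \<gamma>: "inverses n \<gamma> \<gamma>'" "mat_over U \<gamma>" "mat_over U \<gamma>'"
    "positive_mat \<gamma>" "positive_mat (\<gamma>' * C)" by blast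
  note d\<gamma> = inversesD(1-4)[OF \<gamma>(1)]
  \<comment> \<open>The matrices over \<open>U\<close> near \<open>C\<close> that are joined to \<open>A\<close> and to \<open>B\<close>.\<close>
  define C1 where "C1 k = h k * C * h' k" for k
  define C2 where "C2 k = l k * C * l' k" for k
  have lim: "mlim C1 C sequentially" "mlim C2 C sequentially"
    unfolding C1_def C2_def by (rule mlim_conjugate[OF h(1,2) C(1)], rule mlim_conjugate[OF l(1,2) C(1)])
  have c: "C1 k \<in> carrier_mat n n" "C2 k \<in> carrier_mat n n" for k by (auto simp: C1_def C2_def d)
  have v: "vertex (C1 k)" "vertex (C2 k)" for k using h(4) l(4) by (auto simp: C1_def C2_def)
  define q where "q k = l k * h' k" for k
  have qc: "q k \<in> carrier_mat n n" for k by (auto simp: q_def d)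
  have qlim: "mlim q (1\<^sub>m n) sequentially"
  proof -
    have "mlim q (1\<^sub>m n * 1\<^sub>m n) sequentially" unfolding q_def by (intro mlim_mult h l) auto
    then show ?thesis by (simp add: one_mult_dim)
  qed
  have qint: "q k * C1 k = C2 k * q k" for k
    unfolding q_def C1_def C2_def
    by (simp add: mult_assoc_dim d inverses_cancel[OF h(3)] inverses_cancel[OF l(3)])
  have "\<exists>Q. Q \<in> carrier_mat n n \<and> mat_over U Q \<and> Q * C1 k = C2 k * Q
      \<and> (\<forall>i<n. \<forall>j<n. \<bar>Q $$ (i,j) - q k $$ (i,j)\<bar> < inverse (real (Suc k)))" for k
  proof -
    have ov: "mat_over U (C1 k)" "mat_over U (C2 k)" using v by (auto simp: vertex_def)
    from intertwiner_approximation[OF ov(1) c(1) ov(2) c(2) qc qint] obtain Q where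
      Q: "mlim Q (q k) sequentially" "\<And>n. mat_over U (Q n)" "\<And>n. Q n * C1 k = C2 k * Q n" by blast
    have "\<forall>\<^sub>F x in sequentially. \<forall>i<dim_row (q k). \<forall>j<dim_col (q k). \<bar>Q x $$ (i,j) - q k $$ (i,j)\<bar> < inverse (real (Suc k))"
      by (rule mlim_eventually_close[OF Q(1)]) simp
    then obtain x where "\<forall>i<dim_row (q k). \<forall>j<dim_col (q k). \<bar>Q x $$ (i,j) - q k $$ (i,j)\<bar> < inverse (real (Suc k))"
      by (auto simp: eventually_sequentially)
    then show ?thesis using Q mlimD(1,2)[OF Q(1), of x] qc[of k] by (intro exI[of _ "Q x"]) auto
  qed
  then obtain Q where Q: "\<And>k. Q k \<in> carrier_mat n n" "\<And>k. mat_over U (Q k)" "\<And>k. Q k * C1 k = C2 k * Q k"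
    "\<And>k i j. i < n \<Longrightarrow> j < n \<Longrightarrow> \<bar>Q k $$ (i,j) - q k $$ (i,j)\<bar> < inverse (real (Suc k))" by metis
  note dQ = carrier_matD[OF Q(1)]
  have Qlim: "mlim Q (1\<^sub>m n) sequentially" by (rule mlim_close[OF qlim]) (use Q(4) dQ in auto)
  have Q'lim: "mlim (\<lambda>k. minv (Q k)) (1\<^sub>m n) sequentially" by (rule mlim_minv_one[OF Qlim])
  note 1 = one_mult_dim[of \<gamma> n] mult_one_dim[of "\<gamma>' * C" n]
  have "\<forall>\<^sub>F k in sequentially. inverses n (Q k) (minv (Q k))"
    by (rule eventually_inverses[OF Qlim]) auto
  moreover have "\<forall>\<^sub>F k in sequentially. positive_mat (\<gamma>' * C1 k)"
    by (rule eventually_positive_entries[OF mlim_mult[OF mlim_const lim(1)]]) (use \<gamma>(5) d d\<gamma> in auto)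
  moreover have "\<forall>\<^sub>F k in sequentially. positive_mat (Q k * \<gamma>)"
    by (rule eventually_positive_entries[OF mlim_mult[OF Qlim mlim_const]]) (use \<gamma>(4) 1 d\<gamma> in auto)
  moreover have "\<forall>\<^sub>F k in sequentially. positive_mat (\<gamma>' * C1 k * minv (Q k))"
    by (rule eventually_positive_entries[OF mlim_mult[OF mlim_mult[OF mlim_const lim(1)] Q'lim]])
       (use \<gamma>(5) 1 d d\<gamma> in auto)
  ultimately have "\<forall>\<^sub>F k in sequentially. sse_pos (C1 k) (C2 k)"
  proof eventually_elim
    case (elim k)
    have "Q k * C1 k * minv (Q k) = C2 k * (Q k * minv (Q k))"
      unfolding Q(3) by (rule mult_assoc_dim) (use c[of k] dQ in auto)
    then have eq: "Q k * C1 k * minv (Q k) = C2 k"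
      using c[of k] by (simp add: inversesD(5)[OF elim(1)] mult_one_dim)
    have "sse_pos (C1 k) (Q k * C1 k * minv (Q k))"
      by (rule sse_pos_conjugate[OF v(1) c(1) _ elim(1) Q(2) _ \<gamma>(1-4)])
         (use elim v Q(2) dQ in \<open>auto simp: eq positive_imp_nonneg intro!: mat_over_minv\<close>)
    then show ?case by (simp add: eq)
  qed
  then obtain k where "sse_pos (C1 k) (C2 k)" by (auto simp: eventually_sequentially)
  with h(5)[of k] sse_pos_sym[OF l(5)[of k]] show ?thesis
    unfolding C1_def C2_def by (meson rtranclp_trans)
qed

end

section \<open>Weighted splittings and the peak of a chain\<close>

definition up :: "real mat \<Rightarrow> real mat \<Rightarrow> bool" where
  "up D C \<longleftrightarrow> (\<exists>m N \<pi> s P. subdiv_data m N \<pi> s \<and> P \<in> carrier_mat N m \<and> nonneg_mat P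
     \<and> D = subdivision m N \<pi> s * P \<and> C = P * subdivision m N \<pi> s)"

definition down :: "real mat \<Rightarrow> real mat \<Rightarrow> bool" where
  "down C D \<longleftrightarrow> up D\<^sup>T C\<^sup>T"

definition nondegenerate_pair :: "nat \<Rightarrow> nat \<Rightarrow> real mat \<Rightarrow> real mat \<Rightarrow> bool" where
  "nondegenerate_pair m n V W \<longleftrightarrow> 0 < m \<and> 0 < n \<and> V \<in> carrier_mat m n \<and> W \<in> carrier_mat n m \<and> nonneg_mat V
     \<and> nonneg_mat W \<and> (\<forall>i<m. \<exists>j<n. 0 < V $$ (i,j)) \<and> (\<forall>j<n. \<exists>i<m. 0 < V $$ (i,j))"

definition nondegenerate_step :: "real mat \<Rightarrow> real mat \<Rightarrow> bool" where
  "nondegenerate_step A B \<longleftrightarrow> (\<exists>m n V W. nondegenerate_pair m n V W \<and> A = V * W \<and> B = W * V)"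

text \<open>
  Factor \<open>V = S R\<^sup>T\<close> through the index set of its positive entries: \<open>S\<close> carries the weights and remembers the
  row, \<open>R\<close> is zero-one and remembers the column. The intermediate matrix is \<open>R\<^sup>T W S\<close>.
\<close>

lemma nondegenerate_step_up_down:
  assumes "nondegenerate_step A B"
  shows "\<exists>C. up A C \<and> down C B"
proof -
  obtain m n V W where nd: "nondegenerate_pair m n V W" and AB: "A = V * W" "B = W * V"
    using assms by (auto simp: nondegenerate_step_def)
  then have V: "V \<in> carrier_mat m n" "nonneg_mat V" and W: "W \<in> carrier_mat n m" "nonneg_mat W"
    and mn: "0 < m" "0 < n" and rows: "\<And>i. i < m \<Longrightarrow> \<exists>j<n. 0 < V $$ (i,j)" and cols: "\<And>j. j < n \<Longrightarrow> \<exists>i<m. 0 < V $$ (i,j)"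
    by (auto simp: nondegenerate_pair_def)
  note d = carrier_matD[OF V(1)] carrier_matD[OF W(1)]
  define E where "E = {p. fst p < m \<and> snd p < n \<and> 0 < V $$ p}"
  have "finite E" by (rule finite_subset[of _ "{..<m} \<times> {..<n}"]) (auto simp: E_def)
  from ex_bij_betw_nat_finite[OF this] obtain e where e: "bij_betw e {..<card E} E"
    by (auto simp: lessThan_atLeast0)
  define N where "N = card E"
  have eE: "e x \<in> E" if "x < N" for x using bij_betwE[OF e] that by (auto simp: N_def)
  have surj: "\<exists>x<N. e x = p" if "p \<in> E" for p
    using e that unfolding bij_betw_def N_def by (metis imageE lessThan_iff)
  define S where "S = subdivision m N (fst \<circ> e) (\<lambda>x. V $$ e x)"
  define R where "R = subdivision n N (snd \<circ> e) (\<lambda>_. 1)"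
  have S: "subdiv_data m N (fst \<circ> e) (\<lambda>x. V $$ e x)"
    unfolding subdiv_data_def
  proof (intro conjI allI impI)
    show "(fst \<circ> e) ` {..<N} = {..<m}"
    proof (intro equalityI subsetI)
      fix i assume "i \<in> {..<m}"
      then obtain j where "i < m" "j < n" "0 < V $$ (i,j)" using rows by auto
      then have "(i,j) \<in> E" by (simp add: E_def)
      from surj[OF this] obtain x where "x < N" "e x = (i,j)" by blast
      then show "i \<in> (fst \<circ> e) ` {..<N}" by (intro image_eqI[of _ _ x]) auto
    qed (use eE in \<open>auto simp: E_def\<close>)
  qed (use eE mn in \<open>auto simp: E_def\<close>)
  have R: "subdiv_data n N (snd \<circ> e) (\<lambda>_. 1)"
    unfolding subdiv_data_def
  proof (intro conjI allI impI)
    show "(snd \<circ> e) ` {..<N} = {..<n}"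
    proof (intro equalityI subsetI)
      fix j assume "j \<in> {..<n}"
      then obtain i where "i < m" "j < n" "0 < V $$ (i,j)" using cols by auto
      then have "(i,j) \<in> E" by (simp add: E_def)
      from surj[OF this] obtain x where "x < N" "e x = (i,j)" by blast
      then show "j \<in> (snd \<circ> e) ` {..<N}" by (intro image_eqI[of _ _ x]) auto
    qed (use eE in \<open>auto simp: E_def\<close>)
  qed (use mn in auto)
  have dS: "dim_row S = m" "dim_col S = N" "dim_row R = n" "dim_col R = N" by (simp_all add: S_def R_def)
  have VST: "V = S * R\<^sup>T"
  proof (rule eq_matI)
    fix i j assume "i < dim_row (S * R\<^sup>T)" "j < dim_col (S * R\<^sup>T)"
    then have ij: "i < m" "j < n" by (simp_all add: dS)
    have "(S * R\<^sup>T) $$ (i,j) = (\<Sum>x<N. S $$ (i,x) * R $$ (j,x))"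
      using ij by (simp add: mult_entry dS)
    also have "\<dots> = (\<Sum>x\<in>{..<card E}. (\<lambda>p. if p = (i,j) then V $$ (i,j) else 0) (e x))"
      unfolding N_def[symmetric]
      by (intro sum.cong refl) (use ij in \<open>auto simp: S_def R_def subdivision_def prod_eq_iff\<close>)
    also have "\<dots> = (\<Sum>p\<in>E. if p = (i,j) then V $$ (i,j) else 0)"
      by (rule sum.reindex_bij_betw[OF e])
    also have "\<dots> = (if (i,j) \<in> E then V $$ (i,j) else 0)" using \<open>finite E\<close> by simp
    also have "\<dots> = V $$ (i,j)"
    proof -
      have "0 \<le> V $$ (i,j)" using ij V d by (auto simp: nonneg_mat_def)
      then show ?thesis using ij by (cases "0 < V $$ (i,j)") (simp_all add: E_def)
    qed
    finally show "V $$ (i,j) = (S * R\<^sup>T) $$ (i,j)" ..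
  qed (simp_all add: dS d)
  have nn: "nonneg_mat S" "nonneg_mat R"
    using S by (auto simp: S_def R_def nonneg_mat_def subdivision_def subdiv_data_def less_imp_le)
  have "up A (R\<^sup>T * W * S)"
    unfolding up_def
  proof (intro exI conjI)
    show "A = subdivision m N (fst \<circ> e) (\<lambda>x. V $$ e x) * (R\<^sup>T * W)"
      unfolding AB S_def[symmetric] by (subst VST) (simp add: mult_assoc_dim dS d)
  qed (use S nn W in \<open>auto simp: S_def[symmetric] dS d intro!: nonneg_mult carrier_matI\<close>)
  moreover have "up B\<^sup>T (R\<^sup>T * W * S)\<^sup>T"
    unfolding up_def
  proof (intro exI conjI)
    show "B\<^sup>T = subdivision n N (snd \<circ> e) (\<lambda>_. 1) * (W * S)\<^sup>T"
      unfolding AB R_def[symmetric]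
      by (subst VST) (simp add: transpose_mult_dim mult_assoc_dim dS d)
    show "(R\<^sup>T * W * S)\<^sup>T = (W * S)\<^sup>T * subdivision n N (snd \<circ> e) (\<lambda>_. 1)"
      unfolding R_def[symmetric] by (simp add: transpose_mult_dim mult_assoc_dim dS d)
  qed (use R nn W in \<open>auto simp: dS d intro!: nonneg_mult carrier_matI\<close>)
  ultimately show ?thesis unfolding down_def by blast
qed

text \<open>
  Let \<open>D = S' P\<close> be the row splitting and \<open>D = Q R'\<close> the column splitting. The transportation problem with
  these marginals has the solution \<open>Z = P Q / D\<close> (entrywise, along the fibres), for which \<open>Q = S' Z\<close> and
  \<open>P = Z R'\<close>. So \<open>C1 = (R' S') Z\<close> and \<open>C2 = Z (R' S')\<close> form a single nondegenerate step, and \<open>D\<close> is no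
  longer needed. Entries of \<open>Z\<close> over a zero of \<open>D\<close> are zero by division by zero, as they should be.
\<close>

lemma down_up_commute:
  assumes "down C1 D" "up D C2"
  shows "\<exists>E. up C1 E \<and> down E C2"
proof -
  obtain m a \<pi> s P where S: "subdiv_data m a \<pi> s" and P: "P \<in> carrier_mat a m" "nonneg_mat P"
    and D: "D = subdivision m a \<pi> s * P" and C2: "C2 = P * subdivision m a \<pi> s"
    using assms(2) by (auto simp: up_def)
  obtain m' b \<tau> t P' where R: "subdiv_data m' b \<tau> t" and P': "P' \<in> carrier_mat b m'" "nonneg_mat P'"
    and DT: "D\<^sup>T = subdivision m' b \<tau> t * P'" and C1T: "C1\<^sup>T = P' * subdivision m' b \<tau> t"
    using assms(1) by (auto simp: up_def down_def)
  have "m' = m" using arg_cong[OF DT, of dim_row] P by (simp add: D)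
  note R = R[unfolded this] and P' = P'[unfolded this] and DT = DT[unfolded this] and C1T = C1T[unfolded this]
  define S' where "S' = subdivision m a \<pi> s"
  define R' where "R' = (subdivision m b \<tau> t)\<^sup>T"
  define Q where "Q = P'\<^sup>T"
  have Q: "Q \<in> carrier_mat m b" "nonneg_mat Q" using P' by (auto simp: Q_def)
  note d = carrier_matD[OF P(1)] carrier_matD[OF Q(1)]
  have dS: "dim_row S' = m" "dim_col S' = a" "dim_row R' = b" "dim_col R' = m" by (simp_all add: S'_def R'_def)
  have DSP: "D = S' * P" by (simp add: D S'_def)
  have DQR: "D = Q * R'"
    using arg_cong[OF DT, of transpose_mat] P' by (simp add: transpose_mult_dim Q_def R'_def)
  have C1: "C1 = R' * Q"
    using arg_cong[OF C1T, of transpose_mat] P' by (simp add: transpose_mult_dim Q_def R'_def)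
  note SD = subdiv_dataD[OF S] and RD = subdiv_dataD[OF R]
  have R'e: "R' $$ (y,j) = (if \<tau> y = j then t y else 0)" if "y < b" "j < m" for y j
    using that by (auto simp: R'_def subdivision_def)
  have De1: "D $$ (i,j) = (\<Sum>x | x < a \<and> \<pi> x = i. s x * P $$ (x,j))" if "i < m" "j < m" for i j
    unfolding D using that P by (intro subdivision_mult) auto
  have De2: "D $$ (i,j) = (\<Sum>y | y < b \<and> \<tau> y = j. t y * Q $$ (i,y))" if "i < m" "j < m" for i j
  proof -
    have "D $$ (i,j) = D\<^sup>T $$ (j,i)" using that by (simp add: DSP dS d)
    also have "\<dots> = (\<Sum>y | y < b \<and> \<tau> y = j. t y * P' $$ (y,i))"
      unfolding DT using that P' by (intro subdivision_mult) auto
    also have "\<dots> = (\<Sum>y | y < b \<and> \<tau> y = j. t y * Q $$ (i,y))"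
      using that P' by (intro sum.cong refl) (auto simp: Q_def)
    finally show ?thesis .
  qed
  have Pn: "0 \<le> P $$ (x,j)" if "x < a" "j < m" for x j using P that by (auto simp: nonneg_mat_def)
  have Qn: "0 \<le> Q $$ (i,y)" if "i < m" "y < b" for i y using Q that by (auto simp: nonneg_mat_def)
  have Dn: "0 \<le> D $$ (i,j)" if "i < m" "j < m" for i j
    unfolding De1[OF that] by (rule sum_nonneg) (use that Pn SD(4) in \<open>auto simp: less_imp_le\<close>)
  have P0: "P $$ (x,j) = 0" if "D $$ (\<pi> x,j) = 0" "x < a" "j < m" for x j
  proof -
    have "(\<Sum>x' | x' < a \<and> \<pi> x' = \<pi> x. s x' * P $$ (x',j)) = 0"
      using De1[of "\<pi> x" j] that SD(3) by simp
    then have "\<forall>x'\<in>{x'. x' < a \<and> \<pi> x' = \<pi> x}. s x' * P $$ (x',j) = 0"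
      by (subst (asm) sum_nonneg_eq_0_iff) (use that Pn SD(4) in \<open>auto simp: less_imp_le\<close>)
    then show ?thesis using that SD(4)[of x] by auto
  qed
  have Q0: "Q $$ (i,y) = 0" if "D $$ (i,\<tau> y) = 0" "i < m" "y < b" for i y
  proof -
    have "(\<Sum>y' | y' < b \<and> \<tau> y' = \<tau> y. t y' * Q $$ (i,y')) = 0"
      using De2[of i "\<tau> y"] that RD(3) by simp
    then have "\<forall>y'\<in>{y'. y' < b \<and> \<tau> y' = \<tau> y}. t y' * Q $$ (i,y') = 0"
      by (subst (asm) sum_nonneg_eq_0_iff) (use that Qn RD(4) in \<open>auto simp: less_imp_le\<close>)
    then show ?thesis using that RD(4)[of y] by auto
  qed
  define Z where "Z = mat a b (\<lambda>(x,y). P $$ (x, \<tau> y) * Q $$ (\<pi> x, y) / D $$ (\<pi> x, \<tau> y))"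
  have Z: "Z \<in> carrier_mat a b" by (simp add: Z_def)
  have QSZ: "Q = S' * Z"
  proof (rule eq_matI)
    fix i y assume "i < dim_row (S' * Z)" "y < dim_col (S' * Z)"
    then have iy: "i < m" "y < b" using Z by (auto simp: dS)
    have "(S' * Z) $$ (i,y) = (\<Sum>x | x < a \<and> \<pi> x = i. s x * Z $$ (x,y))"
      unfolding S'_def using iy Z by (intro subdivision_mult) auto
    also have "\<dots> = (\<Sum>x | x < a \<and> \<pi> x = i. s x * P $$ (x,\<tau> y)) * (Q $$ (i,y) / D $$ (i,\<tau> y))"
      unfolding sum_distrib_right by (intro sum.cong refl) (use iy in \<open>auto simp: Z_def\<close>)
    also have "\<dots> = D $$ (i,\<tau> y) * (Q $$ (i,y) / D $$ (i,\<tau> y))"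
      using De1[of i "\<tau> y"] iy RD(3) by simp
    also have "\<dots> = Q $$ (i,y)" using Q0[of i y] iy by auto
    finally show "Q $$ (i,y) = (S' * Z) $$ (i,y)" ..
  qed (use Z d dS in auto)
  have PZR: "P = Z * R'"
  proof (rule eq_matI)
    fix x j assume "x < dim_row (Z * R')" "j < dim_col (Z * R')"
    then have xj: "x < a" "j < m" using Z by (auto simp: dS)
    have "(Z * R') $$ (x,j) = (Z * R')\<^sup>T $$ (j,x)" using xj Z by (simp add: dS)
    also have "(Z * R')\<^sup>T = subdivision m b \<tau> t * Z\<^sup>T"
      using Z by (simp add: transpose_mult_dim R'_def)
    also have "\<dots> $$ (j,x) = (\<Sum>y | y < b \<and> \<tau> y = j. t y * Z\<^sup>T $$ (y,x))"
      using xj Z by (intro subdivision_mult) auto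
    also have "\<dots> = (\<Sum>y | y < b \<and> \<tau> y = j. t y * Q $$ (\<pi> x,y)) * (P $$ (x,j) / D $$ (\<pi> x,j))"
      unfolding sum_distrib_right by (intro sum.cong refl) (use xj in \<open>auto simp: Z_def\<close>)
    also have "\<dots> = D $$ (\<pi> x,j) * (P $$ (x,j) / D $$ (\<pi> x,j))"
      using De2[of "\<pi> x" j] xj SD(3) by simp
    also have "\<dots> = P $$ (x,j)" using P0[of x j] xj by auto
    finally show "P $$ (x,j) = (Z * R') $$ (x,j)" ..
  qed (use Z d dS in auto)
  have RS: "(R' * S') $$ (y,x) = R' $$ (y,\<pi> x) * s x" if "y < b" "x < a" for x y
    unfolding S'_def using that by (intro mult_subdivision[OF S]) (auto simp: dS)
  have RSpos: "0 < (R' * S') $$ (y,x)" if "y < b" "x < a" "\<pi> x = \<tau> y" for x y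
    using that RD(3)[OF that(1)] SD(4) RD(4) by (simp add: RS R'e)
  have "nondegenerate_step C1 C2"
    unfolding nondegenerate_step_def
  proof (intro exI conjI)
    show "C1 = R' * S' * Z" unfolding C1 by (subst QSZ) (use Z in \<open>simp add: mult_assoc_dim dS\<close>)
    show "C2 = Z * (R' * S')"
      unfolding C2 S'_def[symmetric] by (subst PZR) (use Z in \<open>simp add: mult_assoc_dim dS\<close>)
    show "nondegenerate_pair b a (R' * S') Z"
      unfolding nondegenerate_pair_def
    proof (intro conjI allI impI)
      show "nonneg_mat (R' * S')"
        unfolding nonneg_mat_def using SD RD by (auto simp: dS RS R'e less_imp_le)
      show "nonneg_mat Z"
        unfolding nonneg_mat_def using Pn Qn Dn SD(3) RD(3) by (auto simp: Z_def)
      show "\<exists>x<a. 0 < (R' * S') $$ (y,x)" if "y < b" for y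
        using SD(5)[OF RD(3)[OF that]] RSpos that by blast
      show "\<exists>y<b. 0 < (R' * S') $$ (y,x)" if "x < a" for x
        using RD(5)[OF SD(3)[OF that]] RSpos that by metis
    qed (use Z SD RD in \<open>auto simp: dS intro!: carrier_matI\<close>)
  qed
  then show ?thesis by (rule nondegenerate_step_up_down)
qed

lemma downs_up_commute:
  assumes "down\<^sup>*\<^sup>* C1 D" "up D C2"
  shows "\<exists>E. up C1 E \<and> down\<^sup>*\<^sup>* E C2"
  using assms(1)
proof (induction rule: converse_rtranclp_induct)
  case base
  with assms(2) show ?case by blast
next
  case (step C C')
  then obtain E' where E': "up C' E'" "down\<^sup>*\<^sup>* E' C2" by blast
  from down_up_commute[OF step(1) E'(1)] obtain E where "up C E" "down E E'" by blast
  with E'(2) show ?case by (meson converse_rtranclp_into_rtranclp)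
qed

lemma common_peak:
  assumes "nondegenerate_step\<^sup>*\<^sup>* A B"
  shows "\<exists>E. up\<^sup>*\<^sup>* A E \<and> up\<^sup>*\<^sup>* B\<^sup>T E\<^sup>T"
proof -
  have "\<exists>E. up\<^sup>*\<^sup>* A E \<and> down\<^sup>*\<^sup>* E B"
    using assms
  proof (induction rule: rtranclp_induct)
    case (step B B')
    then obtain E where E: "up\<^sup>*\<^sup>* A E" "down\<^sup>*\<^sup>* E B" by blast
    from nondegenerate_step_up_down[OF step(2)] obtain C where C: "up B C" "down C B'" by blast
    from downs_up_commute[OF E(2) C(1)] obtain E' where "up E E'" "down\<^sup>*\<^sup>* E' C" by blast
    with E(1) C(2) show ?case by (meson rtranclp.rtrancl_into_rtrancl)
  qed blast
  then obtain E where E: "up\<^sup>*\<^sup>* A E" "down\<^sup>*\<^sup>* E B" by blast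
  from E(2) have "up\<^sup>*\<^sup>* B\<^sup>T E\<^sup>T"
    by (induction rule: converse_rtranclp_induct)
       (auto simp: down_def intro: rtranclp.rtrancl_into_rtrancl)
  with E(1) show ?thesis by blast
qed

section \<open>Removing inessential indices\<close>

text \<open>
  From every index of such a set, infinite paths lead forwards and backwards inside the set.
\<close>

definition self_supporting :: "real mat \<Rightarrow> nat set \<Rightarrow> bool" where
  "self_supporting M Y \<longleftrightarrow> Y \<subseteq> {..<dim_row M} \<and>
     (\<forall>x\<in>Y. (\<exists>z\<in>Y. 0 < M $$ (x,z)) \<and> (\<exists>z\<in>Y. 0 < M $$ (z,x)))"

definition essential :: "real mat \<Rightarrow> nat set" where
  "essential M = \<Union> {Y. self_supporting M Y}"

lemma self_supporting_essential: "self_supporting M (essential M)"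
  unfolding self_supporting_def essential_def by blast

lemma essential_maximal: "self_supporting M Y \<Longrightarrow> Y \<subseteq> essential M"
  unfolding essential_def by blast

lemma finite_essential: "finite (essential M)"
  using self_supporting_essential[of M] by (auto simp: self_supporting_def intro: finite_subset)

lemma product_entry_pos_iff:
  assumes "nonneg_mat V" "nonneg_mat W" "dim_col V = dim_row W" "x < dim_row V" "z < dim_col W"
  shows "0 < (V * W) $$ (x,z) \<longleftrightarrow> (\<exists>y<dim_row W. 0 < V $$ (x,y) \<and> 0 < W $$ (y,z))"
proof -
  have nn: "0 \<le> V $$ (x,y)" "0 \<le> W $$ (y,z)" if "y < dim_row W" for y
    using assms that by (auto simp: nonneg_mat_def)
  have e: "(V * W) $$ (x,z) = (\<Sum>y<dim_row W. V $$ (x,y) * W $$ (y,z))"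
    using assms by (simp add: mult_entry)
  show ?thesis
  proof
    assume "0 < (V * W) $$ (x,z)"
    then have "\<not> (\<forall>y\<in>{..<dim_row W}. V $$ (x,y) * W $$ (y,z) = 0)"
      unfolding e using sum.neutral[of "{..<dim_row W}" "\<lambda>y. V $$ (x,y) * W $$ (y,z)"] by fastforce
    then obtain y where "y < dim_row W" "V $$ (x,y) * W $$ (y,z) \<noteq> 0" by auto
    then show "\<exists>y<dim_row W. 0 < V $$ (x,y) \<and> 0 < W $$ (y,z)"
      using nn[of y] by (intro exI[of _ y]) (auto simp: less_le)
  next
    assume "\<exists>y<dim_row W. 0 < V $$ (x,y) \<and> 0 < W $$ (y,z)"
    then obtain y where "y < dim_row W" "0 < V $$ (x,y)" "0 < W $$ (y,z)" by blast
    then show "0 < (V * W) $$ (x,z)"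
      unfolding e by (intro sum_pos2[of _ y]) (use nn in auto)
  qed
qed

text \<open>
  The intermediate indices of all two-step paths \<open>x \<rightarrow> y \<rightarrow> z\<close> between essential \<open>x\<close> and \<open>z\<close> support each other.
\<close>

lemma essential_transfer:
  assumes V: "V \<in> carrier_mat m n" "nonneg_mat V" and W: "W \<in> carrier_mat n m" "nonneg_mat W"
    and x: "x \<in> essential (V * W)" "z \<in> essential (V * W)" and y: "y < n" "0 < V $$ (x,y)" "0 < W $$ (y,z)"
  shows "y \<in> essential (W * V)"
proof -
  define E where "E = essential (V * W)"
  have E: "E \<subseteq> {..<m}" "\<And>x. x \<in> E \<Longrightarrow> (\<exists>z\<in>E. 0 < (V * W) $$ (x,z)) \<and> (\<exists>z\<in>E. 0 < (V * W) $$ (z,x))"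
    using self_supporting_essential[of "V * W"] V by (auto simp: self_supporting_def E_def)
  have iff: "0 < (V * W) $$ (x,z) \<longleftrightarrow> (\<exists>y<n. 0 < V $$ (x,y) \<and> 0 < W $$ (y,z))" if "x \<in> E" "z \<in> E" for x z
    using product_entry_pos_iff[OF V(2) W(2)] V W E(1) that by auto
  have iff': "0 < (W * V) $$ (y,y')" if "y < n" "y' < n" "x \<in> E" "0 < W $$ (y,x)" "0 < V $$ (x,y')" for x y y'
    using product_entry_pos_iff[OF W(2) V(2), of y y'] V W E(1) that by auto
  define Y where "Y = {y. y < n \<and> (\<exists>x\<in>E. \<exists>z\<in>E. 0 < V $$ (x,y) \<and> 0 < W $$ (y,z))}"
  have "self_supporting (W * V) Y"
    unfolding self_supporting_def
  proof (intro conjI ballI)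
    show "Y \<subseteq> {..<dim_row (W * V)}" using W by (auto simp: Y_def)
    fix y assume "y \<in> Y"
    then obtain x z where y: "y < n" "x \<in> E" "z \<in> E" "0 < V $$ (x,y)" "0 < W $$ (y,z)" by (auto simp: Y_def)
    obtain z' where "z' \<in> E" "0 < (V * W) $$ (z,z')" using E(2)[OF y(3)] by blast
    then obtain y' where y': "y' < n" "0 < V $$ (z,y')" "0 < W $$ (y',z')" using iff[OF y(3)] by auto
    then have "y' \<in> Y" using y(3) \<open>z' \<in> E\<close> by (auto simp: Y_def)
    then show "\<exists>y'\<in>Y. 0 < (W * V) $$ (y,y')" using iff'[OF y(1) y'(1) y(3,5) y'(2)] by blast
    obtain x' where "x' \<in> E" "0 < (V * W) $$ (x',x)" using E(2)[OF y(2)] by blast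
    then obtain y'' where y'': "y'' < n" "0 < V $$ (x',y'')" "0 < W $$ (y'',x)" using iff[OF _ y(2)] by auto
    then have "y'' \<in> Y" using y(2) \<open>x' \<in> E\<close> by (auto simp: Y_def)
    then show "\<exists>y'\<in>Y. 0 < (W * V) $$ (y',y)" using iff'[OF y''(1) y(1,2) y''(3) y(4)] by blast
  qed
  then have "Y \<subseteq> essential (W * V)" by (rule essential_maximal)
  moreover have "y \<in> Y" using x y by (auto simp: Y_def E_def)
  ultimately show ?thesis by blast
qed

text \<open>
  With the increasing enumeration, restricting a matrix to all of its indices leaves it unchanged.
\<close>

definition enum :: "nat set \<Rightarrow> nat \<Rightarrow> nat" where
  "enum I i = sorted_list_of_set I ! i"

lemma bij_betw_enum: "finite I \<Longrightarrow> bij_betw (enum I) {..<card I} I"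
  using bij_betw_nth[of "sorted_list_of_set I" "{..<card I}" I] by (simp add: enum_def[abs_def])

lemma enum_in: "finite I \<Longrightarrow> i < card I \<Longrightarrow> enum I i \<in> I"
  using bij_betwE[OF bij_betw_enum] by blast

lemma enum_surj: "finite I \<Longrightarrow> x \<in> I \<Longrightarrow> \<exists>i<card I. enum I i = x"
  using bij_betw_imp_surj_on[OF bij_betw_enum, of I] by (metis imageE lessThan_iff)

lemma enum_lessThan: "i < n \<Longrightarrow> enum {..<n} i = i"
  by (simp add: enum_def lessThan_atLeast0)

definition restrict_mat :: "real mat \<Rightarrow> nat set \<Rightarrow> nat set \<Rightarrow> real mat" where
  "restrict_mat M I J = mat (card I) (card J) (\<lambda>(i,j). M $$ (enum I i, enum J j))"

definition trim :: "real mat \<Rightarrow> real mat" where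
  "trim M = restrict_mat M (essential M) (essential M)"

lemma restrict_mult:
  assumes V: "V \<in> carrier_mat m n" and W: "W \<in> carrier_mat n k"
    and I: "finite I" "I \<subseteq> {..<m}" and K: "finite K" "K \<subseteq> {..<k}" and J: "J \<subseteq> {..<n}"
    and zero: "\<And>x y z. x \<in> I \<Longrightarrow> z \<in> K \<Longrightarrow> y < n \<Longrightarrow> y \<notin> J \<Longrightarrow> V $$ (x,y) * W $$ (y,z) = 0"
  shows "restrict_mat (V * W) I K = restrict_mat V I J * restrict_mat W J K"
proof (rule eq_matI)
  have J': "finite J" using J by (rule finite_subset) simp
  fix i l assume "i < dim_row (restrict_mat V I J * restrict_mat W J K)" "l < dim_col (restrict_mat V I J * restrict_mat W J K)"
  then have il: "i < card I" "l < card K" by (simp_all add: restrict_mat_def)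
  define x z where "x = enum I i" "z = enum K l"
  have xz: "x \<in> I" "z \<in> K" using il I K by (simp_all add: x_z_def enum_in)
  have "restrict_mat (V * W) I K $$ (i,l) = (\<Sum>y<n. V $$ (x,y) * W $$ (y,z))"
    using il xz I K V W by (auto simp: restrict_mat_def x_z_def[symmetric] mult_entry subset_iff)
  also have "\<dots> = (\<Sum>y\<in>J. V $$ (x,y) * W $$ (y,z))"
    using J zero xz by (intro sum.mono_neutral_right) auto
  also have "\<dots> = (\<Sum>j<card J. V $$ (x,enum J j) * W $$ (enum J j,z))"
    by (rule sum.reindex_bij_betw[OF bij_betw_enum[OF J'], symmetric])
  also have "\<dots> = (restrict_mat V I J * restrict_mat W J K) $$ (i,l)"
    using il by (subst mult_entry) (auto simp: restrict_mat_def x_z_def)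
  finally show "restrict_mat (V * W) I K $$ (i,l) = (restrict_mat V I J * restrict_mat W J K) $$ (i,l)" .
qed (simp_all add: restrict_mat_def)

text \<open>
  Indices outside the essential ones contribute nothing to the entries of \<open>V W\<close> and \<open>W V\<close> at essential
  indices, by \<open>essential_transfer\<close>, so the factorization survives the restriction. Every essential
  index has an essential successor and predecessor; hence no row or column of the restricted \<open>V\<close> vanishes.
\<close>

lemma trim_step:
  assumes E: "ESSE {0..} M M'" and ne: "essential M \<noteq> {}"
  shows "nondegenerate_step (trim M) (trim M') \<and> essential M' \<noteq> {}"
proof -
  obtain m n V W where V: "V \<in> carrier_mat m n" "nonneg_mat V" and W: "W \<in> carrier_mat n m" "nonneg_mat W"
    and M: "M = V * W" "M' = W * V"
    using E by (auto simp: ESSE_def mat_over_iff nonneg_mat_def)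
  define I J where "I = essential M" "J = essential M'"
  have I: "finite I" "I \<subseteq> {..<m}" "\<And>x. x \<in> I \<Longrightarrow> (\<exists>z\<in>I. 0 < (V * W) $$ (x,z)) \<and> (\<exists>z\<in>I. 0 < (V * W) $$ (z,x))"
    using self_supporting_essential[of M] finite_essential[of M] V by (auto simp: self_supporting_def I_J_def M)
  have J: "finite J" "J \<subseteq> {..<n}" "\<And>x. x \<in> J \<Longrightarrow> (\<exists>z\<in>J. 0 < (W * V) $$ (x,z)) \<and> (\<exists>z\<in>J. 0 < (W * V) $$ (z,x))"
    using self_supporting_essential[of M'] finite_essential[of M'] W by (auto simp: self_supporting_def I_J_def M)
  have Vn: "0 \<le> V $$ (x,y)" "0 \<le> W $$ (y,x)" if "x < m" "y < n" for x y
    using V W that by (auto simp: nonneg_mat_def)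
  have IJ: "y \<in> J" if "x \<in> I" "z \<in> I" "y < n" "0 < V $$ (x,y)" "0 < W $$ (y,z)" for x y z
    using essential_transfer[OF V W, of x z y] that by (simp add: I_J_def M)
  have JI: "y \<in> I" if "x \<in> J" "z \<in> J" "y < m" "0 < W $$ (x,y)" "0 < V $$ (y,z)" for x y z
    using essential_transfer[OF W V, of x z y] that by (simp add: I_J_def M)
  have rowI: "\<exists>y\<in>J. 0 < V $$ (x,y)" if x: "x \<in> I" for x
  proof -
    obtain z where z: "z \<in> I" "0 < (V * W) $$ (x,z)" using I(3)[OF x] by blast
    then obtain y where "y < n" "0 < V $$ (x,y)" "0 < W $$ (y,z)"
      using product_entry_pos_iff[OF V(2) W(2), of x z] V W I(2) x by auto
    then show ?thesis using IJ x z by blast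
  qed
  have colJ: "\<exists>x\<in>I. 0 < V $$ (x,y)" if y: "y \<in> J" for y
  proof -
    obtain z where z: "z \<in> J" "0 < (W * V) $$ (z,y)" using J(3)[OF y] by blast
    then obtain x where "x < m" "0 < W $$ (z,x)" "0 < V $$ (x,y)"
      using product_entry_pos_iff[OF W(2) V(2), of z y] V W J(2) y by auto
    then show ?thesis using JI y z by blast
  qed
  have ne': "J \<noteq> {}" using rowI ne unfolding I_J_def by blast
  have "trim M = restrict_mat V I J * restrict_mat W J I"
    unfolding trim_def I_J_def(1)[symmetric] unfolding M
  proof (rule restrict_mult[OF V(1) W(1) I(1,2) I(1,2) J(2)])
    fix x y z assume a: "x \<in> I" "z \<in> I" "y < n" "y \<notin> J"
    then have "x < m" "z < m" using I(2) by auto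
    then show "V $$ (x,y) * W $$ (y,z) = 0"
      using IJ[OF a(1-3)] a(4) Vn[of x y] Vn[of z y] a(3) by (auto simp: less_le)
  qed
  moreover have "trim M' = restrict_mat W J I * restrict_mat V I J"
    unfolding trim_def I_J_def(2)[symmetric] unfolding M
  proof (rule restrict_mult[OF W(1) V(1) J(1,2) J(1,2) I(2)])
    fix x y z assume a: "x \<in> J" "z \<in> J" "y < m" "y \<notin> I"
    then have "x < n" "z < n" using J(2) by auto
    then show "W $$ (x,y) * V $$ (y,z) = 0"
      using JI[OF a(1-3)] a(4) Vn[of y x] Vn[of y z] a(3) by (auto simp: less_le)
  qed
  moreover have "nondegenerate_pair (card I) (card J) (restrict_mat V I J) (restrict_mat W J I)"
    unfolding nondegenerate_pair_def
  proof (intro conjI allI impI)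
    show "0 < card I" "0 < card J" using ne ne' I(1) J(1) by (auto simp: I_J_def card_gt_0_iff)
    show "\<exists>j<card J. 0 < restrict_mat V I J $$ (i,j)" if i: "i < card I" for i
    proof -
      obtain y where y: "y \<in> J" "0 < V $$ (enum I i, y)" using rowI[OF enum_in[OF I(1) i]] by blast
      obtain j where "j < card J" "enum J j = y" using enum_surj[OF J(1) y(1)] by blast
      then show ?thesis using i y by (intro exI[of _ j]) (auto simp: restrict_mat_def)
    qed
    show "\<exists>i<card I. 0 < restrict_mat V I J $$ (i,j)" if j: "j < card J" for j
    proof -
      obtain x where x: "x \<in> I" "0 < V $$ (x, enum J j)" using colJ[OF enum_in[OF J(1) j]] by blast
      obtain i where "i < card I" "enum I i = x" using enum_surj[OF I(1) x(1)] by blast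
      then show ?thesis using j x by (intro exI[of _ i]) (auto simp: restrict_mat_def)
    qed
    have m: "enum I i < m" if "i < card I" for i using enum_in[OF I(1) that] I(2) by auto
    have n: "enum J j < n" if "j < card J" for j using enum_in[OF J(1) that] J(2) by auto
    show "nonneg_mat (restrict_mat V I J)" "nonneg_mat (restrict_mat W J I)"
      using Vn m n by (auto simp: nonneg_mat_def restrict_mat_def)
  qed (simp_all add: restrict_mat_def)
  ultimately show ?thesis using ne' unfolding nondegenerate_step_def I_J_def(2) by blast
qed

lemma trim_positive:
  assumes A: "positive_mat A" "A \<in> carrier_mat n n"
  shows "essential A = {..<n}" "trim A = A"
proof -
  have "self_supporting A {..<n}"
    using A by (auto simp: self_supporting_def positive_mat_iff)
  then show e: "essential A = {..<n}"
    using essential_maximal[of A "{..<n}"] self_supporting_essential[of A] A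
    by (intro equalityI) (auto simp: self_supporting_def)
  show "trim A = A"
    unfolding trim_def e using A by (intro eq_matI) (auto simp: restrict_mat_def enum_lessThan)
qed

lemma nondegenerate_chain_of_SSE:
  assumes sse: "SSE {0..} A B" and A: "positive_mat A" "A \<in> carrier_mat n n" "0 < n"
    and B: "positive_mat B" "B \<in> carrier_mat k k"
  shows "nondegenerate_step\<^sup>*\<^sup>* A B"
proof -
  obtain Ms where Ms: "Ms \<noteq> []" "hd Ms = A" "last Ms = B" "successively (ESSE {0..}) Ms"
    using sse by (auto simp: SSE_through_def)
  have "(ESSE {0..})\<^sup>*\<^sup>* (hd Ms) (last Ms)"
    using Ms(1,4)
  proof (induction Ms)
    case (Cons M Ms)
    then show ?case by (cases Ms) (auto intro: converse_rtranclp_into_rtranclp)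
  qed simp
  then have "(ESSE {0..})\<^sup>*\<^sup>* A B" using Ms by simp
  then have "nondegenerate_step\<^sup>*\<^sup>* (trim A) (trim B) \<and> essential B \<noteq> {}"
  proof (induction rule: rtranclp_induct)
    case base
    show ?case using trim_positive(1)[OF A(1,2)] A(3) by auto
  next
    case (step M M')
    then show ?case using trim_step[of M M'] by (auto intro: rtranclp.rtrancl_into_rtrancl)
  qed
  then show ?thesis using trim_positive(2)[OF A(1,2)] trim_positive(2)[OF B] by simp
qed

section \<open>Positive conjugates of the peak\<close>

definition one_plus :: "nat \<Rightarrow> real \<Rightarrow> real mat \<Rightarrow> real mat" where
  "one_plus n t Y = 1\<^sub>m n + t \<cdot>\<^sub>m Y"

lemma one_plus_dim [simp]:
  "dim_row (one_plus n t Y) = dim_row Y" "dim_col (one_plus n t Y) = dim_col Y"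
  by (simp_all add: one_plus_def)

lemma one_plus_zero: "Y \<in> carrier_mat n n \<Longrightarrow> one_plus n 0 Y = 1\<^sub>m n"
  by (intro eq_matI) (auto simp: one_plus_def)

lemma mlim_one_plus:
  assumes "Y \<in> carrier_mat n n" "(f \<longlongrightarrow> t) F"
  shows "mlim (\<lambda>x. one_plus n (f x) Y) (one_plus n t Y) F"
  unfolding one_plus_def using assms by (intro mlim_add mlim_const mlim_smult) auto

lemma mlim_one_plus_one:
  assumes "Y \<in> carrier_mat n n" "(f \<longlongrightarrow> 0) F"
  shows "mlim (\<lambda>x. one_plus n (f x) Y) (1\<^sub>m n) F"
  using mlim_one_plus[OF assms] by (simp add: one_plus_zero[OF assms(1)])

lemma shift_conjugate_expansion:
  assumes C: "C \<in> carrier_mat n n" and Y: "Y \<in> carrier_mat n n" and inv: "inverses n (one_plus n t Y) h"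
  shows "one_plus n t Y * C * h = C + t \<cdot>\<^sub>m ((Y * C - C * Y) * h)"
proof -
  note d = carrier_matD[OF C] carrier_matD[OF Y] inversesD(3,4)[OF inv]
  have "one_plus n t Y * C = C * one_plus n t Y + t \<cdot>\<^sub>m (Y * C - C * Y)"
    unfolding one_plus_def by (intro eq_matI) (simp_all add: mat_dim d algebra_simps)
  then have "one_plus n t Y * C * h = C * (one_plus n t Y * h) + t \<cdot>\<^sub>m (Y * C - C * Y) * h"
    by (simp add: add_mult_dim mult_assoc_dim d)
  then show ?thesis by (simp add: inversesD(5)[OF inv] mult_one_dim smult_mult_dim d)
qed

text \<open>
  At the zeros of \<open>E\<close> the first-order term of the conjugation is strictly positive, and elsewhere \<open>E\<close> itself is.
  The base matrix may vary with the parameter, at an arbitrary speed, as long as it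
  stays nonnegative.
\<close>

lemma eventually_positive_conjugates:
  fixes f :: "'x \<Rightarrow> real"
  assumes E: "E \<in> carrier_mat n n" "nonneg_mat E" and Y: "Y \<in> carrier_mat n n"
    and zero: "\<And>a b. a < n \<Longrightarrow> b < n \<Longrightarrow> E $$ (a,b) = 0 \<Longrightarrow> (E * Y) $$ (a,b) < (Y * E) $$ (a,b)"
    and f: "(f \<longlongrightarrow> 0) F" "\<forall>\<^sub>F x in F. 0 < f x"
    and Z: "mlim Z E F" "\<forall>\<^sub>F x in F. nonneg_mat (Z x)"
  shows "\<forall>\<^sub>F x in F. inverses n (one_plus n (f x) Y) (minv (one_plus n (f x) Y))
     \<and> positive_mat (one_plus n (f x) Y * Z x * minv (one_plus n (f x) Y))"
proof -
  note d = carrier_matD[OF E(1)] carrier_matD[OF Y]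
  have dZ: "dim_row (Z x) = n" "dim_col (Z x) = n" for x using mlimD(1,2)[OF Z(1)] d by auto
  let ?g = "\<lambda>x. one_plus n (f x) Y"
  have glim: "mlim ?g (1\<^sub>m n) F" by (rule mlim_one_plus_one[OF Y f(1)])
  have inv: "\<forall>\<^sub>F x in F. inverses n (?g x) (minv (?g x))"
    by (rule eventually_inverses[OF glim]) auto
  define B where "B x = (Y * Z x - Z x * Y) * minv (?g x)" for x
  have dB: "dim_row (B x) = n" "dim_col (B x) = n" for x by (simp_all add: B_def d dZ)
  have Blim: "mlim B (Y * E - E * Y) F"
  proof -
    have "mlim B ((Y * E - E * Y) * 1\<^sub>m n) F"
      unfolding B_def by (intro mlim_mult mlim_minus mlim_const Z mlim_minv_one glim) (auto simp: d)
    then show ?thesis by (simp add: mult_one_dim d)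
  qed
  have Clim: "mlim (\<lambda>x. Z x + f x \<cdot>\<^sub>m B x) E F"
  proof -
    have "mlim (\<lambda>x. Z x + f x \<cdot>\<^sub>m B x) (E + 0 \<cdot>\<^sub>m (Y * E - E * Y)) F"
      by (intro mlim_add mlim_smult Z Blim f) (auto simp: d)
    moreover have "E + 0 \<cdot>\<^sub>m (Y * E - E * Y) = E" by (intro eq_matI) (auto simp: d)
    ultimately show ?thesis by simp
  qed
  have ent: "\<forall>\<^sub>F x in F. 0 < (Z x + f x \<cdot>\<^sub>m B x) $$ (a,b)" if ab: "a < n" "b < n" for a b
  proof (cases "E $$ (a,b) = 0")
    case True
    have "0 < (Y * E - E * Y) $$ (a,b)" using zero[OF ab True] ab by (simp add: d)
    moreover have "((\<lambda>x. B x $$ (a,b)) \<longlongrightarrow> (Y * E - E * Y) $$ (a,b)) F"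
      by (rule mlimD(3)[OF Blim]) (use ab in \<open>auto simp: d\<close>)
    ultimately have "\<forall>\<^sub>F x in F. 0 < B x $$ (a,b)" by (rule order_tendstoD(1)[rotated])
    then show ?thesis using f(2) Z(2)
      by eventually_elim (use ab in \<open>auto simp: dB dZ nonneg_mat_def intro!: add_nonneg_pos\<close>)
  next
    case False
    then have "0 < E $$ (a,b)" using E ab by (auto simp: nonneg_mat_def less_le)
    moreover have "((\<lambda>x. (Z x + f x \<cdot>\<^sub>m B x) $$ (a,b)) \<longlongrightarrow> E $$ (a,b)) F"
      by (rule mlimD(3)[OF Clim]) (use ab in \<open>auto simp: d\<close>)
    ultimately show ?thesis by (rule order_tendstoD(1)[rotated])
  qed
  have "\<forall>\<^sub>F x in F. \<forall>a\<in>{..<n}. \<forall>b\<in>{..<n}. 0 < (Z x + f x \<cdot>\<^sub>m B x) $$ (a,b)"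
    by (intro eventually_ball_finite ballI finite_lessThan) (use ent in auto)
  then show ?thesis using inv
  proof eventually_elim
    case (elim x)
    have "Z x \<in> carrier_mat n n" using dZ by (intro carrier_matI)
    from shift_conjugate_expansion[OF this Y elim(2)]
    have "?g x * Z x * minv (?g x) = Z x + f x \<cdot>\<^sub>m B x" by (simp add: B_def)
    moreover have "positive_mat (Z x + f x \<cdot>\<^sub>m B x)"
      using elim(1) by (auto simp: positive_mat_iff dB simp del: index_add_mat(1))
    ultimately show ?case using elim(2) by simp
  qed
qed

context real_subfield_loc
begin

text \<open>
  For the positivity of the conjugates \<open>K = 1\<close> would be enough. The factor \<open>K\<close> gives the room that is lost
  when \<open>Y\<close> is lifted along a further splitting.
\<close>

definition spreadable :: "real mat \<Rightarrow> real mat \<Rightarrow> bool" where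
  "spreadable A D \<longleftrightarrow> (\<exists>n. D \<in> carrier_mat n n \<and> nonneg_mat D \<and> (\<forall>K\<ge>1. \<exists>Y\<in>carrier_mat n n.
     (\<forall>i<n. \<forall>j<n. i \<noteq> j \<longrightarrow> 0 \<le> Y $$ (i,j)) \<and>
     (\<forall>a<n. \<forall>b<n. D $$ (a,b) = 0 \<longrightarrow> K * (D * Y) $$ (a,b) < (Y * D) $$ (a,b)) \<and>
     (\<forall>\<^sub>F t in at_right 0. Reach A (one_plus n t Y * D * minv (one_plus n t Y)))))"

lemma spreadableE:
  assumes sp: "spreadable A D" and D: "D \<in> carrier_mat n n" and K: "1 \<le> K"
  obtains Y where "Y \<in> carrier_mat n n" "\<And>i j. i < n \<Longrightarrow> j < n \<Longrightarrow> i \<noteq> j \<Longrightarrow> 0 \<le> Y $$ (i,j)"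
    "\<And>a b. a < n \<Longrightarrow> b < n \<Longrightarrow> D $$ (a,b) = 0 \<Longrightarrow> K * (D * Y) $$ (a,b) < (Y * D) $$ (a,b)"
    "\<forall>\<^sub>F t in at_right 0. Reach A (one_plus n t Y * D * minv (one_plus n t Y))"
proof -
  obtain m where m: "D \<in> carrier_mat m m" and
    ex: "\<forall>K\<ge>1. \<exists>Y\<in>carrier_mat m m. (\<forall>i<m. \<forall>j<m. i \<noteq> j \<longrightarrow> 0 \<le> Y $$ (i,j)) \<and>
     (\<forall>a<m. \<forall>b<m. D $$ (a,b) = 0 \<longrightarrow> K * (D * Y) $$ (a,b) < (Y * D) $$ (a,b)) \<and>
     (\<forall>\<^sub>F t in at_right 0. Reach A (one_plus m t Y * D * minv (one_plus m t Y)))"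
    using sp unfolding spreadable_def by (elim exE conjE)
  have "m = n" using m D by auto
  from ex[unfolded this, rule_format, OF K] show thesis
    by (elim bexE conjE) (rule that; blast)
qed

lemma spreadable_refl:
  assumes "vertex A" shows "spreadable A A"
proof -
  define n where "n = dim_row A"
  have A: "A \<in> carrier_mat n n" "positive_mat A" using assms by (auto simp: vertex_def n_def)
  have "one_plus n t (0\<^sub>m n n) = 1\<^sub>m n" for t by (intro eq_matI) (auto simp: one_plus_def)
  then have R: "Reach A (one_plus n t (0\<^sub>m n n) * A * minv (one_plus n t (0\<^sub>m n n)))" for t
    using A Reach_refl[OF assms] by (simp add: minv_one mat_dim)
  show ?thesis
    unfolding spreadable_def
  proof (intro exI[of _ n] conjI allI impI bexI[of _ "0\<^sub>m n n"])
    fix a b K assume ab: "a < n" "b < n" and 0: "A $$ (a,b) = 0"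
    have "0 < A $$ (a,b)" using A ab by (simp add: positive_mat_iff)
    with 0 show "K * (A * 0\<^sub>m n n) $$ (a,b) < (0\<^sub>m n n * A) $$ (a,b)" by simp
  qed (use A R in \<open>auto simp: positive_imp_nonneg\<close>)
qed

text \<open>
  Lift \<open>Y\<close> to \<open>Y' = \<Sigma> Y S + c (\<Sigma> S - 1)\<close> with a large \<open>c\<close>. The second summand averages over the fibres of the
  splitting. It makes \<open>Y' C\<close> large at the zeros of \<open>C\<close> lying over positive entries of \<open>D\<close> while \<open>C Y'\<close>
  does not depend on \<open>c\<close>. Over a zero of \<open>D\<close> the second summand has no effect. There the rows of \<open>P\<close> are
  only bounded by multiples of the rows of \<open>D\<close>, and the inequality for \<open>C\<close> follows from the one for \<open>D\<close>
  with a larger factor \<open>K'\<close>. Since \<open>S Y' = Y S\<close>, the conjugate of \<open>D\<close> by \<open>1 + t Y\<close> is split into the conjugate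
  of \<open>C\<close> by \<open>1 + t Y'\<close>.
\<close>

lemma spreadable_up:
  assumes sp: "spreadable A D" and up: "up D C"
  shows "spreadable A C"
proof -
  obtain m N \<pi> s P where S: "subdiv_data m N \<pi> s" and P: "P \<in> carrier_mat N m" "nonneg_mat P"
    and D: "D = subdivision m N \<pi> s * P" and C: "C = P * subdivision m N \<pi> s"
    using up by (auto simp: up_def)
  note SD = subdiv_dataD[OF S]
  define S' where "S' = subdivision m N \<pi> s"
  define \<Sigma> where "\<Sigma> = spread m N \<pi> s"
  have Sc: "S' \<in> carrier_mat m N" "\<Sigma> \<in> carrier_mat N m" by (auto simp: S'_def \<Sigma>_def intro!: carrier_matI)
  have S\<Sigma>: "S' * \<Sigma> = 1\<^sub>m m" unfolding S'_def \<Sigma>_def by (rule subdivision_spread[OF S])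
  have Dc: "D \<in> carrier_mat m m" and Cc: "C \<in> carrier_mat N N"
    using P by (auto simp: D C intro!: carrier_matI)
  note d = carrier_matD[OF P(1)] carrier_matD[OF Sc(1)] carrier_matD[OF Sc(2)] carrier_matD[OF Dc] carrier_matD[OF Cc]
  have DS: "D = S' * P" "C = P * S'" by (simp_all add: D C S'_def)
  define \<sigma> where "\<sigma> x = inverse (fibre_sum N \<pi> s (\<pi> x))" for x
  have \<sigma>: "0 < \<sigma> x" if "x < N" for x unfolding \<sigma>_def using fibre_sum_pos[OF S SD(3)[OF that]] by simp
  have MS: "(M * S') $$ (a,x) = M $$ (a,\<pi> x) * s x" if "dim_col M = m" "a < dim_row M" "x < N" for M a x
    unfolding S'_def by (rule mult_subdivision[OF S that])
  have \<Sigma>M: "(\<Sigma> * M) $$ (x,b) = \<sigma> x * M $$ (\<pi> x,b)" if "dim_row M = m" "b < dim_col M" "x < N" for M x b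
    unfolding \<Sigma>_def \<sigma>_def by (rule spread_mult[OF S that])
  have Pn: "0 \<le> P $$ (x,j)" if "x < N" "j < m" for x j using P that by (auto simp: nonneg_mat_def)
  have Cn: "nonneg_mat C"
    unfolding DS using P Sc SD by (intro nonneg_mult) (auto simp: S'_def nonneg_mat_def subdivision_def less_imp_le)
  have Dn: "nonneg_mat D" using sp by (auto simp: spreadable_def)
  have PleD: "s x * P $$ (x,j) \<le> D $$ (\<pi> x,j)" if "x < N" "j < m" for x j
  proof -
    have "D $$ (\<pi> x,j) = (\<Sum>x' | x' < N \<and> \<pi> x' = \<pi> x. s x' * P $$ (x',j))"
      unfolding D using that P SD(3) by (intro subdivision_mult) auto
    also have "\<dots> \<ge> s x * P $$ (x,j)"
      by (rule member_le_sum[of x]) (use that Pn SD(4) in \<open>auto simp: less_imp_le\<close>)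
    finally show ?thesis .
  qed
  have C0: "P $$ (x,\<pi> y) = 0" if "C $$ (x,y) = 0" "x < N" "y < N" for x y
  proof -
    have "C $$ (x,y) = P $$ (x,\<pi> y) * s y" unfolding DS using that by (intro MS) (auto simp: d)
    then show ?thesis using that SD(4)[of y] by auto
  qed
  have sumY: "(M * Y) $$ (x,b) = (\<Sum>k<m. M $$ (x,k) * Y $$ (k,b))"
    if "Y \<in> carrier_mat m m" "dim_col M = m" "x < dim_row M" "b < m" for M Y :: "real mat" and x b
    using that carrier_matD[OF that(1)] by (simp add: mult_entry)
  have main: "\<exists>Y'\<in>carrier_mat N N. (\<forall>i<N. \<forall>j<N. i \<noteq> j \<longrightarrow> 0 \<le> Y' $$ (i,j)) \<and>
     (\<forall>a<N. \<forall>b<N. C $$ (a,b) = 0 \<longrightarrow> K * (C * Y') $$ (a,b) < (Y' * C) $$ (a,b)) \<and>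
     (\<forall>\<^sub>F t in at_right 0. Reach A (one_plus N t Y' * C * minv (one_plus N t Y')))"
    if K: "K \<ge> 1" for K
  proof -
    \<comment> \<open>Large enough to absorb the ratios between the rows of \<open>P\<close> and the rows of \<open>D\<close>.\<close>
    define K' where "K' = 1 + (\<Sum>x<N. K / (s x * \<sigma> x))"
    have pos: "0 \<le> K / (s x * \<sigma> x)" if "x < N" for x using that K SD(4) \<sigma> by (simp add: less_imp_le)
    have K'x: "K / (s x * \<sigma> x) \<le> K'" if "x < N" for x
    proof -
      have "K / (s x * \<sigma> x) \<le> (\<Sum>x<N. K / (s x * \<sigma> x))"
        by (rule member_le_sum[of x]) (use that pos in auto)
      then show ?thesis by (simp add: K'_def)
    qed
    have K'1: "K' \<ge> 1" unfolding K'_def using pos by (auto intro: sum_nonneg)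
    from spreadableE[OF sp Dc K'1] obtain Y where
      Y: "Y \<in> carrier_mat m m" "\<And>i j. i < m \<Longrightarrow> j < m \<Longrightarrow> i \<noteq> j \<Longrightarrow> 0 \<le> Y $$ (i,j)"
      "\<And>a b. a < m \<Longrightarrow> b < m \<Longrightarrow> D $$ (a,b) = 0 \<Longrightarrow> K' * (D * Y) $$ (a,b) < (Y * D) $$ (a,b)"
      "\<forall>\<^sub>F t in at_right 0. Reach A (one_plus m t Y * D * minv (one_plus m t Y))"
      by blast
    note dY = carrier_matD[OF Y(1)]
    have Dz: "D $$ (\<pi> x,b) = 0 \<Longrightarrow> P $$ (x,b) = 0" if "x < N" "b < m" for x b
      using PleD[OF that] Pn[OF that] SD(4)[OF that(1)] by (smt (verit) mult_pos_pos)
    have PY0: "0 \<le> (P * Y) $$ (x,b)" if "x < N" "b < m" "P $$ (x,b) = 0" for x b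
    proof -
      have "0 \<le> P $$ (x,k) * Y $$ (k,b)" if "k < m" for k
        using Y(2)[of k b] Pn[of x k] that \<open>x < N\<close> \<open>b < m\<close> \<open>P $$ (x,b) = 0\<close> by (cases "k = b") auto
      then show ?thesis using that by (subst sumY[OF Y(1)]) (auto simp: d intro!: sum_nonneg)
    qed
    have type1: "K * (P * Y) $$ (x,b) < \<sigma> x * (Y * D) $$ (\<pi> x,b)"
      if xb: "x < N" "b < m" "D $$ (\<pi> x,b) = 0" for x b
    proof -
      note \<pi>x = SD(3)[OF xb(1)]
      have le: "s x * (P $$ (x,k) * Y $$ (k,b)) \<le> D $$ (\<pi> x,k) * Y $$ (k,b) \<and> 0 \<le> D $$ (\<pi> x,k) * Y $$ (k,b)"
        if "k < m" for k
      proof (cases "k = b")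
        case True
        then show ?thesis using xb Dz[of x b] by simp
      next
        case False
        have "0 \<le> D $$ (\<pi> x,k)" using Dn \<pi>x that by (auto simp: nonneg_mat_def d)
        then show ?thesis using mult_right_mono[OF PleD[OF xb(1) that] Y(2)[OF that xb(2) False]] Y(2)[OF that xb(2) False]
          by (simp add: mult.assoc)
      qed
      have "s x * (P * Y) $$ (x,b) \<le> (D * Y) $$ (\<pi> x,b)"
        using xb \<pi>x le by (auto simp: sumY[OF Y(1)] d sum_distrib_left intro!: sum_mono)
      moreover have DY0: "0 \<le> (D * Y) $$ (\<pi> x,b)"
        using xb \<pi>x le by (auto simp: sumY[OF Y(1)] d intro!: sum_nonneg)
      ultimately have "K * (P * Y) $$ (x,b) \<le> \<sigma> x * (K / (s x * \<sigma> x) * (D * Y) $$ (\<pi> x,b))"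
        using K SD(4)[OF xb(1)] \<sigma>[OF xb(1)] by (simp add: field_simps)
      also have "\<dots> \<le> \<sigma> x * (K' * (D * Y) $$ (\<pi> x,b))"
        using K'x[OF xb(1)] DY0 \<sigma>[OF xb(1)] by (intro mult_left_mono mult_right_mono) auto
      also have "\<dots> < \<sigma> x * (Y * D) $$ (\<pi> x,b)"
        using Y(3)[OF \<pi>x xb(2,3)] \<sigma>[OF xb(1)] by simp
      finally show ?thesis .
    qed
    \<comment> \<open>The second condition on \<open>c\<close> compensates a negative diagonal entry of \<open>Y\<close>, which the lift
      spreads over off-diagonal positions inside a fibre.\<close>
    have "\<forall>\<^sub>F c in at_top. (\<forall>x\<in>{..<N}. \<forall>b\<in>{..<m}. 0 < D $$ (\<pi> x,b) \<longrightarrow>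
        K * (P * Y) $$ (x,b) < \<sigma> x * ((Y * D) $$ (\<pi> x,b) + c * D $$ (\<pi> x,b))) \<and>
        (\<forall>i\<in>{..<m}. 0 \<le> c + Y $$ (i,i)) \<and> (0::real) \<le> c"
    proof (intro eventually_conj eventually_ball_finite ballI finite_lessThan)
      fix x b assume "x \<in> {..<N}" "b \<in> {..<m}"
      then have xb: "x < N" "b < m" by auto
      show "\<forall>\<^sub>F c in at_top. 0 < D $$ (\<pi> x,b) \<longrightarrow>
        K * (P * Y) $$ (x,b) < \<sigma> x * ((Y * D) $$ (\<pi> x,b) + c * D $$ (\<pi> x,b))"
        using eventually_gt_at_top[of "(K * (P * Y) $$ (x,b) / \<sigma> x - (Y * D) $$ (\<pi> x,b)) / D $$ (\<pi> x,b)"]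
      proof eventually_elim
        case (elim c)
        show ?case
        proof
          assume pD: "0 < D $$ (\<pi> x,b)"
          then have "K * (P * Y) $$ (x,b) / \<sigma> x - (Y * D) $$ (\<pi> x,b) < c * D $$ (\<pi> x,b)"
            using elim by (simp add: pos_divide_less_eq)
          then have "K * (P * Y) $$ (x,b) / \<sigma> x < (Y * D) $$ (\<pi> x,b) + c * D $$ (\<pi> x,b)" by simp
          then show "K * (P * Y) $$ (x,b) < \<sigma> x * ((Y * D) $$ (\<pi> x,b) + c * D $$ (\<pi> x,b))"
            using \<sigma>[OF xb(1)] by (simp add: pos_divide_less_eq mult.commute)
        qed
      qed
    next
      fix i show "\<forall>\<^sub>F c in at_top. 0 \<le> c + Y $$ (i,i)"
        using eventually_ge_at_top[of "- Y $$ (i,i)"] by eventually_elim simp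
    qed (rule eventually_ge_at_top)
    from eventually_happens'[OF _ this] obtain c where
      c: "\<And>x b. x < N \<Longrightarrow> b < m \<Longrightarrow> 0 < D $$ (\<pi> x,b) \<Longrightarrow>
        K * (P * Y) $$ (x,b) < \<sigma> x * ((Y * D) $$ (\<pi> x,b) + c * D $$ (\<pi> x,b))"
      "\<And>i. i < m \<Longrightarrow> 0 \<le> c + Y $$ (i,i)" "0 \<le> c" by auto
    define Y' where "Y' = \<Sigma> * Y * S' + c \<cdot>\<^sub>m (\<Sigma> * S' - 1\<^sub>m N)"
    have Y'c: "Y' \<in> carrier_mat N N" by (auto simp: Y'_def d intro!: carrier_matI)
    note dY' = carrier_matD[OF Y'c]
    have Y'e: "Y' $$ (x,y) = \<sigma> x * (Y $$ (\<pi> x,\<pi> y) + (if \<pi> x = \<pi> y then c else 0)) * s y - (if x = y then c else 0)"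
      if "x < N" "y < N" for x y
    proof -
      have "(\<Sigma> * Y * S') $$ (x,y) = \<sigma> x * Y $$ (\<pi> x,\<pi> y) * s y"
        using that SD(3) by (subst MS) (auto simp: d dY \<Sigma>M)
      moreover have "(\<Sigma> * S') $$ (x,y) = \<sigma> x * (if \<pi> x = \<pi> y then s y else 0)"
        using that SD(3) by (subst \<Sigma>M) (auto simp: d S'_def subdivision_def)
      ultimately show ?thesis using that by (simp add: Y'_def d dY algebra_simps)
    qed
    have Y'off: "0 \<le> Y' $$ (i,j)" if "i < N" "j < N" "i \<noteq> j" for i j
    proof -
      have "0 \<le> Y $$ (\<pi> i,\<pi> j) + (if \<pi> i = \<pi> j then c else 0)"
        using Y(2)[OF SD(3)[OF that(1)] SD(3)[OF that(2)]] c(2)[OF SD(3)[OF that(1)]]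
        by (cases "\<pi> i = \<pi> j") (auto simp: add.commute)
      then show ?thesis using that \<sigma>[of i] SD(4)[of j] by (simp add: Y'e less_imp_le)
    qed
    have S'Y': "S' * Y' = Y * S'"
    proof -
      have "S' * (\<Sigma> * M) = M" if "dim_row M = m" for M
        using S\<Sigma> that by (simp add: one_mult_dim d flip: mult_assoc_dim)
      then have "S' * Y' = Y * S' + c \<cdot>\<^sub>m (S' - S')"
        unfolding Y'_def by (simp add: mat_dim d dY)
      then show ?thesis by (auto simp: d dY)
    qed
    have CY': "(C * Y') $$ (x,y) = (P * Y) $$ (x,\<pi> y) * s y" if "x < N" "y < N" for x y
    proof -
      have "C * Y' = P * Y * S'" unfolding DS by (simp add: mult_assoc_dim d dY dY' S'Y')
      then show ?thesis using that SD(3) by (simp add: MS d dY)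
    qed
    have Y'C: "(Y' * C) $$ (x,y) = \<sigma> x * ((Y * D) $$ (\<pi> x,\<pi> y) + c * D $$ (\<pi> x,\<pi> y)) * s y - c * C $$ (x,y)"
      if xy: "x < N" "y < N" for x y
    proof -
      have "Y' * C = \<Sigma> * (Y * D) * S' + c \<cdot>\<^sub>m (\<Sigma> * D * S' - C)"
        unfolding Y'_def DS by (simp add: mat_dim d dY)
      moreover have "(\<Sigma> * (Y * D) * S') $$ (x,y) = \<sigma> x * (Y * D) $$ (\<pi> x,\<pi> y) * s y"
        using xy SD(3) by (subst MS) (auto simp: d dY \<Sigma>M)
      moreover have "(\<Sigma> * D * S') $$ (x,y) = \<sigma> x * D $$ (\<pi> x,\<pi> y) * s y"
        using xy SD(3) by (subst MS) (auto simp: d dY \<Sigma>M)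
      ultimately show ?thesis using xy by (simp add: d dY algebra_simps)
    qed
    have Y'zero: "K * (C * Y') $$ (x,y) < (Y' * C) $$ (x,y)" "0 \<le> (C * Y') $$ (x,y)"
      if xy: "x < N" "y < N" "C $$ (x,y) = 0" for x y
    proof -
      note \<pi> = SD(3)[OF xy(1)] SD(3)[OF xy(2)]
      have "K * (P * Y) $$ (x,\<pi> y) < \<sigma> x * ((Y * D) $$ (\<pi> x,\<pi> y) + c * D $$ (\<pi> x,\<pi> y))"
      proof (cases "D $$ (\<pi> x,\<pi> y) = 0")
        case True
        with type1[OF xy(1) \<pi>(2)] show ?thesis by simp
      next
        case False
        then have "0 < D $$ (\<pi> x,\<pi> y)" using Dn \<pi> by (auto simp: nonneg_mat_def d less_le)
        with c(1)[OF xy(1) \<pi>(2)] show ?thesis by simp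
      qed
      from mult_strict_right_mono[OF this SD(4)[OF xy(2)]]
      show "K * (C * Y') $$ (x,y) < (Y' * C) $$ (x,y)"
        using xy by (simp add: CY' Y'C mult.assoc)
      show "0 \<le> (C * Y') $$ (x,y)"
        using PY0[OF xy(1) \<pi>(2) C0[OF xy(3,1,2)]] SD(4)[OF xy(2)] xy by (simp add: CY' less_imp_le)
    qed
    have strict: "(C * Y') $$ (x,y) < (Y' * C) $$ (x,y)" if xy: "x < N" "y < N" "C $$ (x,y) = 0" for x y
    proof -
      have "1 * (C * Y') $$ (x,y) \<le> K * (C * Y') $$ (x,y)"
        using K Y'zero(2)[OF xy] by (rule mult_right_mono)
      with Y'zero(1)[OF xy] show ?thesis by simp
    qed
    have t0: "((\<lambda>t::real. t) \<longlongrightarrow> 0) (at_right 0)" by (rule tendsto_ident_at)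
    have tpos: "\<forall>\<^sub>F t in at_right (0::real). 0 < t" by (simp add: eventually_at_right_less)
    have "\<forall>\<^sub>F t in at_right 0. inverses N (one_plus N t Y') (minv (one_plus N t Y'))
       \<and> positive_mat (one_plus N t Y' * C * minv (one_plus N t Y'))"
      by (rule eventually_positive_conjugates[OF Cc Cn Y'c strict t0 tpos mlim_const always_eventually])
         (use Cn in auto)
    moreover have "\<forall>\<^sub>F t in at_right 0. inverses m (one_plus m t Y) (minv (one_plus m t Y))"
      by (rule eventually_inverses[OF mlim_one_plus_one[OF Y(1) t0]]) auto
    ultimately have "\<forall>\<^sub>F t in at_right 0. Reach A (one_plus N t Y' * C * minv (one_plus N t Y'))"
      using Y(4)
    proof eventually_elim
      case (elim t)
      define g where "g = one_plus m t Y"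
      define g' where "g' = one_plus N t Y'"
      have gi: "inverses m g (minv g)" and g'i: "inverses N g' (minv g')"
        and posC: "positive_mat (g' * C * minv g')" and RD: "Reach A (g * D * minv g)"
        using elim by (simp_all add: g_def g'_def)
      note dg = inversesD(1-4)[OF gi] inversesD(1-4)[OF g'i]
      have Sg: "S' * g' = g * S'"
        unfolding g_def g'_def one_plus_def by (simp add: mat_dim d dY dY' S'Y')
      have gS: "minv g * S' = S' * minv g'"
      proof -
        have "minv g * (S' * g') * minv g' = minv g * (g * S') * minv g'" by (simp only: Sg)
        then show ?thesis
          using inverses_cancel[OF gi] inversesD(5)[OF g'i] by (simp add: mult_assoc_dim d dg mult_one_dim del: minv_dim)
      qed
      define Q where "Q = g' * P * minv g"
      have Qc: "Q \<in> carrier_mat N m" by (auto simp: Q_def dg intro!: carrier_matI simp del: minv_dim)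
      have QS: "Q * S' = g' * C * minv g'"
        unfolding Q_def DS by (simp add: mult_assoc_dim d dg gS del: minv_dim)
      have SQ: "g * D * minv g = S' * Q"
      proof -
        have "S' * Q = S' * g' * P * minv g" by (simp add: Q_def mult_assoc_dim d dg del: minv_dim)
        then show ?thesis unfolding Sg DS by (simp add: mult_assoc_dim d dg del: minv_dim)
      qed
      have "positive_mat Q"
        unfolding positive_mat_iff
      proof (intro allI impI)
        fix x i assume "x < dim_row Q" "i < dim_col Q"
        then have xi: "x < N" "i < m" using Qc by auto
        obtain y where y: "y < N" "\<pi> y = i" using SD(5)[OF xi(2)] by blast
        have "0 < (Q * S') $$ (x,y)"
          using posC xi y unfolding QS[symmetric] by (auto simp: positive_mat_iff d carrier_matD[OF Qc])
        then show "0 < Q $$ (x,i)"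
          using MS[of Q x y] Qc xi y SD(4)[OF y(1)] by (simp add: zero_less_mult_iff)
      qed
      then have "Reach A (Q * S')"
        using Reach_weighted_split[OF RD S Qc _ SQ[unfolded S'_def]] by (simp add: S'_def)
      then show ?case by (simp add: QS g'_def)
    qed
    then show ?thesis using Y'c Y'off Y'zero(1) by blast
  qed
  show ?thesis unfolding spreadable_def using Cc Cn main by blast
qed

lemma spreadable_ups:
  assumes "vertex A" "up\<^sup>*\<^sup>* A E" shows "spreadable A E"
  using assms(2) by (induction rule: rtranclp_induct) (auto intro: spreadable_refl[OF assms(1)] spreadable_up)

text \<open>
  The conjugates \<open>\<gamma> \<tau> * E * minv (\<gamma> \<tau>)\<close> are reached from \<open>A\<close> and the conjugates \<open>Z t\<close> of \<open>E\<close> are reached from \<open>B\<close>,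
  for small parameters. A fixed conjugate of the first kind is also reached from \<open>B\<close>: for \<open>t\<close> small enough,
  two segments of positive conjugates lead to it from \<open>Z t\<close>.
\<close>

lemma sse_pos_of_common_peak:
  assumes A: "vertex A" and B: "vertex B" and up: "up\<^sup>*\<^sup>* A E" "up\<^sup>*\<^sup>* B\<^sup>T E\<^sup>T"
  shows "sse_pos A B"
proof -
  obtain n where E: "E \<in> carrier_mat n n" "nonneg_mat E"
    using spreadable_ups[OF A up(1)] by (auto simp: spreadable_def)
  note dE = carrier_matD[OF E(1)]
  have ET: "E\<^sup>T \<in> carrier_mat n n" "nonneg_mat E\<^sup>T" using E by auto
  have one: "(1::real) \<le> 1" by simp
  obtain Y where Y1: "Y \<in> carrier_mat n n"
    and "\<And>i j. i < n \<Longrightarrow> j < n \<Longrightarrow> i \<noteq> j \<Longrightarrow> 0 \<le> Y $$ (i,j)"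
    and Y2: "\<And>a b. a < n \<Longrightarrow> b < n \<Longrightarrow> E $$ (a,b) = 0 \<Longrightarrow> 1 * (E * Y) $$ (a,b) < (Y * E) $$ (a,b)"
    and Y3: "\<forall>\<^sub>F t in at_right 0. Reach A (one_plus n t Y * E * minv (one_plus n t Y))"
    by (rule spreadableE[OF spreadable_ups[OF A up(1)] E(1) one]) (rule that; blast)
  note Y = Y1 Y2[unfolded mult_1] Y3
  obtain Y' where Y1': "Y' \<in> carrier_mat n n"
    and "\<And>i j. i < n \<Longrightarrow> j < n \<Longrightarrow> i \<noteq> j \<Longrightarrow> 0 \<le> Y' $$ (i,j)"
    and Y2': "\<And>a b. a < n \<Longrightarrow> b < n \<Longrightarrow> E\<^sup>T $$ (a,b) = 0 \<Longrightarrow> 1 * (E\<^sup>T * Y') $$ (a,b) < (Y' * E\<^sup>T) $$ (a,b)"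
    and Y3': "\<forall>\<^sub>F t in at_right 0. Reach B\<^sup>T (one_plus n t Y' * E\<^sup>T * minv (one_plus n t Y'))"
    by (rule spreadableE[OF spreadable_ups[OF vertex_transpose[OF B] up(2)] ET(1) one]) (rule that; blast)
  note Y' = Y1' Y2'[unfolded mult_1] Y3'
  have t0: "((\<lambda>t::real. t) \<longlongrightarrow> 0) (at_right 0)" by (rule tendsto_ident_at)
  have tpos: "\<forall>\<^sub>F t in at_right (0::real). 0 < t" by (simp add: eventually_at_right_less)
  define \<gamma> where "\<gamma> \<tau> = one_plus n \<tau> Y" for \<tau>
  have d\<gamma>: "dim_row (\<gamma> \<tau>) = n" "dim_col (\<gamma> \<tau>) = n" for \<tau> using Y(1) by (simp_all add: \<gamma>_def)
  have \<gamma>0: "\<gamma> 0 = 1\<^sub>m n" unfolding \<gamma>_def by (rule one_plus_zero[OF Y(1)])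
  \<comment> \<open>Transposition turns conjugation of the transpose of \<open>E\<close> by a matrix into conjugation of \<open>E\<close> by
    its inverse transpose.\<close>
  define g where "g t = (minv (one_plus n t Y'))\<^sup>T" for t
  define g' where "g' t = (one_plus n t Y')\<^sup>T" for t
  have dg: "dim_row (g t) = n" "dim_col (g t) = n" "dim_row (g' t) = n" "dim_col (g' t) = n" for t
    using Y'(1) by (simp_all add: g_def g'_def)
  define Z where "Z t = g t * E * g' t" for t
  have Zc: "Z t \<in> carrier_mat n n" for t by (auto simp: Z_def dg intro!: carrier_matI)
  have Ylim: "mlim (\<lambda>t. one_plus n t Y') (1\<^sub>m n) (at_right 0)" by (rule mlim_one_plus_one[OF Y'(1) t0])
  have glim: "mlim g (1\<^sub>m n) (at_right 0)" "mlim g' (1\<^sub>m n) (at_right 0)"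
    unfolding g_def g'_def using mlim_transpose[OF mlim_minv_one[OF Ylim]] mlim_transpose[OF Ylim] by simp_all
  have Zlim: "mlim Z E (at_right 0)" unfolding Z_def by (rule mlim_conjugate[OF glim E(1)])
  have Ztr: "Z t = (one_plus n t Y' * E\<^sup>T * minv (one_plus n t Y'))\<^sup>T" for t
    using Y'(1) by (simp add: Z_def g_def g'_def transpose_mult_dim mult_assoc_dim dE)
  have "\<forall>\<^sub>F t in at_right 0. inverses n (one_plus n t Y') (minv (one_plus n t Y'))
     \<and> positive_mat (one_plus n t Y' * E\<^sup>T * minv (one_plus n t Y'))"
    by (rule eventually_positive_conjugates[OF ET Y'(1,2) t0 tpos mlim_const always_eventually]) (use ET in auto)
  then have evB: "\<forall>\<^sub>F t in at_right 0. inverses n (g t) (g' t) \<and> positive_mat (Z t) \<and> Reach B (Z t)"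
    using Y'(3)
  proof eventually_elim
    case (elim t)
    have "inverses n (g t) (g' t)"
      unfolding g_def g'_def using elim(1) by (blast intro: inverses_transpose[OF inverses_sym])
    moreover have "positive_mat (Z t)" using elim(1) unfolding Ztr by simp
    moreover have "Reach B (Z t)" using Reach_transpose[OF elim(2)] unfolding Ztr by simp
    ultimately show ?case by blast
  qed
  \<comment> \<open>Conjugating \<open>Z t\<close> by \<open>\<gamma> \<tau>'\<close> keeps it positive for all \<open>\<tau>' \<le> \<tau>\<close>, with a bound on \<open>\<tau>\<close> that does not
    depend on \<open>t\<close>: a product filter expresses this uniformity.\<close>
  let ?F = "at_right (0::real) \<times>\<^sub>F at_right (0::real)"
  have "\<forall>\<^sub>F p in ?F. inverses n (one_plus n (fst p) Y) (minv (one_plus n (fst p) Y))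
     \<and> positive_mat (one_plus n (fst p) Y * Z (snd p) * minv (one_plus n (fst p) Y))"
  proof (rule eventually_positive_conjugates[OF E Y(1,2)])
    show "(fst \<longlongrightarrow> 0) ?F" by (rule filterlim_compose[OF t0 filterlim_fst])
    show "\<forall>\<^sub>F p in ?F. 0 < fst p" by (rule eventually_compose_filterlim[OF tpos filterlim_fst])
    show "mlim (\<lambda>p. Z (snd p)) E ?F" by (rule mlim_compose[OF Zlim filterlim_snd])
    have "\<forall>\<^sub>F t in at_right 0. nonneg_mat (Z t)"
      using evB by eventually_elim (simp add: positive_imp_nonneg)
    then show "\<forall>\<^sub>F p in ?F. nonneg_mat (Z (snd p))" by (rule eventually_compose_filterlim[OF _ filterlim_snd])
  qed
  then obtain P1 P2 where P1: "\<forall>\<^sub>F \<tau> in at_right 0. P1 \<tau>" and P2: "\<forall>\<^sub>F t in at_right 0. P2 t"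
    and P12: "\<And>\<tau> t. P1 \<tau> \<Longrightarrow> P2 t \<Longrightarrow> inverses n (\<gamma> \<tau>) (minv (\<gamma> \<tau>)) \<and> positive_mat (\<gamma> \<tau> * Z t * minv (\<gamma> \<tau>))"
    unfolding eventually_prod_filter \<gamma>_def by auto
  have "\<forall>\<^sub>F \<tau> in at_right 0. inverses n (\<gamma> \<tau>) (minv (\<gamma> \<tau>)) \<and> positive_mat (\<gamma> \<tau> * E * minv (\<gamma> \<tau>))"
    unfolding \<gamma>_def
    by (rule eventually_positive_conjugates[OF E Y(1,2) t0 tpos mlim_const always_eventually]) (use E in auto)
  then have "\<forall>\<^sub>F \<tau> in at_right 0. P1 \<tau> \<and> inverses n (\<gamma> \<tau>) (minv (\<gamma> \<tau>)) \<and> positive_mat (\<gamma> \<tau> * E * minv (\<gamma> \<tau>))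
      \<and> Reach A (\<gamma> \<tau> * E * minv (\<gamma> \<tau>))"
    using P1 Y(3) unfolding \<gamma>_def[symmetric] by eventually_elim blast
  then obtain b where b: "b > 0" "\<And>\<tau>. 0 < \<tau> \<Longrightarrow> \<tau> < b \<Longrightarrow> P1 \<tau> \<and> inverses n (\<gamma> \<tau>) (minv (\<gamma> \<tau>))
      \<and> positive_mat (\<gamma> \<tau> * E * minv (\<gamma> \<tau>)) \<and> Reach A (\<gamma> \<tau> * E * minv (\<gamma> \<tau>))"
    unfolding eventually_at_right_field by blast
  define \<tau> where "\<tau> = b / 2"
  have \<tau>: "0 < \<tau>" "\<tau> < b" using b(1) by (auto simp: \<tau>_def)
  define G where "G = \<gamma> \<tau>"
  define G' where "G' = minv (\<gamma> \<tau>)"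
  have G: "inverses n G G'" "positive_mat (G * E * G')" "Reach A (G * E * G')"
    using b(2)[OF \<tau>] by (auto simp: G_def G'_def)
  note dG = inversesD(1-4)[OF G(1)]
  \<comment> \<open>With \<open>\<tau>\<close> fixed, the inner conjugator \<open>g t\<close> is contracted to the identity along a segment. The
    conjugates stay near the positive matrix \<open>G * E * G'\<close>, uniformly along the segment, if \<open>t\<close> is small.\<close>
  define k where "k t u = 1\<^sub>m n + u \<cdot>\<^sub>m (g t - 1\<^sub>m n)" for t u :: real
  have dk: "dim_row (k t u) = n" "dim_col (k t u) = n" for t u by (simp_all add: k_def)
  let ?H = "at_right (0::real) \<times>\<^sub>F principal {0..1::real}"
  have bounded: "\<forall>\<^sub>F p in ?H. snd p \<in> {0..1}"
    by (rule eventually_compose_filterlim[OF _ filterlim_snd]) (simp add: eventually_principal)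
  have klim: "mlim (\<lambda>p. k (fst p) (snd p)) (1\<^sub>m n) ?H"
    unfolding mlim_def
  proof (intro conjI allI impI)
    fix i j assume ij: "i < dim_row (1\<^sub>m n :: real mat)" "j < dim_col (1\<^sub>m n :: real mat)"
    have "((\<lambda>p. g (fst p) $$ (i,j)) \<longlongrightarrow> 1\<^sub>m n $$ (i,j)) ?H"
      using mlimD(3)[OF mlim_compose[OF glim(1) filterlim_fst] ij] .
    then have "((\<lambda>p. g (fst p) $$ (i,j) - 1\<^sub>m n $$ (i,j)) \<longlongrightarrow> 0) ?H" by (simp only: LIM_zero)
    then have "((\<lambda>p. snd p * (g (fst p) $$ (i,j) - 1\<^sub>m n $$ (i,j))) \<longlongrightarrow> 0) ?H"
    proof (rule tendsto_0_le[where K = 1])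
      show "\<forall>\<^sub>F p in ?H. norm (snd p * (g (fst p) $$ (i,j) - 1\<^sub>m n $$ (i,j)))
          \<le> norm (g (fst p) $$ (i,j) - 1\<^sub>m n $$ (i,j)) * 1"
        using bounded by eventually_elim (auto simp: abs_mult intro!: mult_left_le_one_le)
    qed
    from tendsto_add[OF tendsto_const this, of "1\<^sub>m n $$ (i,j)"]
    show "((\<lambda>p. k (fst p) (snd p) $$ (i,j)) \<longlongrightarrow> 1\<^sub>m n $$ (i,j)) ?H"
      using ij by (simp add: k_def dg)
  qed (simp_all add: dk)
  have "\<forall>\<^sub>F p in ?H. inverses n (k (fst p) (snd p)) (minv (k (fst p) (snd p)))"
    by (rule eventually_inverses[OF klim]) auto
  moreover have "\<forall>\<^sub>F p in ?H. positive_mat (G * (k (fst p) (snd p) * E * minv (k (fst p) (snd p))) * G')"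
    by (rule eventually_positive_entries[OF _ G(2)],
        intro mlim_mult mlim_const mlim_conjugate[OF klim mlim_minv_one[OF klim] E(1)])
       (auto simp: dG dE)
  ultimately have "\<forall>\<^sub>F p in ?H. inverses n (k (fst p) (snd p)) (minv (k (fst p) (snd p)))
      \<and> positive_mat (G * (k (fst p) (snd p) * E * minv (k (fst p) (snd p))) * G')"
    by (rule eventually_conj)
  then obtain Q1 Q2 where Q1: "\<forall>\<^sub>F t in at_right 0. Q1 t" and Q2: "\<forall>\<^sub>F u in principal {0..1}. Q2 u"
    and Q12: "\<And>t u. Q1 t \<Longrightarrow> Q2 u \<Longrightarrow> inverses n (k t u) (minv (k t u))
      \<and> positive_mat (G * (k t u * E * minv (k t u)) * G')"
    unfolding eventually_prod_filter by auto
  have Q2': "Q2 u" if "u \<in> {0..1}" for u using Q2 that by (simp add: eventually_principal)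
  have "\<forall>\<^sub>F t in at_right 0. P2 t \<and> Q1 t \<and> inverses n (g t) (g' t) \<and> positive_mat (Z t) \<and> Reach B (Z t)"
    using P2 Q1 evB by eventually_elim blast
  from eventually_happens'[OF _ this] obtain t where
    t: "P2 t" "Q1 t" "inverses n (g t) (g' t)" "positive_mat (Z t)" "Reach B (Z t)" by auto
  note kt = Q12[OF t(2) Q2']
  have RB1: "Reach B (G * Z t * G')"
  proof -
    have cont: "((\<lambda>s. s * \<tau>) \<longlongrightarrow> s * \<tau>) (at s within {0..1})" for s by (intro tendsto_intros)
    have inv: "inverses n (\<gamma> (s * \<tau>)) (minv (\<gamma> (s * \<tau>)))
        \<and> positive_mat (\<gamma> (s * \<tau>) * Z t * minv (\<gamma> (s * \<tau>)))" if "s \<in> {0..1}" for s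
    proof (cases "s = 0")
      case True
      then show ?thesis using t(4) Zc[of t] by (simp add: \<gamma>0 minv_one inverses_one mat_dim)
    next
      case False
      have "s * \<tau> \<le> 1 * \<tau>" using that \<tau> by (intro mult_right_mono) auto
      then have "s * \<tau> < b" using \<tau> by linarith
      moreover have "0 < s * \<tau>" using False that \<tau> by simp
      ultimately have "P1 (s * \<tau>)" using b(2) by blast
      then show ?thesis using P12 t(1) by blast
    qed
    have lim: "mlim (\<lambda>s. \<gamma> (s * \<tau>)) (\<gamma> (s * \<tau>)) (at s within {0..1})" for s
      unfolding \<gamma>_def by (rule mlim_one_plus[OF Y(1) cont])
    have "Reach B (\<gamma> (1 * \<tau>) * Z t * minv (\<gamma> (1 * \<tau>)))"
    proof (rule Reach_path[OF Zc, where g = "\<lambda>s. \<gamma> (s * \<tau>)" and g' = "\<lambda>s. minv (\<gamma> (s * \<tau>))"])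
      show "Reach B (\<gamma> (0 * \<tau>) * Z t * minv (\<gamma> (0 * \<tau>)))"
        using t(5) Zc[of t] by (simp add: \<gamma>0 minv_one mat_dim)
      show "mlim (\<lambda>s. minv (\<gamma> (s * \<tau>))) (minv (\<gamma> (s * \<tau>))) (at s within {0..1})" if "s \<in> {0..1}" for s
        by (rule mlim_minv[OF lim]) (use inv[OF that] det_nonzero_of_inverses in \<open>auto simp: d\<gamma>\<close>)
    qed (use inv lim in auto)
    then show ?thesis by (simp add: G_def G'_def)
  qed
  have RB2: "Reach B (G * E * G')"
  proof -
    \<comment> \<open>The segment is traversed backwards, from \<open>g t\<close> to the identity.\<close>
    let ?h = "\<lambda>s. G * k t (1 - s)" and ?h' = "\<lambda>s. minv (k t (1 - s)) * G'"
    have k1: "k t 1 = g t" by (intro eq_matI) (auto simp: k_def dg)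
    have k0: "k t 0 = 1\<^sub>m n" by (intro eq_matI) (auto simp: k_def dg)
    have m: "1 - s \<in> {0..1}" if "s \<in> {0..1}" for s :: real using that by auto
    have conj: "?h s * E * ?h' s = G * (k t (1 - s) * E * minv (k t (1 - s))) * G'" for s
      by (simp add: mult_assoc_dim dG dk dE)
    have klim: "mlim (\<lambda>s. k t (1 - s)) (k t (1 - s)) (at s within {0..1})" for s
      unfolding k_def by (intro mlim_add mlim_const mlim_smult tendsto_intros) (auto simp: dg)
    have "Reach B (?h 1 * E * ?h' 1)"
    proof (rule Reach_path[OF E(1), where g = ?h and g' = ?h'])
      show "inverses n (?h s) (?h' s)" if "s \<in> {0..1}" for s
        using kt[OF m[OF that]] by (intro inverses_mult G) auto
      show "positive_mat (?h s * E * ?h' s)" if "s \<in> {0..1}" for s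
        using kt[OF m[OF that]] unfolding conj by auto
      show "mlim ?h (?h s) (at s within {0..1})" for s
        by (intro mlim_mult mlim_const klim) (simp add: dG dk)
      show "mlim ?h' (?h' s) (at s within {0..1})" if "s \<in> {0..1}" for s
      proof (intro mlim_mult mlim_const mlim_minv[OF klim])
        show "det (k t (1 - s)) \<noteq> 0" using kt[OF m[OF that]] det_nonzero_of_inverses by blast
      qed (simp_all add: dk dG)
      show "Reach B (?h 0 * E * ?h' 0)"
        using RB1 unfolding conj by (simp add: k1 minv_eqI[OF t(3)] Z_def)
    qed
    then show ?thesis unfolding conj by (simp add: k0 minv_one mat_dim dE)
  qed
  show ?thesis
    by (rule Reach_join[OF _ G(2,3) RB2]) (auto simp: dG intro!: carrier_matI)
qed

end

theorem theorem8p2: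
  fixes U :: "real set" and A B :: "real mat"
  assumes "real_subfield U"
    and "mat_over U A" and "positive_mat A"
    and "mat_over U B" and "positive_mat B"
    and "SSE {0..} A B"
  shows "SSE_through positive_mat (U \<inter> {0..}) A B"
proof -
  interpret real_subfield_loc U by (rule real_subfield_loc.intro) fact
  have dims: "square_mat A \<and> 0 < dim_row A \<and> square_mat B \<and> 0 < dim_row B"
  proof -
    obtain Ms where "Ms \<noteq> []" "hd Ms = A" "last Ms = B" "\<forall>M\<in>set Ms. square_mat M \<and> 0 < dim_row M"
      using assms(6) by (auto simp: SSE_through_def)
    then show ?thesis by (metis hd_in_set last_in_set)
  qed
  have A: "vertex A" and B: "vertex B" using assms dims by (auto simp: vertex_def)
  have Ac: "A \<in> carrier_mat (dim_row A) (dim_row A)" "B \<in> carrier_mat (dim_row B) (dim_row B)"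
    using dims by (auto intro!: carrier_matI)
  have "nondegenerate_step\<^sup>*\<^sup>* A B"
    by (rule nondegenerate_chain_of_SSE[OF assms(6,3) Ac(1) _ assms(5) Ac(2)]) (use dims in simp)
  from common_peak[OF this] obtain E where "up\<^sup>*\<^sup>* A E" "up\<^sup>*\<^sup>* B\<^sup>T E\<^sup>T" by blast
  then have "sse_pos A B" by (rule sse_pos_of_common_peak[OF A B])
  then show ?thesis by (rule SSE_through_of_sse_pos[OF A])
qed

end
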